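(* Suppose that $V$ is a matrix ordered operator space such that both $V$ and its dual space $V^*$ are operator systems with complete norm. Then $V$ is completely isomorphic and complete order isomorphic to a matrix regular operator space.
   Context: **Matrix ordered spaces.** A complex vector space $V$ is matrix ordered if: (i) $V$ is a $*$-vector space (it carries a conjugate-linear involution $*$), so that each $M_n(V)$, $n\ge 1$, is a $*$-vector space with $[v_{ij}]^*=[v_{ji}^*]$; (ii) each $M_n(V)$ is partially ordered by a (not necessarily proper) cone $M_n(V)^+\subset M_n(V)_{sa}$, where $M_n(V)_{sa}$ is the set of self-adjoint elements; (iii) $\alpha^* M_m(V)^+\alpha\subset M_n(V)^+$ for every scalar matrix $\alpha\in M_{m,n}$. For $v,w\in M_n(V)_{sa}$, $v\le w$ means $w-v\in M_n(V)^+$. The cone $M_n(V)^+$ is proper if $M_n(V)^+\cap -M_n(V)^+=\{0\}$. A matrix ordered operator space is a (complex, abstract) operator space $V$, with matrix norms $\|\cdot\|_n$ on $M_n(V)$, which is also a matrix ordered vector space, such that for every $n\in\mathbb N$ the $*$-operation is an isometry on $M_n(V)$ and the cone $M_n(V)^+$ is closed. "With complete norm" means that the space is complete in its norm. **Positive maps.** A positive map between such spaces is a $*$-preserving linear map sending positive elements to positive elements; it is completely positive if all its amplifications are positive. $CB(V,W)$ and $CP(V,W)$ denote the completely bounded and completely positive linear maps. **Dual.** The dual $V^*$ of a matrix ordered operator space $V$ is its operator space dual, with $M_n(V^* )=CB(V,M_n)$ isometrically, involution $f^*(v)=\overline{f(v^* )}$, and cones $M_n(V^* )^+=CB(V,M_n)\cap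 CP(V,M_n)$. It is a matrix ordered operator space. **Matrix regular operator space.** A matrix ordered operator space $V$ with complete norm is matrix regular if for each $n\in\mathbb N$ and all $v\in M_n(V)_{sa}$: (1) $u\in M_n(V)^+$ and $-u\le v\le u$ imply $\|v\|_n\le\|u\|_n$; (2) $\|v\|_n<1$ implies that there exists $u\in M_n(V)^+$ with $\|u\|_n<1$ and $-u\le v\le u$. **Operator system (in Werner's nonunital sense).** Let $X$ be a matrix ordered operator space with proper positive cones $M_n(X)^+$. For $x\in M_n(X)$ the modified numerical radius is $$\nu_X(x)=\sup\left\{\left|\varphi\begin{pmatrix}0 & x \\ x^* & 0\end{pmatrix}\right| : \varphi\in M_{2n}(X)^*_{1,+}\right\},$$ where $M_{2n}(X)^*_{1,+}$ is the set of positive contractive linear functionals on $M_{2n}(X)$. A matrix ordered operator space $X$ with proper positive cones is an operator system if there is $k>0$ such that $\|x\|_n\le k\,\nu_X(x)$ for all $n\in\mathbb N$ and $x\in M_n(X)$. No unit is assumed. **Isomorphism.** $V$ is completely isomorphic and complete order isomorphic to $W$ if there is a single linear bijection $\Phi:V\to W$ such that $\Phi$ and $\Phi^{-1}$ are both completely bounded and both completely positive. *)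

theory Defs
  imports
    "HOL-Analysis.Abstract_Metric_Spaces"
    "HOL-Analysis.L2_Norm"
    "HOL-Library.Function_Algebras"
    "Jordan_Normal_Form.Schur_Decomposition"
begin

section \<open>Scalar matrices\<close>

definition euclid_norm :: "complex vec \<Rightarrow> real" where
  "euclid_norm x = L2_set (\<lambda>i. cmod (x $ i)) {..<dim_vec x}"

definition op_norm :: "complex mat \<Rightarrow> real" where
  "op_norm A =
     Sup {euclid_norm (A *\<^sub>v x) | x. x \<in> carrier_vec (dim_col A) \<and> euclid_norm x \<le> 1}"

text \<open>The order on \<^typ>\<open>complex\<close> is the one of \<^theory>\<open>HOL-Library.Complex_Order\<close>:
  \<open>0 \<le> z\<close> means that \<open>z\<close> is real and nonnegative. Over the complex numbers this forces
  the matrix to be self-adjoint.\<close>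

definition psd :: "nat \<Rightarrow> complex mat \<Rightarrow> bool" where
  "psd n A \<longleftrightarrow> A \<in> carrier_mat n n \<and> (\<forall>x\<in>carrier_vec n. 0 \<le> (A *\<^sub>v x) \<bullet>c x)"


section \<open>Matrix ordered operator spaces\<close>

text \<open>The underlying vector space is a subspace \<open>vcarrier\<close> of an additive group \<^typ>\<open>'a\<close>
  on which \<open>vscale\<close> acts; a carrier is needed since the dual consists of certain functions only.
  Matrices are those of \<^theory>\<open>Jordan_Normal_Form.Matrix\<close>, so that \<open>mnorm\<close> reads the size off its
  argument. Only square matrices of positive size with entries in \<open>vcarrier\<close> matter.\<close>

record 'a mo_space =
  vcarrier :: "'a set"
  vscale :: "complex \<Rightarrow> 'a \<Rightarrow> 'a"
  vstar :: "'a \<Rightarrow> 'a"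
  mnorm :: "'a mat \<Rightarrow> real"
  mcone :: "nat \<Rightarrow> 'a mat set"

definition Mat :: "('a::ab_group_add) mo_space \<Rightarrow> nat \<Rightarrow> 'a mat set" where
  "Mat V n = {x \<in> carrier_mat n n. elements_mat x \<subseteq> vcarrier V}"

definition mscale :: "('a::ab_group_add) mo_space \<Rightarrow> complex \<Rightarrow> 'a mat \<Rightarrow> 'a mat" where
  "mscale V c x = map_mat (vscale V c) x"

definition mstar :: "('a::ab_group_add) mo_space \<Rightarrow> 'a mat \<Rightarrow> 'a mat" where
  "mstar V x = mat (dim_col x) (dim_row x) (\<lambda>(i, j). vstar V (x $$ (j, i)))"

definition Mat_sa :: "('a::ab_group_add) mo_space \<Rightarrow> nat \<Rightarrow> 'a mat set" where
  "Mat_sa V n = {x \<in> Mat V n. mstar V x = x}"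

text \<open>The product \<open>\<alpha> x \<beta>\<close> with scalar matrices \<open>\<alpha>\<close> and \<open>\<beta>\<close>.\<close>

definition bimult ::
  "('a::ab_group_add) mo_space \<Rightarrow> complex mat \<Rightarrow> 'a mat \<Rightarrow> complex mat \<Rightarrow> 'a mat" where
  "bimult V \<alpha> x \<beta> = mat (dim_row \<alpha>) (dim_col \<beta>) (\<lambda>(i, j).
     \<Sum>k<dim_row x. \<Sum>l<dim_col x. vscale V (\<alpha> $$ (i, k) * \<beta> $$ (l, j)) (x $$ (k, l)))"

text \<open>Set to \<open>0\<close> off \<open>Mat V n\<close> because \<^locale>\<open>Metric_space\<close> demands nonnegativity and
  symmetry on the whole type.\<close>

definition mdist :: "('a::ab_group_add) mo_space \<Rightarrow> nat \<Rightarrow> 'a mat \<Rightarrow> 'a mat \<Rightarrow> real" where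
  "mdist V n x y = (if x \<in> Mat V n \<and> y \<in> Mat V n then mnorm V (x - y) else 0)"

definition mle :: "('a::ab_group_add) mo_space \<Rightarrow> nat \<Rightarrow> 'a mat \<Rightarrow> 'a mat \<Rightarrow> bool" where
  "mle V n x y \<longleftrightarrow> x \<in> Mat_sa V n \<and> y \<in> Mat_sa V n \<and> y - x \<in> mcone V n"

definition star_vector_space :: "('a::ab_group_add) mo_space \<Rightarrow> bool" where
  "star_vector_space V \<longleftrightarrow>
     vector_space (vscale V) \<and> module.subspace (vscale V) (vcarrier V) \<and>
     (\<forall>v\<in>vcarrier V. vstar V v \<in> vcarrier V \<and> vstar V (vstar V v) = v) \<and>
     (\<forall>v\<in>vcarrier V. \<forall>w\<in>vcarrier V. vstar V (v + w) = vstar V v + vstar V w) \<and>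
     (\<forall>c. \<forall>v\<in>vcarrier V. vstar V (vscale V c v) = vscale V (cnj c) (vstar V v))"

definition matrix_ordered :: "('a::ab_group_add) mo_space \<Rightarrow> bool" where
  "matrix_ordered V \<longleftrightarrow>
     star_vector_space V \<and>
     (\<forall>n>0. mcone V n \<subseteq> Mat_sa V n \<and> 0\<^sub>m n n \<in> mcone V n \<and>
       (\<forall>x\<in>mcone V n. \<forall>y\<in>mcone V n. x + y \<in> mcone V n) \<and>
       (\<forall>t::real. \<forall>x\<in>mcone V n. 0 \<le> t \<longrightarrow> mscale V (complex_of_real t) x \<in> mcone V n)) \<and>
     (\<forall>m>0. \<forall>n>0. \<forall>\<alpha>\<in>carrier_mat m n. \<forall>x\<in>mcone V m.
        bimult V (mat_adjoint \<alpha>) x \<alpha> \<in> mcone V n)"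

definition proper_cones :: "('a::ab_group_add) mo_space \<Rightarrow> bool" where
  "proper_cones V \<longleftrightarrow> (\<forall>n>0. mcone V n \<inter> uminus ` mcone V n = {0\<^sub>m n n})"

text \<open>Abstract operator spaces, by Ruan's axioms.\<close>

definition operator_space :: "('a::ab_group_add) mo_space \<Rightarrow> bool" where
  "operator_space V \<longleftrightarrow>
     vector_space (vscale V) \<and> module.subspace (vscale V) (vcarrier V) \<and>
     (\<forall>n>0. \<forall>x\<in>Mat V n. 0 \<le> mnorm V x \<and> (mnorm V x = 0 \<longleftrightarrow> x = 0\<^sub>m n n) \<and>
       (\<forall>c. mnorm V (mscale V c x) = cmod c * mnorm V x) \<and>
       (\<forall>y\<in>Mat V n. mnorm V (x + y) \<le> mnorm V x + mnorm V y)) \<and>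
     (\<forall>m>0. \<forall>n>0. \<forall>x\<in>Mat V m. \<forall>y\<in>Mat V n.
        mnorm V (four_block_mat x (0\<^sub>m m n) (0\<^sub>m n m) y) = max (mnorm V x) (mnorm V y)) \<and>
     (\<forall>m>0. \<forall>n>0. \<forall>x\<in>Mat V m. \<forall>\<alpha>\<in>carrier_mat n m. \<forall>\<beta>\<in>carrier_mat m n.
        mnorm V (bimult V \<alpha> x \<beta>) \<le> op_norm \<alpha> * mnorm V x * op_norm \<beta>)"

definition matrix_ordered_operator_space :: "('a::ab_group_add) mo_space \<Rightarrow> bool" where
  "matrix_ordered_operator_space V \<longleftrightarrow>
     operator_space V \<and> matrix_ordered V \<and>
     (\<forall>n>0. \<forall>x\<in>Mat V n. mnorm V (mstar V x) = mnorm V x) \<and>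
     (\<forall>n>0. closedin (Metric_space.mtopology (Mat V n) (mdist V n)) (mcone V n))"

text \<open>The norm of the space itself is its first matrix norm.\<close>

definition complete_norm :: "('a::ab_group_add) mo_space \<Rightarrow> bool" where
  "complete_norm V \<longleftrightarrow> Metric_space.mcomplete (Mat V 1) (mdist V 1)"

definition matrix_regular :: "('a::ab_group_add) mo_space \<Rightarrow> bool" where
  "matrix_regular V \<longleftrightarrow>
     matrix_ordered_operator_space V \<and> complete_norm V \<and>
     (\<forall>n>0. \<forall>v\<in>Mat_sa V n.
        (\<forall>u\<in>mcone V n. mle V n (- u) v \<and> mle V n v u \<longrightarrow> mnorm V v \<le> mnorm V u) \<and>
        (mnorm V v < 1 \<longrightarrow> (\<exists>u\<in>mcone V n. mnorm V u < 1 \<and> mle V n (- u) v \<and> mle V n v u)))"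


section \<open>Completely bounded and completely positive maps\<close>

definition linear_map ::
  "('a::ab_group_add) mo_space \<Rightarrow> ('b::ab_group_add) mo_space \<Rightarrow> ('a \<Rightarrow> 'b) \<Rightarrow> bool" where
  "linear_map V W \<Phi> \<longleftrightarrow>
     \<Phi> ` vcarrier V \<subseteq> vcarrier W \<and>
     (\<forall>v\<in>vcarrier V. \<forall>w\<in>vcarrier V. \<Phi> (v + w) = \<Phi> v + \<Phi> w) \<and>
     (\<forall>c. \<forall>v\<in>vcarrier V. \<Phi> (vscale V c v) = vscale W c (\<Phi> v))"

definition completely_bounded ::
  "('a::ab_group_add) mo_space \<Rightarrow> ('b::ab_group_add) mo_space \<Rightarrow> ('a \<Rightarrow> 'b) \<Rightarrow> bool" where
  "completely_bounded V W \<Phi> \<longleftrightarrow>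
     linear_map V W \<Phi> \<and> (\<exists>K. \<forall>n>0. \<forall>x\<in>Mat V n. mnorm W (map_mat \<Phi> x) \<le> K * mnorm V x)"

definition completely_positive ::
  "('a::ab_group_add) mo_space \<Rightarrow> ('b::ab_group_add) mo_space \<Rightarrow> ('a \<Rightarrow> 'b) \<Rightarrow> bool" where
  "completely_positive V W \<Phi> \<longleftrightarrow>
     linear_map V W \<Phi> \<and> (\<forall>v\<in>vcarrier V. \<Phi> (vstar V v) = vstar W (\<Phi> v)) \<and>
     (\<forall>n>0. \<forall>x\<in>mcone V n. map_mat \<Phi> x \<in> mcone W n)"

definition complete_order_isomorphism ::
  "('a::ab_group_add) mo_space \<Rightarrow> ('b::ab_group_add) mo_space \<Rightarrow> ('a \<Rightarrow> 'b) \<Rightarrow> bool" where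
  "complete_order_isomorphism V W \<Phi> \<longleftrightarrow>
     bij_betw \<Phi> (vcarrier V) (vcarrier W) \<and>
     completely_bounded V W \<Phi> \<and> completely_positive V W \<Phi> \<and>
     completely_bounded W V (inv_into (vcarrier V) \<Phi>) \<and>
     completely_positive W V (inv_into (vcarrier V) \<Phi>)"


section \<open>The dual\<close>

text \<open>Bounded linear functionals, normalized to vanish off the carrier so that
  functionals which agree on the space are equal.\<close>

definition bounded_functionals :: "('a::ab_group_add) mo_space \<Rightarrow> ('a \<Rightarrow> complex) set" where
  "bounded_functionals V = {f.
     (\<forall>v\<in>vcarrier V. \<forall>w\<in>vcarrier V. f (v + w) = f v + f w) \<and>
     (\<forall>c. \<forall>v\<in>vcarrier V. f (vscale V c v) = c * f v) \<and>
     (\<exists>K. \<forall>v\<in>vcarrier V. cmod (f v) \<le> K * mnorm V (mat 1 1 (\<lambda>_. v))) \<and>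
     (\<forall>v. v \<notin> vcarrier V \<longrightarrow> f v = 0)}"

text \<open>A matrix \<open>F = [f\<^sub>i\<^sub>j]\<close> of functionals is identified with the map \<open>v \<mapsto> [f\<^sub>i\<^sub>j(v)]\<close> into \<open>M\<^sub>n\<close>.
  Since bounded maps into \<open>M\<^sub>n\<close> are completely bounded, the matrices with bounded entries
  are exactly \<open>CB(V, M\<^sub>n)\<close>.\<close>

definition induced_map :: "('a \<Rightarrow> complex) mat \<Rightarrow> 'a \<Rightarrow> complex mat" where
  "induced_map F v = map_mat (\<lambda>f. f v) F"

text \<open>The \<open>m\<close>-th amplification of the induced map, where \<open>M\<^sub>m(M\<^sub>n)\<close> is identified with
  \<open>M\<^sub>m\<^sub>n\<close>: the \<open>(k, l)\<close> block of size \<open>n\<close> is the value at \<open>x $$ (k, l)\<close>.\<close>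

definition amplification :: "('a \<Rightarrow> complex) mat \<Rightarrow> 'a mat \<Rightarrow> complex mat" where
  "amplification F x = (let n = dim_row F; m = dim_row x in
     mat (m * n) (m * n) (\<lambda>(i, j).
       induced_map F (x $$ (i div n, j div n)) $$ (i mod n, j mod n)))"

definition cb_norm :: "('a::ab_group_add) mo_space \<Rightarrow> ('a \<Rightarrow> complex) mat \<Rightarrow> real" where
  "cb_norm V F =
     Sup {op_norm (amplification F x) | m x. 0 < m \<and> x \<in> Mat V m \<and> mnorm V x \<le> 1}"

definition dual :: "('a::ab_group_add) mo_space \<Rightarrow> ('a \<Rightarrow> complex) mo_space" where
  "dual V = \<lparr>
     vcarrier = bounded_functionals V,
     vscale = (\<lambda>c f v. c * f v),
     vstar = (\<lambda>f v. if v \<in> vcarrier V then cnj (f (vstar V v)) else 0),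
     mnorm = cb_norm V,
     mcone = (\<lambda>n. {F \<in> carrier_mat n n. elements_mat F \<subseteq> bounded_functionals V \<and>
       (\<forall>v\<in>vcarrier V. induced_map F (vstar V v) = mat_adjoint (induced_map F v)) \<and>
       (\<forall>m>0. \<forall>x\<in>mcone V m. psd (m * n) (amplification F x))})\<rparr>"


section \<open>Operator systems in the sense of Werner\<close>

text \<open>Positive contractive linear functionals on \<open>M\<^sub>n(V)\<close>.\<close>

definition positive_contractive ::
  "('a::ab_group_add) mo_space \<Rightarrow> nat \<Rightarrow> ('a mat \<Rightarrow> complex) \<Rightarrow> bool" where
  "positive_contractive V n \<phi> \<longleftrightarrow>
     (\<forall>x\<in>Mat V n. \<forall>y\<in>Mat V n. \<phi> (x + y) = \<phi> x + \<phi> y) \<and>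
     (\<forall>c. \<forall>x\<in>Mat V n. \<phi> (mscale V c x) = c * \<phi> x) \<and>
     (\<forall>x\<in>Mat V n. \<phi> (mstar V x) = cnj (\<phi> x)) \<and>
     (\<forall>x\<in>mcone V n. 0 \<le> \<phi> x) \<and>
     (\<forall>x\<in>Mat V n. cmod (\<phi> x) \<le> mnorm V x)"

definition num_radius :: "('a::ab_group_add) mo_space \<Rightarrow> nat \<Rightarrow> 'a mat \<Rightarrow> real" where
  "num_radius V n x =
     Sup {cmod (\<phi> (four_block_mat (0\<^sub>m n n) x (mstar V x) (0\<^sub>m n n))) | \<phi>.
       positive_contractive V (2 * n) \<phi>}"

definition operator_system :: "('a::ab_group_add) mo_space \<Rightarrow> bool" where
  "operator_system V \<longleftrightarrow>
     matrix_ordered_operator_space V \<and> proper_cones V \<and>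
     (\<exists>k>0. \<forall>n>0. \<forall>x\<in>Mat V n. mnorm V x \<le> k * num_radius V n x)"

end

theory Submission
  imports Defs
begin

text \<open>Let \<open>|||x|||\<close> be the infimum of \<open>max \<parallel>a\<parallel> \<parallel>b\<parallel>\<close> over all positive \<open>2 \<times> 2\<close> block matrices
  with diagonal \<open>a, b\<close> and corner \<open>x\<close>. Wherever this is a norm it is a matrix regular operator space norm:
  \<open>-u \<le> v \<le> u\<close> says that the block matrix with diagonal \<open>u, u\<close> and corner \<open>v\<close> is positive, and conversely
  the average \<open>u = (a + b)/2\<close> dominates \<open>\<plusminus>v\<close>. So \<open>V\<close> with \<open>|||\<cdot>|||\<close> is the required space as soon as
  \<open>|||\<cdot>|||\<close> is equivalent to the given norm.

  A positive functional sees the corner of a positive block matrix through its diagonal, hence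
  \<open>\<nu>(x) \<le> |||x|||\<close>; since \<open>V\<close> is an operator system, \<open>\<parallel>x\<parallel> \<le> k |||x|||\<close>.

  The reverse estimate comes from the dual. If \<open>\<parallel>F(y)\<parallel> \<le> 1\<close> for all positive contractions \<open>y\<close>, then the
  functional of the self-adjoint \<open>2 \<times> 2\<close> block matrix with corner \<open>F\<close> is dominated, on positive elements, by the
  dual (trace class) norm, because positive elements have positive factorizations \<open>\<gamma> y \<gamma>\<^sup>*\<close>
  of the same size. A Hahn-Banach sandwich gives a cb-contraction above it, so the numerical radius of
  \<open>F\<close> is at most \<open>1\<close> and \<open>\<parallel>F\<parallel> \<le> k'\<close>. A second Hahn-Banach argument, which produces densities
  \<open>P, Q\<close> together with the functional in the manner of Effros and Ruan, turns this into the statement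
  that every contraction \<open>x\<close> is within \<open>1/2\<close> of some \<open>\<alpha> y \<beta>\<close> with \<open>y\<close> a positive contraction and
  \<open>\<parallel>\<alpha>\<parallel>\<^sup>2, \<parallel>\<beta>\<parallel>\<^sup>2 \<le> 2 k'\<close>. Iterating and using completeness makes the approximation exact.\<close>

text \<open>Products of norms of scalar factors are not convex. The mean of the squared
  Hilbert-Schmidt norms replaces them: it adds up when two factorizations are joined over a direct
  sum, and moving a positive scalar from one factor to the other recovers the product. Both
  separations use convex cones of pairs (vector, real bound) that lie over the whole space. The
  gauges in question are infima over factorizations, and the cones merely collect these. A
  functional dominated only on \<open>\<alpha> y \<beta>\<close> with \<open>y\<close> a positive
  contraction need not be bounded, and such products need not reach every direction. Hence the
  positive contractions are thickened by a ball of radius \<open>d\<close>. This makes the second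
  cone total and its minorants bounded; the price is the error that the iteration removes. The
  constants fit as follows, with \<open>k\<close> the constant of the dual. Separation yields a
  value of at least \<open>4 * k\<close> at \<open>x0\<close>. The densities have mass at most 1
  each, and the shift making their roots invertible adds 1/2 each, so the squared Hilbert-Schmidt
  norms of the roots sum to at most 3. Half of the functional has cb-norm at most \<open>k\<close>,
  and \<open>2 * k \<le> 3 * k / 2\<close> is absurd.\<close>

unbundle no vec_syntax

section \<open>Scalar matrices\<close>

definition sqnorm :: "complex vec \<Rightarrow> real" where
  "sqnorm x = (\<Sum>i<dim_vec x. (cmod (x $ i))\<^sup>2)"

definition hs_sqnorm :: "complex mat \<Rightarrow> real" where
  "hs_sqnorm A = (\<Sum>i<dim_row A. \<Sum>j<dim_col A. (cmod (A $$ (i, j)))\<^sup>2)"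

text \<open>Norms of vectors and scalar matrices are kept squared: \<open>sq_bounded c A\<close> says that \<open>\<parallel>A\<parallel>\<^sup>2 \<le> c\<close>.\<close>

definition sq_bounded :: "real \<Rightarrow> complex mat \<Rightarrow> bool" where
  "sq_bounded c A \<longleftrightarrow> (\<forall>x\<in>carrier_vec (dim_col A). sqnorm (A *\<^sub>v x) \<le> c * sqnorm x)"

lemma euclid_norm_sqnorm: "euclid_norm x = sqrt (sqnorm x)"
  by (simp add: euclid_norm_def L2_set_def sqnorm_def)

lemma sqnorm_nonneg [simp]: "0 \<le> sqnorm x"
  by (simp add: sqnorm_def sum_nonneg)

lemma hs_sqnorm_nonneg [simp]: "0 \<le> hs_sqnorm x"
  by (simp add: hs_sqnorm_def sum_nonneg)

lemma mult_mat_vec_index: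
  assumes "A \<in> carrier_mat n m" "x \<in> carrier_vec m" "i < n"
  shows "(A *\<^sub>v x) $ i = (\<Sum>k<m. A $$ (i, k) * x $ k)"
  using assms by (simp add: scalar_prod_def atLeast0LessThan)

lemma mult_mat_index:
  assumes "A \<in> carrier_mat n m" "B \<in> carrier_mat m p" "i < n" "j < p"
  shows "(A * B) $$ (i, j) = (\<Sum>k<m. A $$ (i, k) * B $$ (k, j))"
  using assms by (simp add: scalar_prod_def atLeast0LessThan)

lemma dim_adjoint [simp]:
  "dim_row (mat_adjoint (A::complex mat)) = dim_col A" "dim_col (mat_adjoint A) = dim_row A"
  by (simp_all add: mat_adjoint_def)

lemma adjoint_carrier [simp]: "A \<in> carrier_mat n m \<Longrightarrow> mat_adjoint (A::complex mat) \<in> carrier_mat m n"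
  by (rule carrier_matI) auto

lemma adjoint_index [simp]:
  "i < dim_col A \<Longrightarrow> j < dim_row A \<Longrightarrow> mat_adjoint (A::complex mat) $$ (i, j) = cnj (A $$ (j, i))"
  by (simp add: mat_adjoint_def mat_of_rows_index)

lemma adjoint_adjoint [simp]: "mat_adjoint (mat_adjoint (A::complex mat)) = A"
  by (intro eq_matI) auto

lemma adjoint_mult:
  "A \<in> carrier_mat n m \<Longrightarrow> B \<in> carrier_mat m p \<Longrightarrow>
    mat_adjoint (A * B :: complex mat) = mat_adjoint B * mat_adjoint A"
  by (intro eq_matI) (auto simp: scalar_prod_def ac_simps)

lemma adjoint_add:
  "A \<in> carrier_mat n m \<Longrightarrow> B \<in> carrier_mat n m \<Longrightarrow>
    mat_adjoint (A + B :: complex mat) = mat_adjoint A + mat_adjoint B"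
  by (intro eq_matI) auto

lemma adjoint_smult: "mat_adjoint (c \<cdot>\<^sub>m A :: complex mat) = cnj c \<cdot>\<^sub>m mat_adjoint A"
  by (intro eq_matI) auto

lemma adjoint_one [simp]: "mat_adjoint (1\<^sub>m n :: complex mat) = 1\<^sub>m n"
  by (intro eq_matI) auto

lemma cscalar_prod_sum:
  "dim_vec x = n \<Longrightarrow> dim_vec y = n \<Longrightarrow> x \<bullet>c y = (\<Sum>i<n. x $ i * cnj (y $ i))" for x y :: "complex vec"
  by (simp add: scalar_prod_def atLeast0LessThan)

lemma cscalar_prod_self: "x \<bullet>c x = complex_of_real (sqnorm x)"
  by (simp add: cscalar_prod_sum sqnorm_def complex_norm_square[symmetric] of_real_power[symmetric] del: of_real_power)

lemma cmod_sum_mult_le: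
  "(cmod (\<Sum>i\<in>I. f i * g i))\<^sup>2 \<le> (\<Sum>i\<in>I. (cmod (f i))\<^sup>2) * (\<Sum>i\<in>I. (cmod (g i))\<^sup>2)"
proof -
  have "cmod (\<Sum>i\<in>I. f i * g i) \<le> (\<Sum>i\<in>I. cmod (f i) * cmod (g i))"
    by (rule order_trans[OF norm_sum]) (simp add: norm_mult)
  then have "(cmod (\<Sum>i\<in>I. f i * g i))\<^sup>2 \<le> (\<Sum>i\<in>I. cmod (f i) * cmod (g i))\<^sup>2"
    by (simp add: power_mono)
  also have "\<dots> \<le> (\<Sum>i\<in>I. (cmod (f i))\<^sup>2) * (\<Sum>i\<in>I. (cmod (g i))\<^sup>2)"
    by (rule Cauchy_Schwarz_ineq_sum)
  finally show ?thesis .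
qed

lemma cscalar_prod_le:
  fixes x y :: "complex vec"
  assumes "dim_vec x = n" "dim_vec y = n"
  shows "(cmod (x \<bullet>c (y :: complex vec)))\<^sup>2 \<le> sqnorm x * sqnorm y"
  using cmod_sum_mult_le[of "\<lambda>i. x $ i" "\<lambda>i. cnj (y $ i)" "{..<n}"] assms
  by (simp add: cscalar_prod_sum[OF assms] sqnorm_def)

lemma cscalar_prod_adjoint:
  fixes x y :: "complex vec"
  assumes "A \<in> carrier_mat n m" "x \<in> carrier_vec m" "y \<in> carrier_vec n"
  shows "(A *\<^sub>v x) \<bullet>c y = x \<bullet>c (mat_adjoint A *\<^sub>v y)"
proof -
  have "(A *\<^sub>v x) \<bullet>c y = (\<Sum>i<n. \<Sum>k<m. A $$ (i, k) * x $ k * cnj (y $ i))"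
    using assms by (subst cscalar_prod_sum[where n=n]) (auto simp: mult_mat_vec_index sum_distrib_right simp del: index_mult_mat_vec)
  also have "\<dots> = (\<Sum>k<m. \<Sum>i<n. A $$ (i, k) * x $ k * cnj (y $ i))"
    by (rule sum.swap)
  also have "\<dots> = x \<bullet>c (mat_adjoint A *\<^sub>v y)"
  proof -
    have "(\<Sum>i<n. A $$ (i, k) * x $ k * cnj (y $ i)) = x $ k * cnj ((mat_adjoint A *\<^sub>v y) $ k)" if "k < m" for k
    proof -
      have "(mat_adjoint A *\<^sub>v y) $ k = (\<Sum>i<n. cnj (A $$ (i, k)) * y $ i)"
        using assms that by (subst mult_mat_vec_index[of _ m n]) auto
      then show ?thesis by (simp add: sum_distrib_left ac_simps)
    qed
    then show ?thesis using assms by (subst cscalar_prod_sum[where n=m]) auto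
  qed
  finally show ?thesis .
qed

text \<open>For \<open>y\<close> the image of \<open>x\<close> under the adjoint,
  \<open>sqnorm y\<close> is the inner product of \<open>A y\<close> with \<open>x\<close>.
  Cauchy-Schwarz and the bound on \<open>A\<close> give \<open>sqnorm y\<close> squared at most
  \<open>c * sqnorm y * sqnorm x\<close>, and one factor cancels.\<close>

lemma sq_bounded_adjoint:
  assumes "sq_bounded c A" "0 \<le> c"
  shows "sq_bounded c (mat_adjoint A)"
  unfolding sq_bounded_def
proof
  fix x :: "complex vec" assume x: "x \<in> carrier_vec (dim_col (mat_adjoint A))"
  define y where "y = mat_adjoint A *\<^sub>v x"
  have A: "A \<in> carrier_mat (dim_row A) (dim_col A)" by simp
  have x': "x \<in> carrier_vec (dim_row A)" using x by simp
  have y: "y \<in> carrier_vec (dim_col A)" unfolding y_def by (rule carrier_vecI) simp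
  have Ay: "A *\<^sub>v y \<in> carrier_vec (dim_row A)" by (rule carrier_vecI) simp
  have "(A *\<^sub>v y) \<bullet>c x = complex_of_real (sqnorm y)"
    using cscalar_prod_adjoint[OF A y x'] by (simp add: y_def cscalar_prod_self)
  then have "(sqnorm y)\<^sup>2 \<le> sqnorm (A *\<^sub>v y) * sqnorm x"
    using cscalar_prod_le[of "A *\<^sub>v y" "dim_row A" x] x' by simp
  also have "\<dots> \<le> (c * sqnorm y) * sqnorm x"
    using assms(1) y by (intro mult_right_mono) (auto simp: sq_bounded_def)
  finally have "sqnorm y * sqnorm y \<le> sqnorm y * (c * sqnorm x)" by (simp add: power2_eq_square mult_ac)
  then have "sqnorm y = 0 \<or> sqnorm y \<le> c * sqnorm x"
    using sqnorm_nonneg[of y] by (metis mult_le_cancel_left_pos order_le_less)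
  then show "sqnorm (mat_adjoint A *\<^sub>v x) \<le> c * sqnorm x"
    using assms(2) by (auto simp: y_def)
qed

lemma sq_boundedD: "sq_bounded c A \<Longrightarrow> A \<in> carrier_mat n m \<Longrightarrow> x \<in> carrier_vec m \<Longrightarrow> sqnorm (A *\<^sub>v x) \<le> c * sqnorm x"
  by (auto simp: sq_bounded_def)

lemma sq_bounded_hs_sqnorm: "sq_bounded (hs_sqnorm A) A"
  unfolding sq_bounded_def
proof
  fix x :: "complex vec" assume x: "x \<in> carrier_vec (dim_col A)"
  have "sqnorm (A *\<^sub>v x) = (\<Sum>i<dim_row A. (cmod (\<Sum>k<dim_col A. A $$ (i, k) * x $ k))\<^sup>2)"
    using x by (simp add: sqnorm_def mult_mat_vec_index[where n="dim_row A" and m="dim_col A"] del: index_mult_mat_vec)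
  also have "\<dots> \<le> (\<Sum>i<dim_row A. (\<Sum>k<dim_col A. (cmod (A $$ (i, k)))\<^sup>2) * (\<Sum>k<dim_col A. (cmod (x $ k))\<^sup>2))"
    by (intro sum_mono cmod_sum_mult_le)
  also have "\<dots> = hs_sqnorm A * sqnorm x"
    using x by (simp add: hs_sqnorm_def sqnorm_def sum_distrib_right)
  finally show "sqnorm (A *\<^sub>v x) \<le> hs_sqnorm A * sqnorm x" .
qed

lemma sq_bounded_mono: "sq_bounded c A \<Longrightarrow> c \<le> d \<Longrightarrow> sq_bounded d A"
  unfolding sq_bounded_def by (meson mult_right_mono order_trans sqnorm_nonneg)

lemma hs_sqnorm_adjoint [simp]: "hs_sqnorm (mat_adjoint A) = hs_sqnorm A"
proof -
  have "hs_sqnorm (mat_adjoint A) = (\<Sum>i<dim_col A. \<Sum>j<dim_row A. (cmod (A $$ (j, i)))\<^sup>2)"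
    by (simp add: hs_sqnorm_def)
  also have "\<dots> = hs_sqnorm A" unfolding hs_sqnorm_def by (rule sum.swap)
  finally show ?thesis .
qed

lemma hs_sqnorm_cols: "hs_sqnorm A = (\<Sum>j<dim_col A. sqnorm (col A j))"
proof -
  have "hs_sqnorm A = (\<Sum>j<dim_col A. \<Sum>i<dim_row A. (cmod (A $$ (i, j)))\<^sup>2)"
    unfolding hs_sqnorm_def by (rule sum.swap)
  then show ?thesis by (simp add: sqnorm_def)
qed

lemma smult_mat_vec:
  "A \<in> carrier_mat p n \<Longrightarrow> v \<in> carrier_vec n \<Longrightarrow> (c \<cdot>\<^sub>m A) *\<^sub>v v = c \<cdot>\<^sub>v (A *\<^sub>v v)" for A :: "complex mat"
  by (intro eq_vecI) (auto simp: scalar_prod_def sum_distrib_left mult_ac)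

lemma sqnorm_unit_vec: "i < n \<Longrightarrow> sqnorm (unit_vec n i) = 1"
proof -
  assume i: "i < n"
  have "sqnorm (unit_vec n i) = (\<Sum>k<n. if k = i then 1 else 0)"
    unfolding sqnorm_def using i by (intro sum.cong) auto
  then show ?thesis using i by simp
qed

lemma sqnorm_smult: "sqnorm (c \<cdot>\<^sub>v x) = (cmod c)\<^sup>2 * sqnorm x"
  by (simp add: sqnorm_def norm_mult power_mult_distrib sum_distrib_left)

lemma hs_sqnorm_smult: "hs_sqnorm (c \<cdot>\<^sub>m A) = (cmod c)\<^sup>2 * hs_sqnorm A"
  by (simp add: hs_sqnorm_def norm_mult power_mult_distrib sum_distrib_left)

lemma sq_bounded_smult: "sq_bounded c A \<Longrightarrow> sq_bounded ((cmod t)\<^sup>2 * c) (t \<cdot>\<^sub>m A)"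
  unfolding sq_bounded_def
proof
  fix x :: "complex vec" assume h: "\<forall>x\<in>carrier_vec (dim_col A). sqnorm (A *\<^sub>v x) \<le> c * sqnorm x" 
    and "x \<in> carrier_vec (dim_col (t \<cdot>\<^sub>m A))"
  then have x: "x \<in> carrier_vec (dim_col A)" by simp
  have "(t \<cdot>\<^sub>m A) *\<^sub>v x = t \<cdot>\<^sub>v (A *\<^sub>v x)"
    using x by (intro smult_mat_vec) auto
  then show "sqnorm (t \<cdot>\<^sub>m A *\<^sub>v x) \<le> (cmod t)\<^sup>2 * c * sqnorm x"
    using h x by (simp add: sqnorm_smult mult_left_mono mult.assoc)
qed

text \<open>The Hilbert-Schmidt norm bounds the set in \<open>op_norm\<close>, so its supremum is a
  genuine one; the zero vector witnesses nonnegativity.\<close>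

lemma op_norm_set:
  fixes A :: "complex mat"
  shows op_norm_bdd: "bdd_above {euclid_norm (A *\<^sub>v x) | x. x \<in> carrier_vec (dim_col A) \<and> euclid_norm x \<le> 1}"
    and op_norm_nonneg: "0 \<le> op_norm A"
proof -
  show b: "bdd_above {euclid_norm (A *\<^sub>v x) | x. x \<in> carrier_vec (dim_col A) \<and> euclid_norm x \<le> 1}"
  proof (rule bdd_aboveI[where M="sqrt (hs_sqnorm A)"], clarify)
    fix x assume "x \<in> carrier_vec (dim_col A)" "euclid_norm x \<le> 1"
    then have "sqnorm (A *\<^sub>v x) \<le> hs_sqnorm A * sqnorm x" "sqnorm x \<le> 1"
      using sq_bounded_hs_sqnorm[of A] by (auto simp: sq_bounded_def euclid_norm_sqnorm)
    then have "sqnorm (A *\<^sub>v x) \<le> hs_sqnorm A"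
      by (meson hs_sqnorm_nonneg mult_left_le order_trans)
    then show "euclid_norm (A *\<^sub>v x) \<le> sqrt (hs_sqnorm A)" by (simp add: euclid_norm_sqnorm)
  qed
  have "euclid_norm (A *\<^sub>v 0\<^sub>v (dim_col A)) \<le> op_norm A"
    unfolding op_norm_def
    by (intro cSup_upper b) (auto simp: euclid_norm_sqnorm sqnorm_def intro!: exI[of _ "0\<^sub>v (dim_col A)"])
  then show "0 \<le> op_norm A" by (rule order_trans[rotated]) (simp add: euclid_norm_sqnorm)
qed

lemma sq_bounded_op_norm: "sq_bounded ((op_norm A)\<^sup>2) A"
  unfolding sq_bounded_def
proof
  fix x :: "complex vec" assume x: "x \<in> carrier_vec (dim_col A)"
  show "sqnorm (A *\<^sub>v x) \<le> (op_norm A)\<^sup>2 * sqnorm x"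
  proof (cases "sqnorm x = 0")
    case True
    then have "sqnorm (A *\<^sub>v x) \<le> 0" using sq_boundedD[OF sq_bounded_hs_sqnorm[of A] _ x, of "dim_row A"] by simp
    then show ?thesis using True by simp
  next
    case False
    then have p: "0 < sqnorm x" using sqnorm_nonneg[of x] by linarith
    define t where "t = complex_of_real (1 / sqrt (sqnorm x))"
    have t: "(cmod t)\<^sup>2 = 1 / sqnorm x" using p unfolding t_def norm_of_real by (simp add: power_divide)
    have "euclid_norm (A *\<^sub>v (t \<cdot>\<^sub>v x)) \<le> op_norm A"
      unfolding op_norm_def
      using x p t by (intro cSup_upper op_norm_bdd) (auto simp: euclid_norm_sqnorm sqnorm_smult intro!: exI[of _ "t \<cdot>\<^sub>v x"])
    moreover have "A *\<^sub>v (t \<cdot>\<^sub>v x) = t \<cdot>\<^sub>v (A *\<^sub>v x)"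
      using x by (intro mult_mat_vec[of _ "dim_row A"]) auto
    ultimately have "sqrt (sqnorm (A *\<^sub>v x) / sqnorm x) \<le> op_norm A"
      using t by (simp add: euclid_norm_sqnorm sqnorm_smult)
    then have "sqnorm (A *\<^sub>v x) / sqnorm x \<le> (op_norm A)\<^sup>2"
      by (simp add: sqrt_le_D)
    then show ?thesis using p by (simp add: pos_divide_le_eq)
  qed
qed

lemma op_norm_le:
  assumes "sq_bounded c A" "0 \<le> c"
  shows "op_norm A \<le> sqrt c"
  unfolding op_norm_def
proof (rule cSup_least, goal_cases)
  case 1
  have "0\<^sub>v (dim_col A) \<in> carrier_vec (dim_col A) \<and> euclid_norm (0\<^sub>v (dim_col A)) \<le> 1"
    by (simp add: euclid_norm_sqnorm sqnorm_def)
  then show ?case by blast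
next
  case (2 y)
  then obtain x where x: "y = euclid_norm (A *\<^sub>v x)" "x \<in> carrier_vec (dim_col A)" "euclid_norm x \<le> 1" by auto
  then have "sqnorm (A *\<^sub>v x) \<le> c * sqnorm x" "sqnorm x \<le> 1"
    using assms by (auto simp: sq_bounded_def euclid_norm_sqnorm)
  then have "sqnorm (A *\<^sub>v x) \<le> c" using assms(2) by (meson mult_left_le order_trans)
  then show ?case by (simp add: x euclid_norm_sqnorm)
qed

lemma sum_lessThan_add: "(\<Sum>k<m + n. f k) = (\<Sum>k<m. f k) + (\<Sum>k<(n::nat). f (m + k) :: 'b::comm_monoid_add)"
  by (induction n) (simp_all add: add.assoc)

section \<open>Linear minorants of convex cones and square roots of positive forms\<close>

locale real_space =
  fixes E :: "'e set" and add :: "'e \<Rightarrow> 'e \<Rightarrow> 'e" and sc :: "real \<Rightarrow> 'e \<Rightarrow> 'e" and z :: 'e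
  assumes add_closed: "x \<in> E \<Longrightarrow> y \<in> E \<Longrightarrow> add x y \<in> E"
    and sc_closed: "x \<in> E \<Longrightarrow> sc t x \<in> E"
    and zero_closed: "z \<in> E"
    and add_assoc: "x \<in> E \<Longrightarrow> y \<in> E \<Longrightarrow> w \<in> E \<Longrightarrow> add (add x y) w = add x (add y w)"
    and add_comm: "x \<in> E \<Longrightarrow> y \<in> E \<Longrightarrow> add x y = add y x"
    and add_zero: "x \<in> E \<Longrightarrow> add x z = x"
    and sc_add: "x \<in> E \<Longrightarrow> y \<in> E \<Longrightarrow> sc t (add x y) = add (sc t x) (sc t y)"
    and sc_plus: "x \<in> E \<Longrightarrow> sc (s + t) x = add (sc s x) (sc t x)"
    and sc_sc: "x \<in> E \<Longrightarrow> sc s (sc t x) = sc (s * t) x"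
    and sc_one: "x \<in> E \<Longrightarrow> sc 1 x = x"
    and sc_zero: "x \<in> E \<Longrightarrow> sc 0 x = z"
begin

text \<open>Plays the role of the epigraph of a sublinear functional without naming the functional:
  adding two factorizations is easier than comparing infima. Upward closure is not part of it. The
  last clause keeps the infimum over every fibre finite once all fibres are nonempty.\<close>

definition epi_cone :: "('e \<times> real) set \<Rightarrow> bool" where
  "epi_cone G \<longleftrightarrow> G \<subseteq> E \<times> UNIV \<and>
     (\<forall>x a y b. (x, a) \<in> G \<longrightarrow> (y, b) \<in> G \<longrightarrow> (add x y, a + b) \<in> G) \<and>
     (\<forall>x a t. (x, a) \<in> G \<longrightarrow> 0 \<le> t \<longrightarrow> (sc t x, t * a) \<in> G) \<and>
     (\<forall>a. (z, a) \<in> G \<longrightarrow> 0 \<le> a)"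

lemma epi_coneD:
  assumes "epi_cone G"
  shows "(x, a) \<in> G \<Longrightarrow> x \<in> E"
    and "(x, a) \<in> G \<Longrightarrow> (y, b) \<in> G \<Longrightarrow> (add x y, a + b) \<in> G"
    and "(x, a) \<in> G \<Longrightarrow> 0 \<le> t \<Longrightarrow> (sc t x, t * a) \<in> G"
    and "(z, a) \<in> G \<Longrightarrow> 0 \<le> a"
  using assms unfolding epi_cone_def by blast+

lemma add_neg: "x \<in> E \<Longrightarrow> add (sc t x) (sc (- t) x) = z"
  using sc_plus[of x t "- t"] sc_zero by simp

text \<open>Adjoins the ray through \<open>(- x, - c)\<close>, which forces linear minorants to be
  at least \<open>c\<close> at \<open>x\<close>. The clause over zero survives:
  \<open>y - t x = 0\<close> with \<open>t > 0\<close> puts \<open>a' / t\<close> into the fibre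
  over \<open>x\<close>, which \<open>c\<close> bounds from below.\<close>

lemma epi_cone_extend:
  assumes M: "epi_cone M" and x: "x \<in> E" and p: "\<And>a. (x, a) \<in> M \<Longrightarrow> c \<le> a"
  shows "epi_cone {(add y (sc (- t) x), a - t * c) | y a t. (y, a) \<in> M \<and> 0 \<le> t}"
    (is "epi_cone ?G")
  unfolding epi_cone_def
proof (intro conjI allI impI)
  show "?G \<subseteq> E \<times> UNIV"
    using epi_coneD(1)[OF M] x by (auto intro!: add_closed sc_closed)
next
  fix u a v b assume "(u, a) \<in> ?G" "(v, b) \<in> ?G"
  then obtain y a' t y' b' t' where h: "u = add y (sc (- t) x)" "a = a' - t * c" "(y, a') \<in> M" "0 \<le> t"
    "v = add y' (sc (- t') x)" "b = b' - t' * c" "(y', b') \<in> M" "0 \<le> t'" by blast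
  have yE: "y \<in> E" "y' \<in> E" using h epi_coneD(1)[OF M] by blast+
  have s: "sc (- t) x \<in> E" "sc (- t') x \<in> E" using sc_closed[OF x] by auto
  have "add u v = add y (add (sc (- t) x) (add y' (sc (- t') x)))"
    unfolding h by (rule add_assoc) (intro yE s add_closed)+
  also have "add (sc (- t) x) (add y' (sc (- t') x)) = add y' (add (sc (- t) x) (sc (- t') x))"
    using add_assoc[OF s(1) yE(2) s(2)] add_assoc[OF yE(2) s] add_comm[OF s(1) yE(2)] by simp
  also have "add (sc (- t) x) (sc (- t') x) = sc (- (t + t')) x"
    using sc_plus[OF x, of "- t" "- t'"] by simp
  also have "add y (add y' (sc (- (t + t')) x)) = add (add y y') (sc (- (t + t')) x)"
    by (rule add_assoc[symmetric]) (intro yE sc_closed x)+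
  finally have "(add u v, a + b) = (add (add y y') (sc (- (t + t')) x), (a' + b') - (t + t') * c)"
    using h by (simp add: algebra_simps)
  moreover have "(add y y', a' + b') \<in> M" using epi_coneD(2)[OF M] h by blast
  moreover have "0 \<le> t + t'" using h by simp
  ultimately show "(add u v, a + b) \<in> ?G" by blast
next
  fix u a s assume "(u, a) \<in> ?G" and s: "0 \<le> (s::real)"
  then obtain y a' t where h: "u = add y (sc (- t) x)" "a = a' - t * c" "(y, a') \<in> M" "0 \<le> t" by blast
  have yE: "y \<in> E" using h epi_coneD(1)[OF M] by blast
  have "(sc s u, s * a) = (add (sc s y) (sc (- (s * t)) x), s * a' - (s * t) * c)"
    unfolding h using sc_add[OF yE sc_closed[OF x], of s "- t"] sc_sc[OF x, of s "- t"] by (simp add: algebra_simps)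
  moreover have "(sc s y, s * a') \<in> M" "0 \<le> s * t" using epi_coneD(3)[OF M h(3) s] h s by simp_all
  ultimately show "(sc s u, s * a) \<in> ?G" by blast
next
  fix a assume "(z, a) \<in> ?G"
  then obtain y a' t where h: "z = add y (sc (- t) x)" "a = a' - t * c" "(y, a') \<in> M" "0 \<le> t" by blast
  have yE: "y \<in> E" using h epi_coneD(1)[OF M] by blast
  have "sc t x = add z (sc t x)" using add_comm[OF zero_closed sc_closed[OF x]] add_zero[OF sc_closed[OF x]] by simp
  also have "\<dots> = add y (add (sc (- t) x) (sc t x))"
    unfolding h(1) by (rule add_assoc) (intro yE sc_closed x)+
  also have "\<dots> = y" using add_neg[OF x, of "- t"] add_zero[OF yE] by simp
  finally have y: "y = sc t x" by simp
  show "0 \<le> a"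
  proof (cases "t = 0")
    case True
    then have "(z, a') \<in> M" using h y sc_zero[OF x] by simp
    then show ?thesis using epi_coneD(4)[OF M] h True by simp
  next
    case False
    then have "(sc (1 / t) (sc t x), (1 / t) * a') \<in> M" using epi_coneD(3)[OF M h(3), of "1 / t"] h y by simp
    then have "(x, a' / t) \<in> M" using False sc_sc[OF x] sc_one[OF x] by simp
    then have "c \<le> a' / t" by (rule p)
    then show ?thesis using False h by (simp add: pos_le_divide_eq mult.commute)
  qed
qed

text \<open>In a maximal cone the infimum over each fibre is attained and odd, hence linear.\<close>

theorem epi_cone_linear_minorant:
  assumes \<Gamma>: "epi_cone \<Gamma>" and total: "\<And>x. x \<in> E \<Longrightarrow> \<exists>a. (x, a) \<in> \<Gamma>"
  obtains l where "\<And>x y. x \<in> E \<Longrightarrow> y \<in> E \<Longrightarrow> l (add x y) = l x + l y"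
    and "\<And>t x. x \<in> E \<Longrightarrow> l (sc t x) = t * l x"
    and "\<And>x a. (x, a) \<in> \<Gamma> \<Longrightarrow> l x \<le> a"
proof -
  define \<A> where "\<A> = {G. epi_cone G \<and> \<Gamma> \<subseteq> G}"
  have "\<exists>M\<in>\<A>. \<forall>X\<in>\<A>. M \<subseteq> X \<longrightarrow> X = M"
  proof (rule subset_Zorn_nonempty)
    show "\<A> \<noteq> {}" using \<Gamma> by (auto simp: \<A>_def)
    fix \<C> assume ne: "\<C> \<noteq> {}" and ch: "subset.chain \<A> \<C>"
    have ep: "epi_cone G" if "G \<in> \<C>" for G using that ch by (auto simp: \<A>_def subset.chain_def)
    have "epi_cone (\<Union>\<C>)"
      unfolding epi_cone_def
    proof (intro conjI allI impI)
      show "\<Union>\<C> \<subseteq> E \<times> UNIV" using ep by (auto dest: epi_coneD(1))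
      fix x a y b assume "(x, a) \<in> \<Union>\<C>" "(y, b) \<in> \<Union>\<C>"
      then obtain G H where GH: "G \<in> \<C>" "H \<in> \<C>" "(x, a) \<in> G" "(y, b) \<in> H" by blast
      then have "G \<subseteq> H \<or> H \<subseteq> G" using ch by (auto simp: subset.chain_def)
      then have "\<exists>K\<in>\<C>. (x, a) \<in> K \<and> (y, b) \<in> K" using GH by blast
      then show "(add x y, a + b) \<in> \<Union>\<C>" using epi_coneD(2)[OF ep] by blast
    next
      show "(sc t x, t * a) \<in> \<Union>\<C>" if "(x, a) \<in> \<Union>\<C>" "0 \<le> t" for x a t
        using that epi_coneD(3)[OF ep] by blast
      show "0 \<le> a" if "(z, a) \<in> \<Union>\<C>" for a using that epi_coneD(4)[OF ep] by blast
    qed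
    moreover obtain G where "G \<in> \<C>" using ne by blast
    moreover from this have "\<Gamma> \<subseteq> G" using ch by (auto simp: \<A>_def subset.chain_def)
    ultimately show "\<Union>\<C> \<in> \<A>" unfolding \<A>_def by blast
  qed
  then obtain M where MA: "M \<in> \<A>" and mx: "\<forall>X\<in>\<A>. M \<subseteq> X \<longrightarrow> X = M" by blast
  have M: "epi_cone M" "\<Gamma> \<subseteq> M" using MA by (auto simp: \<A>_def)
  have max: "X = M" if "epi_cone X" "M \<subseteq> X" for X
  proof -
    have "X \<in> \<A>" using that M by (auto simp: \<A>_def)
    then show ?thesis using mx that(2) by simp
  qed
  define p where "p x = Inf {a. (x, a) \<in> M}" for x
  have ne: "\<exists>a. (x, a) \<in> M" if "x \<in> E" for x using total[OF that] M(2) by blast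
  have neg: "sc (- 1) x \<in> E" "sc (- 1) (sc (- 1) x) = x" "add x (sc (- 1) x) = z" if "x \<in> E" for x
    using that sc_closed sc_sc[OF that, of "- 1" "- 1"] sc_one[OF that] add_neg[OF that, of 1] by simp_all
  have sum_nonneg: "0 \<le> a + b" if "(x, a) \<in> M" "(sc (- 1) x, b) \<in> M" for x a b
    using epi_coneD(2)[OF M(1) that] neg(3)[OF epi_coneD(1)[OF M(1) that(1)]] epi_coneD(4)[OF M(1)] by simp
  have p_le: "p x \<le> a" if "(x, a) \<in> M" for x a
  proof -
    have x: "x \<in> E" by (rule epi_coneD(1)[OF M(1) that])
    \<comment> \<open>An element over \<open>- x\<close> bounds the whole fibre over
      \<open>x\<close> from below, since the two add up to an element over zero.\<close>
    obtain b where b: "(sc (- 1) x, b) \<in> M" using ne[OF neg(1)[OF x]] by blast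
    have "- b \<le> a" if "(x, a) \<in> M" for a using sum_nonneg[OF that b] by simp
    then show ?thesis unfolding p_def using that by (intro cInf_lower bdd_belowI[of _ "- b"]) auto
  qed
  have p_ge: "c \<le> p x" if "x \<in> E" "\<And>a. (x, a) \<in> M \<Longrightarrow> c \<le> a" for x c
    unfolding p_def using ne[OF that(1)] that(2) by (intro cInf_greatest) auto
  have neg_mem: "(sc (- 1) x, - p x) \<in> M" if x: "x \<in> E" for x
  proof -
    \<comment> \<open>The value \<open>p x\<close> is an admissible lower bound for the extension,
      and maximality makes the extension equal to \<open>M\<close>. So the new generator
      \<open>(- x, - p x)\<close> was in \<open>M\<close> all along.\<close>
    let ?G = "{(add y (sc (- t) x), a - t * p x) | y a t. (y, a) \<in> M \<and> 0 \<le> t}"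
    have "M \<subseteq> ?G"
    proof
      fix u assume u: "u \<in> M"
      obtain y a where ya: "u = (y, a)" by (cases u)
      have "u = (add y (sc (- 0) x), a - 0 * p x)"
        using ya add_zero[OF epi_coneD(1)[OF M(1), of y a]] u sc_zero[OF x] by simp
      then show "u \<in> ?G" using u ya by (metis (mono_tags, lifting) mem_Collect_eq order_refl)
    qed
    then have eq: "?G = M" using max epi_cone_extend[OF M(1) x p_le] by blast
    obtain a where "(x, a) \<in> M" using ne[OF x] by blast
    then have "(z, 0) \<in> M" using epi_coneD(3)[OF M(1), of x a 0] sc_zero[OF x] by simp
    then have "(add z (sc (- 1) x), 0 - 1 * p x) \<in> ?G" using zero_le_one by blast
    moreover have "add z (sc (- 1) x) = sc (- 1) x"
      using add_comm[OF zero_closed neg(1)[OF x]] add_zero[OF neg(1)[OF x]] by simp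
    ultimately show ?thesis unfolding eq by simp
  qed
  have odd: "p (sc (- 1) x) = - p x" if x: "x \<in> E" for x
  proof (rule antisym)
    show "p (sc (- 1) x) \<le> - p x" by (rule p_le[OF neg_mem[OF x]])
    show "- p x \<le> p (sc (- 1) x)"
    proof (rule p_ge[OF neg(1)[OF x]])
      fix b assume b: "(sc (- 1) x, b) \<in> M"
      have "- b \<le> p x" by (rule p_ge[OF x]) (use sum_nonneg[OF _ b] in force)
      then show "- p x \<le> b" by simp
    qed
  qed
  have mem: "(x, p x) \<in> M" if x: "x \<in> E" for x
    using neg_mem[OF neg(1)[OF x]] odd[OF x] neg(2)[OF x] by simp
  \<comment> \<open>A pair whose negative also lies in \<open>M\<close> pins the infimum down from
    both sides, because \<open>p\<close> is odd. Additivity and homogeneity both reduce to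
    this.\<close>
  have eq: "p x = a" if "(x, a) \<in> M" "(sc (- 1) x, - a) \<in> M" for x a
    using p_le[OF that(1)] p_le[OF that(2)] odd[OF epi_coneD(1)[OF M(1) that(1)]] by simp
  show thesis
  proof
    show "p (add x y) = p x + p y" if xy: "x \<in> E" "y \<in> E" for x y
    proof (rule eq)
      show "(add x y, p x + p y) \<in> M" by (rule epi_coneD(2)[OF M(1) mem[OF xy(1)] mem[OF xy(2)]])
      show "(sc (- 1) (add x y), - (p x + p y)) \<in> M"
        using epi_coneD(2)[OF M(1) neg_mem[OF xy(1)] neg_mem[OF xy(2)]] sc_add[OF xy, of "- 1"] by simp
    qed
    have hom: "p (sc t x) = t * p x" if x: "x \<in> E" and t: "0 \<le> t" for x t
    proof (rule eq)
      show "(sc t x, t * p x) \<in> M" by (rule epi_coneD(3)[OF M(1) mem[OF x] t])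
      show "(sc (- 1) (sc t x), - (t * p x)) \<in> M"
        using epi_coneD(3)[OF M(1) neg_mem[OF x] t] sc_sc[OF x, of "- 1" t] sc_sc[OF x, of t "- 1"] by simp
    qed
    show "p (sc t x) = t * p x" if x: "x \<in> E" for x t
    proof (cases "0 \<le> t")
      case False
      then have "p (sc (- t) (sc (- 1) x)) = (- t) * p (sc (- 1) x)" by (intro hom neg x) simp
      then show ?thesis using sc_sc[OF x, of "- t" "- 1"] odd[OF x] by simp
    qed (rule hom[OF x])
    show "p x \<le> a" if "(x, a) \<in> \<Gamma>" for x a using p_le that M(2) by blast
  qed
qed

end

text \<open>Elimination of the last variable. The Schur complement \<open>H'\<close> is again
  positive definite: its form at \<open>\<xi>\<close> is the form of \<open>H\<close> at the
  extension of \<open>\<xi>\<close> by the minimizing last coordinate, that is, after completing the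
  square.\<close>

lemma cholesky:
  fixes H :: "nat \<Rightarrow> nat \<Rightarrow> complex"
  assumes "\<And>i j. i < n \<Longrightarrow> j < n \<Longrightarrow> H j i = cnj (H i j)"
    and "\<And>\<xi>. \<exists>i<n. \<xi> i \<noteq> 0 \<Longrightarrow> 0 < Re (\<Sum>i<n. \<Sum>j<n. cnj (\<xi> i) * H i j * \<xi> j)"
  shows "\<exists>R. \<forall>i<n. \<forall>j<n. H i j = (\<Sum>k<n. cnj (R k i) * R k j)"
  using assms
proof (induction n arbitrary: H)
  case 0
  then show ?case by simp
next
  case (Suc n)
  define d where "d = Re (H n n)"
  have Hnn: "H n n = complex_of_real d"
    using Suc.prems(1)[of n n] by (simp add: d_def complex_eq_iff)
  have d: "0 < d"
    using Suc.prems(2)[of "\<lambda>i. if i = n then 1 else 0"] Hnn by (auto simp: if_distrib[of cnj] if_distrib[of "\<lambda>x. x * _"] cong: if_cong)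
  have herm: "H n i = cnj (H i n)" if "i < n" for i using Suc.prems(1)[of i n] that by simp
  define H' where "H' i j = H i j - H i n * H n j / d" for i j
  have "\<exists>R. \<forall>i<n. \<forall>j<n. H' i j = (\<Sum>k<n. cnj (R k i) * R k j)"
  proof (rule Suc.IH)
    show "H' j i = cnj (H' i j)" if "i < n" "j < n" for i j
      using that Suc.prems(1)[of i j] herm by (simp add: H'_def mult.commute)
    fix \<xi> :: "nat \<Rightarrow> complex" assume nz: "\<exists>i<n. \<xi> i \<noteq> 0"
    define s where "s = (\<Sum>j<n. H n j * \<xi> j)"
    define \<eta> where "\<eta> = \<xi>(n := - s / d)"
    have s': "(\<Sum>i<n. cnj (\<xi> i) * H i n) = cnj s"
      unfolding s_def using herm by (simp add: mult.commute)
    have \<eta>: "\<eta> i = \<xi> i" if "i < n" for i using that by (simp add: \<eta>_def)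
    have \<eta>n: "\<eta> n = - s / d" by (simp add: \<eta>_def)
    have "(\<Sum>i<Suc n. \<Sum>j<Suc n. cnj (\<eta> i) * H i j * \<eta> j) =
        (\<Sum>i<n. \<Sum>j<n. cnj (\<xi> i) * H i j * \<xi> j) + (\<Sum>i<n. cnj (\<xi> i) * H i n) * \<eta> n 
          + cnj (\<eta> n) * s + cnj (\<eta> n) * H n n * \<eta> n"
      by (simp add: \<eta> sum.distrib sum_distrib_left sum_distrib_right s_def mult_ac)
    also have "\<dots> = (\<Sum>i<n. \<Sum>j<n. cnj (\<xi> i) * H i j * \<xi> j) - cnj s * s / d"
      unfolding s' \<eta>n Hnn using d by (simp add: field_simps)
    also have "cnj s * s / d = (\<Sum>i<n. \<Sum>j<n. cnj (\<xi> i) * (H i n * H n j / d) * \<xi> j)"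
      unfolding s'[symmetric] unfolding s_def sum_product sum_divide_distrib
      by (intro sum.cong refl) simp
    finally have "(\<Sum>i<Suc n. \<Sum>j<Suc n. cnj (\<eta> i) * H i j * \<eta> j) = (\<Sum>i<n. \<Sum>j<n. cnj (\<xi> i) * H' i j * \<xi> j)"
      by (simp add: H'_def sum_subtractf[symmetric] algebra_simps)
    moreover have "\<exists>i<Suc n. \<eta> i \<noteq> 0"
    proof -
      obtain i where "i < n" "\<xi> i \<noteq> 0" using nz by blast
      then show ?thesis using \<eta> by (intro exI[of _ i]) simp
    qed
    ultimately show "0 < Re (\<Sum>i<n. \<Sum>j<n. cnj (\<xi> i) * H' i j * \<xi> j)"
      using Suc.prems(2)[of \<eta>] by (simp only:)
  qed
  then obtain R where R: "\<And>i j. i < n \<Longrightarrow> j < n \<Longrightarrow> H' i j = (\<Sum>k<n. cnj (R k i) * R k j)" by blast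
  \<comment> \<open>The last row of the factor is the last row of \<open>H\<close> over the root of
    the pivot. The other rows factor the Schur complement and vanish in the last column.\<close>
  define Q where "Q k j = (if k = n then H n j / sqrt d else if j = n then 0 else R k j)" for k j
  have "H i j = (\<Sum>k<Suc n. cnj (Q k i) * Q k j)" if ij: "i < Suc n" "j < Suc n" for i j
  proof -
    have sq: "complex_of_real (sqrt d) * complex_of_real (sqrt d) = d"
      using d by (simp flip: of_real_mult)
    have last: "cnj (Q n i) * Q n j = cnj (H n i) * H n j / d"
      by (simp add: Q_def sq)
    consider "i < n" "j < n" | "i = n" | "j = n" using ij by linarith
    then show ?thesis
    proof cases
      case 1
      then have "(\<Sum>k<n. cnj (Q k i) * Q k j) = H' i j" by (simp add: R Q_def)
      then show ?thesis using last herm 1 by (simp add: H'_def)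
    next
      case 2
      then have "(\<Sum>k<n. cnj (Q k i) * Q k j) = 0" by (intro sum.neutral) (simp add: Q_def)
      then show ?thesis using last 2 d by (simp add: Hnn)
    next
      case 3
      then have "(\<Sum>k<n. cnj (Q k i) * Q k j) = 0" by (intro sum.neutral) (simp add: Q_def)
      moreover have "cnj (H n i) = H i n" using Suc.prems(1)[of i n] ij by simp
      ultimately show ?thesis using last 3 d by (simp add: Hnn)
    qed
  qed
  then show ?case by blast
qed

text \<open>The quadratic form of \<open>A\<close> as a double sum, the shape in which
  \<open>cholesky\<close> takes its input.\<close>

definition hform :: "complex mat \<Rightarrow> complex vec \<Rightarrow> complex" where
  "hform A x = (\<Sum>i<dim_vec x. \<Sum>j<dim_vec x. cnj (x $ i) * A $$ (i, j) * x $ j)"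

text \<open>Cholesky factor of the Hermitian part of \<open>H\<close> shifted by \<open>e\<close>.
  The real part of the form sees the Hermitian part only, so \<open>H\<close> itself may be any
  matrix. The shift makes the form definite, hence the square factor injective and
  invertible.\<close>

lemma psd_root:
  assumes H: "\<And>x. x \<in> carrier_vec n \<Longrightarrow> 0 \<le> Re (hform H x)" and e: "0 < e"
  obtains R R' where "R \<in> carrier_mat n n" "R' \<in> carrier_mat n n" "R * R' = 1\<^sub>m n" "R' * R = 1\<^sub>m n"
    and "\<And>x. x \<in> carrier_vec n \<Longrightarrow> sqnorm (R *\<^sub>v x) = Re (hform H x) + e * sqnorm x"
proof -
  define h where "h i j = (H $$ (i, j) + cnj (H $$ (j, i))) / 2 + (if i = j then complex_of_real e else 0)" for i j
  have form: "Re (\<Sum>i<n. \<Sum>j<n. cnj (\<xi> i) * h i j * \<xi> j) = Re (hform H (vec n \<xi>)) + e * (\<Sum>i<n. (cmod (\<xi> i))\<^sup>2)" for \<xi>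
  proof -
    let ?S = "\<Sum>i<n. \<Sum>j<n. cnj (\<xi> i) * H $$ (i, j) * \<xi> j"
    have sw: "(\<Sum>i<n. \<Sum>j<n. cnj (\<xi> i) * cnj (H $$ (j, i)) * \<xi> j) = cnj ?S"
      by (subst sum.swap) (simp add: mult_ac)
    have dg: "(\<Sum>i<n. \<Sum>j<n. cnj (\<xi> i) * (if i = j then complex_of_real e else 0) * \<xi> j) = complex_of_real (e * (\<Sum>i<n. (cmod (\<xi> i))\<^sup>2))"
    proof -
      have "(\<Sum>j<n. cnj (\<xi> i) * (if i = j then complex_of_real e else 0) * \<xi> j) = complex_of_real (e * (cmod (\<xi> i))\<^sup>2)" if "i < n" for i
      proof -
        have "(\<Sum>j<n. cnj (\<xi> i) * (if i = j then complex_of_real e else 0) * \<xi> j) = (\<Sum>j<n. if i = j then cnj (\<xi> i) * complex_of_real e * \<xi> j else 0)"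
          by (intro sum.cong) auto
        also have "\<dots> = cnj (\<xi> i) * complex_of_real e * \<xi> i" using that by simp
        finally show ?thesis using complex_norm_square[of "\<xi> i"] by (simp add: mult_ac)
      qed
      then show ?thesis by (simp add: sum_distrib_left)
    qed
    have "(\<Sum>i<n. \<Sum>j<n. cnj (\<xi> i) * h i j * \<xi> j) = (?S + (\<Sum>i<n. \<Sum>j<n. cnj (\<xi> i) * cnj (H $$ (j, i)) * \<xi> j)) / 2
       + (\<Sum>i<n. \<Sum>j<n. cnj (\<xi> i) * (if i = j then complex_of_real e else 0) * \<xi> j)"
      unfolding sum.distrib[symmetric] sum_divide_distrib
      by (intro sum.cong refl) (simp add: h_def algebra_simps add_divide_distrib)
    then have "Re (\<Sum>i<n. \<Sum>j<n. cnj (\<xi> i) * h i j * \<xi> j) = Re ?S + e * (\<Sum>i<n. (cmod (\<xi> i))\<^sup>2)"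
      unfolding sw dg complex_add_cnj by (simp only: plus_complex.simps Re_complex_of_real of_real_mult Re_divide_numeral) simp
    moreover have "hform H (vec n \<xi>) = ?S" unfolding hform_def by (auto intro!: sum.cong)
    ultimately show ?thesis by simp
  qed
  have "\<exists>R. \<forall>i<n. \<forall>j<n. h i j = (\<Sum>k<n. cnj (R k i) * R k j)"
  proof (rule cholesky)
    show "h j i = cnj (h i j)" for i j by (simp add: h_def add.commute)
    fix \<xi> :: "nat \<Rightarrow> complex" assume "\<exists>i<n. \<xi> i \<noteq> 0"
    then have "0 < (\<Sum>i<n. (cmod (\<xi> i))\<^sup>2)" by (auto intro!: sum_pos2)
    then show "0 < Re (\<Sum>i<n. \<Sum>j<n. cnj (\<xi> i) * h i j * \<xi> j)"
      unfolding form using H[of "vec n \<xi>"] e by (intro add_nonneg_pos) auto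
  qed
  then obtain r where r: "\<And>i j. i < n \<Longrightarrow> j < n \<Longrightarrow> h i j = (\<Sum>k<n. cnj (r k i) * r k j)" by blast
  define R where "R = mat n n (\<lambda>(k, j). r k j)"
  have R: "R \<in> carrier_mat n n" by (simp add: R_def)
  have vn: "sqnorm (R *\<^sub>v x) = Re (hform H x) + e * sqnorm x" if x: "x \<in> carrier_vec n" for x
  proof -
    have Rx: "(R *\<^sub>v x) $ k = (\<Sum>j<n. r k j * x $ j)" if "k < n" for k
      using mult_mat_vec_index[OF R x that] that by (simp add: R_def)
    have "complex_of_real (sqnorm (R *\<^sub>v x)) = (\<Sum>k<n. (R *\<^sub>v x) $ k * cnj ((R *\<^sub>v x) $ k))"
      using R by (simp add: sqnorm_def complex_norm_square[symmetric] of_real_power[symmetric] del: of_real_power index_mult_mat_vec)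
    also have "\<dots> = (\<Sum>k<n. \<Sum>i<n. \<Sum>j<n. cnj (x $ i) * (cnj (r k i) * r k j) * x $ j)"
    proof (intro sum.cong refl)
      fix k assume "k \<in> {..<n}"
      then have "(R *\<^sub>v x) $ k * cnj ((R *\<^sub>v x) $ k) = cnj (\<Sum>i<n. r k i * x $ i) * (\<Sum>j<n. r k j * x $ j)"
        by (simp only: Rx lessThan_iff mult.commute)
      also have "\<dots> = (\<Sum>i<n. \<Sum>j<n. cnj (x $ i) * (cnj (r k i) * r k j) * x $ j)"
        unfolding cnj_sum sum_product by (intro sum.cong refl) (simp add: mult_ac)
      finally show "(R *\<^sub>v x) $ k * cnj ((R *\<^sub>v x) $ k) = (\<Sum>i<n. \<Sum>j<n. cnj (x $ i) * (cnj (r k i) * r k j) * x $ j)" .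
    qed
    also have "\<dots> = (\<Sum>i<n. \<Sum>k<n. \<Sum>j<n. cnj (x $ i) * (cnj (r k i) * r k j) * x $ j)"
      by (rule sum.swap)
    also have "\<dots> = (\<Sum>i<n. \<Sum>j<n. \<Sum>k<n. cnj (x $ i) * (cnj (r k i) * r k j) * x $ j)"
      by (intro sum.cong refl sum.swap)
    also have "\<dots> = (\<Sum>i<n. \<Sum>j<n. cnj (x $ i) * h i j * x $ j)"
      by (intro sum.cong refl) (simp add: r sum_distrib_left sum_distrib_right)
    finally have "sqnorm (R *\<^sub>v x) = Re (\<Sum>i<n. \<Sum>j<n. cnj (x $ i) * h i j * x $ j)"
      by (simp only: complex_eq_iff Re_complex_of_real)
    moreover have "vec n (\<lambda>i. x $ i) = x" using x by (intro eq_vecI) auto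
    ultimately show ?thesis using form[of "\<lambda>i. x $ i"] x by (simp add: sqnorm_def)
  qed
  have "det R \<noteq> 0"
  proof
    assume "det R = 0"
    then obtain v where v: "v \<in> carrier_vec n" "v \<noteq> 0\<^sub>v n" "R *\<^sub>v v = 0\<^sub>v n"
      using det_0_iff_vec_prod_zero[OF R] by blast
    have "sqnorm (R *\<^sub>v v) = 0" using v(3) by (simp add: sqnorm_def)
    then have "e * sqnorm v \<le> 0" using vn[OF v(1)] H[OF v(1)] by linarith
    then have "sqnorm v = 0" using e sqnorm_nonneg[of v] by (simp add: mult_le_0_iff)
    then have "v $ i = 0" if "i < n" for i
      using v(1) that by (simp add: sqnorm_def sum_nonneg_eq_0_iff)
    then have "v = 0\<^sub>v n" using v(1) by (intro eq_vecI) auto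
    then show False using v(2) by simp
  qed
  then have "R \<in> Units (ring_mat TYPE(complex) n b)" for b :: unit by (rule det_non_zero_imp_unit[OF R])
  then obtain R' where "R' \<in> carrier_mat n n" "R' * R = 1\<^sub>m n" "R * R' = 1\<^sub>m n"
    unfolding Units_def ring_mat_def by auto
  then show thesis using that R vn by blast
qed

section \<open>Bimodule calculus of matrix spaces\<close>

lemma MatI: "x \<in> carrier_mat n n \<Longrightarrow> (\<And>i j. i < n \<Longrightarrow> j < n \<Longrightarrow> x $$ (i, j) \<in> vcarrier V) \<Longrightarrow> x \<in> Mat V n"
  by (auto simp: Mat_def elements_mat_def)

lemma Mat_carrier: "x \<in> Mat V n \<Longrightarrow> x \<in> carrier_mat n n"
  by (auto simp: Mat_def)

lemma Mat_dim [simp]: "x \<in> Mat V n \<Longrightarrow> dim_row x = n" "x \<in> Mat V n \<Longrightarrow> dim_col x = n"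
  by (auto simp: Mat_def)

lemma Mat_entry: "x \<in> Mat V n \<Longrightarrow> i < n \<Longrightarrow> j < n \<Longrightarrow> x $$ (i, j) \<in> vcarrier V"
  by (metis (mono_tags, lifting) Mat_def elements_matI mem_Collect_eq subsetD)

lemma bimult_dim [simp]: "dim_row (bimult V \<alpha> x \<beta>) = dim_row \<alpha>" "dim_col (bimult V \<alpha> x \<beta>) = dim_col \<beta>"
  by (simp_all add: bimult_def)

lemma mstar_dim [simp]: "dim_row (mstar V x) = dim_col x" "dim_col (mstar V x) = dim_row x"
  by (simp_all add: mstar_def)

lemma mscale_dim [simp]: "dim_row (mscale V c x) = dim_row x" "dim_col (mscale V c x) = dim_col x"
  by (simp_all add: mscale_def)

lemma mstar_index: "i < dim_col x \<Longrightarrow> j < dim_row x \<Longrightarrow> mstar V x $$ (i, j) = vstar V (x $$ (j, i))"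
  by (simp add: mstar_def)

lemma mscale_index: "i < dim_row x \<Longrightarrow> j < dim_col x \<Longrightarrow> mscale V c x $$ (i, j) = vscale V c (x $$ (i, j))"
  by (simp add: mscale_def)

lemma bimult_index:
  "x \<in> Mat V m \<Longrightarrow> i < dim_row \<alpha> \<Longrightarrow> j < dim_col \<beta> \<Longrightarrow>
    bimult V \<alpha> x \<beta> $$ (i, j) = (\<Sum>k<m. \<Sum>l<m. vscale V (\<alpha> $$ (i, k) * \<beta> $$ (l, j)) (x $$ (k, l)))"
  by (simp add: bimult_def)

locale star_space =
  fixes V :: "('a::ab_group_add) mo_space"
  assumes star: "star_vector_space V"
begin

sublocale vs: vector_space "vscale V"
  using star by (simp add: star_vector_space_def)

lemma subspace: "vs.subspace (vcarrier V)"
  using star by (simp add: star_vector_space_def)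

lemmas carrier_zero = vs.subspace_0[OF subspace]
  and carrier_add = vs.subspace_add[OF subspace]
  and carrier_scale = vs.subspace_scale[OF subspace]
  and carrier_sum = vs.subspace_sum[OF subspace]

lemma vstar_carrier: "v \<in> vcarrier V \<Longrightarrow> vstar V v \<in> vcarrier V"
  and vstar_vstar: "v \<in> vcarrier V \<Longrightarrow> vstar V (vstar V v) = v"
  and vstar_add: "v \<in> vcarrier V \<Longrightarrow> w \<in> vcarrier V \<Longrightarrow> vstar V (v + w) = vstar V v + vstar V w"
  and vstar_scale: "v \<in> vcarrier V \<Longrightarrow> vstar V (vscale V c v) = vscale V (cnj c) (vstar V v)"
  using star by (auto simp: star_vector_space_def)

lemma vstar_zero: "vstar V 0 = 0"
  using vstar_scale[OF carrier_zero, of 0] by simp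

lemma vstar_sum: "(\<And>i. i \<in> I \<Longrightarrow> f i \<in> vcarrier V) \<Longrightarrow> vstar V (\<Sum>i\<in>I. f i) = (\<Sum>i\<in>I. vstar V (f i))"
  by (induction I rule: infinite_finite_induct) (auto simp: vstar_zero vstar_add carrier_sum)

lemma Mat_add: "x \<in> Mat V n \<Longrightarrow> y \<in> Mat V n \<Longrightarrow> x + y \<in> Mat V n"
  by (rule MatI) (auto intro: carrier_add Mat_entry dest: Mat_carrier)

lemma Mat_mscale: "x \<in> Mat V n \<Longrightarrow> mscale V c x \<in> Mat V n"
  by (rule MatI) (auto simp: mscale_index intro: carrier_scale Mat_entry)

lemma Mat_mstar: "x \<in> Mat V n \<Longrightarrow> mstar V x \<in> Mat V n"
  by (rule MatI) (auto simp: mstar_index intro: vstar_carrier Mat_entry)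

lemma Mat_zero: "0\<^sub>m n n \<in> Mat V n"
  by (rule MatI) (auto simp: carrier_zero)

lemma uminus_mscale: "- x = mscale V (- 1) x"
  by (intro eq_matI) (auto simp: mscale_index)

lemma minus_mscale: "x \<in> Mat V n \<Longrightarrow> y \<in> Mat V n \<Longrightarrow> x - y = x + mscale V (- 1) y"
  by (intro eq_matI) (auto simp: mscale_index)

lemma Mat_minus: "x \<in> Mat V n \<Longrightarrow> y \<in> Mat V n \<Longrightarrow> x - y \<in> Mat V n"
  by (simp add: minus_mscale Mat_mscale Mat_add)

lemma Mat_bimult:
  assumes "x \<in> Mat V m" "\<alpha> \<in> carrier_mat n m" "\<beta> \<in> carrier_mat m n"
  shows "bimult V \<alpha> x \<beta> \<in> Mat V n"
  using assms by (intro MatI) (auto simp: bimult_index intro!: carrier_sum carrier_scale Mat_entry)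

lemma mat_add_assoc: "x \<in> Mat V n \<Longrightarrow> y \<in> Mat V n \<Longrightarrow> z \<in> Mat V n \<Longrightarrow> x + y + z = x + (y + z)"
  by (intro eq_matI) auto

lemma mat_add_comm: "x \<in> Mat V n \<Longrightarrow> y \<in> Mat V n \<Longrightarrow> x + y = y + x"
  by (intro eq_matI) auto

lemma mat_add_swap:
  assumes "a \<in> Mat V n" "b \<in> Mat V n" "c \<in> Mat V n" "d \<in> Mat V n"
  shows "(a + b) + (c + d) = (a + c) + (b + d)"
  using assms by (intro eq_matI) (auto simp: algebra_simps)

lemma mscale_add: "x \<in> Mat V n \<Longrightarrow> y \<in> Mat V n \<Longrightarrow> mscale V c (x + y) = mscale V c x + mscale V c y"
  by (intro eq_matI) (auto simp: mscale_index vs.scale_right_distrib)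

lemma mscale_add_left: "x \<in> Mat V n \<Longrightarrow> mscale V (c + d) x = mscale V c x + mscale V d x"
  by (intro eq_matI) (auto simp: mscale_index vs.scale_left_distrib)

lemma mscale_mscale [simp]: "mscale V c (mscale V d x) = mscale V (c * d) x"
  by (intro eq_matI) (auto simp: mscale_index)

lemma mscale_one [simp]: "mscale V 1 x = x"
  by (intro eq_matI) (auto simp: mscale_index)

lemma mscale_zero: "x \<in> Mat V n \<Longrightarrow> mscale V 0 x = 0\<^sub>m n n"
  by (intro eq_matI) (auto simp: mscale_index)

lemma mscale_zero_mat [simp]: "mscale V c (0\<^sub>m n m) = 0\<^sub>m n m"
  by (intro eq_matI) (auto simp: mscale_index)

lemma Mat_add_zero: "x \<in> Mat V n \<Longrightarrow> x + 0\<^sub>m n n = x" "x \<in> Mat V n \<Longrightarrow> 0\<^sub>m n n + x = x"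
  by (auto intro!: eq_matI)

lemma mstar_mstar: "x \<in> Mat V n \<Longrightarrow> mstar V (mstar V x) = x"
  by (intro eq_matI) (auto simp: mstar_index vstar_vstar Mat_entry)

lemma mstar_add: "x \<in> Mat V n \<Longrightarrow> y \<in> Mat V n \<Longrightarrow> mstar V (x + y) = mstar V x + mstar V y"
  by (intro eq_matI) (auto simp: mstar_index vstar_add Mat_entry)

lemma mstar_mscale: "x \<in> Mat V n \<Longrightarrow> mstar V (mscale V c x) = mscale V (cnj c) (mstar V x)"
  by (intro eq_matI) (auto simp: mstar_index mscale_index vstar_scale Mat_entry)

lemma bimult_add:
  assumes "x \<in> Mat V m" "y \<in> Mat V m"
  shows "bimult V \<alpha> (x + y) \<beta> = bimult V \<alpha> x \<beta> + bimult V \<alpha> y \<beta>"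
  using assms
  by (intro eq_matI) (auto simp: bimult_index[where m=m] Mat_add vs.scale_right_distrib sum.distrib)

lemma bimult_add_left:
  assumes "x \<in> Mat V m" "\<alpha> \<in> carrier_mat n m" "\<alpha>' \<in> carrier_mat n m"
  shows "bimult V (\<alpha> + \<alpha>') x \<beta> = bimult V \<alpha> x \<beta> + bimult V \<alpha>' x \<beta>"
  using assms
  by (intro eq_matI) (auto simp: bimult_index[where m=m] distrib_right vs.scale_left_distrib sum.distrib)

lemma bimult_add_right:
  assumes "x \<in> Mat V m" "\<beta> \<in> carrier_mat m n" "\<beta>' \<in> carrier_mat m n"
  shows "bimult V \<alpha> x (\<beta> + \<beta>') = bimult V \<alpha> x \<beta> + bimult V \<alpha> x \<beta>'"
  using assms
  by (intro eq_matI) (auto simp: bimult_index[where m=m] distrib_left vs.scale_left_distrib sum.distrib)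

lemma bimult_mscale:
  assumes "x \<in> Mat V m"
  shows "bimult V \<alpha> (mscale V c x) \<beta> = mscale V c (bimult V \<alpha> x \<beta>)"
  using assms
  by (intro eq_matI) (auto simp: bimult_index[where m=m] Mat_mscale mscale_index vs.scale_sum_right mult_ac)

lemma bimult_smult_left:
  assumes "x \<in> Mat V m" "\<alpha> \<in> carrier_mat n m"
  shows "bimult V (c \<cdot>\<^sub>m \<alpha>) x \<beta> = mscale V c (bimult V \<alpha> x \<beta>)"
  using assms
  by (intro eq_matI) (auto simp: bimult_index[where m=m] mscale_index vs.scale_sum_right mult_ac)

lemma bimult_smult_right:
  assumes "x \<in> Mat V m" "\<beta> \<in> carrier_mat m n"
  shows "bimult V \<alpha> x (c \<cdot>\<^sub>m \<beta>) = mscale V c (bimult V \<alpha> x \<beta>)"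
  using assms
  by (intro eq_matI) (auto simp: bimult_index[where m=m] mscale_index vs.scale_sum_right mult_ac)

lemma bimult_one:
  assumes "x \<in> Mat V m"
  shows "bimult V (1\<^sub>m m) x (1\<^sub>m m) = x"
proof (rule eq_matI)
  fix i j assume "i < dim_row x" "j < dim_col x"
  then have ij: "i < m" "j < m" using assms by auto
  have "bimult V (1\<^sub>m m) x (1\<^sub>m m) $$ (i, j) =
      (\<Sum>k<m. \<Sum>l<m. if k = i then (if l = j then x $$ (k, l) else 0) else 0)"
    using assms ij by (simp add: bimult_index[where m=m]) (intro sum.cong refl, auto)
  also have "\<dots> = (\<Sum>k<m. if k = i then (\<Sum>l<m. if l = j then x $$ (k, l) else 0) else 0)"
    by (intro sum.cong) auto
  finally show "bimult V (1\<^sub>m m) x (1\<^sub>m m) $$ (i, j) = x $$ (i, j)" using ij by simp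
qed (use assms in auto)

lemma bimult_zero_left:
  assumes "x \<in> Mat V m"
  shows "bimult V (0\<^sub>m n m) x \<beta> = 0\<^sub>m n (dim_col \<beta>)"
  using assms by (intro eq_matI) (auto simp: bimult_index[where m=m])

text \<open>Associativity: the fourfold sum is reordered until the inner sums are entries of the
  products of scalar matrices. All later manipulation of factorizations goes through this
  law.\<close>

lemma bimult_bimult:
  assumes x: "x \<in> Mat V m" and c: "\<alpha> \<in> carrier_mat p n" "\<alpha>' \<in> carrier_mat n m" "\<beta>' \<in> carrier_mat m n" "\<beta> \<in> carrier_mat n p"
  shows "bimult V \<alpha> (bimult V \<alpha>' x \<beta>') \<beta> = bimult V (\<alpha> * \<alpha>') x (\<beta>' * \<beta>)"
proof (rule eq_matI)
  fix i j assume "i < dim_row (bimult V (\<alpha> * \<alpha>') x (\<beta>' * \<beta>))" "j < dim_col (bimult V (\<alpha> * \<alpha>') x (\<beta>' * \<beta>))"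
  then have i: "i < p" and j: "j < p" using c by auto
  let ?f = "\<lambda>k l k' l'. vscale V (\<alpha> $$ (i, k) * \<alpha>' $$ (k, k') * (\<beta>' $$ (l', l) * \<beta> $$ (l, j))) (x $$ (k', l'))"
  have "bimult V \<alpha> (bimult V \<alpha>' x \<beta>') \<beta> $$ (i, j) = (\<Sum>k<n. \<Sum>l<n. \<Sum>k'<m. \<Sum>l'<m. ?f k l k' l')"
    using Mat_bimult[OF x c(2,3)] c i j x
    by (simp add: bimult_index[where m=n] bimult_index[where m=m] vs.scale_sum_right mult_ac)
  also have "\<dots> = (\<Sum>k<n. \<Sum>k'<m. \<Sum>l<n. \<Sum>l'<m. ?f k l k' l')"
    by (intro sum.cong refl sum.swap)
  also have "\<dots> = (\<Sum>k'<m. \<Sum>k<n. \<Sum>l<n. \<Sum>l'<m. ?f k l k' l')"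
    by (rule sum.swap)
  also have "\<dots> = (\<Sum>k'<m. \<Sum>k<n. \<Sum>l'<m. \<Sum>l<n. ?f k l k' l')"
    by (intro sum.cong refl sum.swap)
  also have "\<dots> = (\<Sum>k'<m. \<Sum>l'<m. \<Sum>k<n. \<Sum>l<n. ?f k l k' l')"
    by (intro sum.cong refl sum.swap)
  also have "\<dots> = (\<Sum>k'<m. \<Sum>l'<m. vscale V ((\<alpha> * \<alpha>') $$ (i, k') * (\<beta>' * \<beta>) $$ (l', j)) (x $$ (k', l')))"
    using c i j
    by (intro sum.cong refl)
      (simp add: mult_mat_index[OF c(1,2)] mult_mat_index[OF c(3,4)] sum_product vs.scale_sum_left del: index_mult_mat)
  also have "\<dots> = bimult V (\<alpha> * \<alpha>') x (\<beta>' * \<beta>) $$ (i, j)"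
    using x c i j by (subst bimult_index[where m=m]) auto
  finally show "bimult V \<alpha> (bimult V \<alpha>' x \<beta>') \<beta> $$ (i, j) = bimult V (\<alpha> * \<alpha>') x (\<beta>' * \<beta>) $$ (i, j)" .
qed (use c in auto)

lemma mstar_bimult:
  assumes x: "x \<in> Mat V m" and c: "\<alpha> \<in> carrier_mat n m" "\<beta> \<in> carrier_mat m n"
  shows "mstar V (bimult V \<alpha> x \<beta>) = bimult V (mat_adjoint \<beta>) (mstar V x) (mat_adjoint \<alpha>)"
proof (rule eq_matI)
  fix i j assume "i < dim_row (bimult V (mat_adjoint \<beta>) (mstar V x) (mat_adjoint \<alpha>))"
    "j < dim_col (bimult V (mat_adjoint \<beta>) (mstar V x) (mat_adjoint \<alpha>))"
  then have ij: "i < n" "j < n" using c by auto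
  have "mstar V (bimult V \<alpha> x \<beta>) $$ (i, j) = vstar V (\<Sum>k<m. \<Sum>l<m. vscale V (\<alpha> $$ (j, k) * \<beta> $$ (l, i)) (x $$ (k, l)))"
    using x c ij by (simp add: mstar_index bimult_index[where m=m])
  also have "\<dots> = (\<Sum>k<m. \<Sum>l<m. vscale V (cnj (\<alpha> $$ (j, k)) * cnj (\<beta> $$ (l, i))) (vstar V (x $$ (k, l))))"
  proof -
    have c: "vscale V (\<alpha> $$ (j, k) * \<beta> $$ (l, i)) (x $$ (k, l)) \<in> vcarrier V" if "k < m" "l < m" for k l
      using x that by (intro carrier_scale Mat_entry)
    show ?thesis
      by (subst vstar_sum, (intro carrier_sum c; simp), intro sum.cong refl, subst vstar_sum, (intro c; simp))
        (use x in \<open>auto intro!: sum.cong simp: vstar_scale Mat_entry\<close>)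
  qed
  also have "\<dots> = (\<Sum>l<m. \<Sum>k<m. vscale V (cnj (\<alpha> $$ (j, k)) * cnj (\<beta> $$ (l, i))) (vstar V (x $$ (k, l))))"
    by (rule sum.swap)
  also have "\<dots> = bimult V (mat_adjoint \<beta>) (mstar V x) (mat_adjoint \<alpha>) $$ (i, j)"
    using x c ij Mat_mstar[OF x] by (simp add: bimult_index[where m=m] mstar_index mult.commute)
  finally show "mstar V (bimult V \<alpha> x \<beta>) $$ (i, j) = bimult V (mat_adjoint \<beta>) (mstar V x) (mat_adjoint \<alpha>) $$ (i, j)" .
qed (use c in auto)

end

section \<open>Direct sums and the axioms\<close>

text \<open>With \<open>inj2\<close>, the isometric embeddings of the summands of a direct sum. They
  turn blocks, corners and direct sums into \<open>bimult\<close> expressions, so the bimodule laws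
  replace index computations.\<close>

definition inj1 :: "nat \<Rightarrow> nat \<Rightarrow> complex mat" where
  "inj1 m n = mat (m + n) m (\<lambda>(i, k). if k = i then 1 else 0)"

text \<open>The guard \<open>m \<le> i\<close> is essential because \<open>i - m\<close> is
  truncated subtraction.\<close>

definition inj2 :: "nat \<Rightarrow> nat \<Rightarrow> complex mat" where
  "inj2 m n = mat (m + n) n (\<lambda>(i, k). if m \<le> i then if k = i - m then 1 else 0 else 0)"

lemma inj_carrier [simp]: "inj1 m n \<in> carrier_mat (m + n) m" "inj2 m n \<in> carrier_mat (m + n) n"
  by (simp_all add: inj1_def inj2_def)

lemma inj_dim [simp]: "dim_row (inj1 m n) = m + n" "dim_col (inj1 m n) = m" "dim_row (inj2 m n) = m + n" "dim_col (inj2 m n) = n"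
  by (simp_all add: inj1_def inj2_def)

lemma inj1_mult_index:
  assumes "B \<in> carrier_mat m p" "i < m + n" "j < p"
  shows "(inj1 m n * B) $$ (i, j) = (if i < m then B $$ (i, j) else 0)"
proof -
  have "(inj1 m n * B) $$ (i, j) = (\<Sum>k<m. inj1 m n $$ (i, k) * B $$ (k, j))"
    using assms by (intro mult_mat_index) auto
  also have "\<dots> = (\<Sum>k<m. (if k = i then B $$ (k, j) else 0))"
    using assms by (intro sum.cong) (auto simp: inj1_def inj2_def)
  finally show ?thesis using assms by (auto simp del: index_mult_mat(1))
qed

lemma inj2_mult_index:
  assumes "B \<in> carrier_mat n p" "i < m + n" "j < p"
  shows "(inj2 m n * B) $$ (i, j) = (if m \<le> i then B $$ (i - m, j) else 0)"
proof -
  have "(inj2 m n * B) $$ (i, j) = (\<Sum>k<n. inj2 m n $$ (i, k) * B $$ (k, j))"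
    using assms by (intro mult_mat_index) auto
  also have "\<dots> = (\<Sum>k<n. (if k = i - m then if m \<le> i then B $$ (k, j) else 0 else 0))"
    using assms by (intro sum.cong) (auto simp: inj1_def inj2_def)
  finally show ?thesis using assms by (auto simp del: index_mult_mat(1))
qed

lemma adj_inj1_mult_index:
  assumes "B \<in> carrier_mat (m + n) p" "i < m" "j < p"
  shows "(mat_adjoint (inj1 m n) * B) $$ (i, j) = B $$ (i, j)"
proof -
  have "(mat_adjoint (inj1 m n) * B) $$ (i, j) = (\<Sum>k<m + n. mat_adjoint (inj1 m n) $$ (i, k) * B $$ (k, j))"
    using assms by (intro mult_mat_index) auto
  also have "\<dots> = (\<Sum>k<m+n. (if k = i then B $$ (k, j) else 0))"
    using assms by (intro sum.cong) (auto simp: inj1_def inj2_def)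
  finally show ?thesis using assms by (auto simp del: index_mult_mat(1))
qed

lemma adj_inj2_mult_index:
  assumes "B \<in> carrier_mat (m + n) p" "i < n" "j < p"
  shows "(mat_adjoint (inj2 m n) * B) $$ (i, j) = B $$ (m + i, j)"
proof -
  have "(mat_adjoint (inj2 m n) * B) $$ (i, j) = (\<Sum>k<m + n. mat_adjoint (inj2 m n) $$ (i, k) * B $$ (k, j))"
    using assms by (intro mult_mat_index) auto
  also have "\<dots> = (\<Sum>k<m+n. (if k = m + i then B $$ (k, j) else 0))"
    using assms by (intro sum.cong) (auto simp: inj1_def inj2_def)
  finally show ?thesis using assms by (auto simp del: index_mult_mat(1))
qed

lemma adj_inj_mult:
  "mat_adjoint (inj1 m n) * inj1 m n = 1\<^sub>m m" "mat_adjoint (inj1 m n) * inj2 m n = 0\<^sub>m m n"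
  "mat_adjoint (inj2 m n) * inj1 m n = 0\<^sub>m n m" "mat_adjoint (inj2 m n) * inj2 m n = 1\<^sub>m n"
  by (intro eq_matI; auto simp: adj_inj1_mult_index[OF inj_carrier(1)] adj_inj1_mult_index[OF inj_carrier(2)]
      adj_inj2_mult_index[OF inj_carrier(1)] adj_inj2_mult_index[OF inj_carrier(2)] simp del: index_mult_mat(1);
      simp add: inj1_def inj2_def)+

lemma inj_mult_adj: "inj1 m n * mat_adjoint (inj1 m n) + inj2 m n * mat_adjoint (inj2 m n) = 1\<^sub>m (m + n)"
  by (intro eq_matI) (auto simp: inj1_mult_index[where p="m+n"] inj2_mult_index[where p="m+n"] simp del: index_mult_mat(1),
      auto simp: inj1_def inj2_def)

text \<open>The sum \<open>inj1 m n * A + inj2 m n * B\<close> is \<open>A\<close> stacked on top of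
  \<open>B\<close>, the standard shape of a column of factors below; compression by the embeddings
  recovers the two halves.\<close>

lemma adj_inj1_sum:
  assumes "A \<in> carrier_mat m p" "B \<in> carrier_mat n p"
  shows "mat_adjoint (inj1 m n) * (inj1 m n * A + inj2 m n * B) = A"
    "mat_adjoint (inj2 m n) * (inj1 m n * A + inj2 m n * B) = B"
proof -
  have c: "inj1 m n * A + inj2 m n * B \<in> carrier_mat (m + n) p" using assms by auto
  show "mat_adjoint (inj1 m n) * (inj1 m n * A + inj2 m n * B) = A"
    using assms by (intro eq_matI) (auto simp: adj_inj1_mult_index[OF c] inj1_mult_index[where p=p]
      inj2_mult_index[where p=p] simp del: index_mult_mat(1))
  show "mat_adjoint (inj2 m n) * (inj1 m n * A + inj2 m n * B) = B"
    using assms by (intro eq_matI) (auto simp: adj_inj2_mult_index[OF c] inj1_mult_index[where p=p]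
      inj2_mult_index[where p=p] simp del: index_mult_mat(1))
qed

lemma hs_sqnorm_inj_sum:
  assumes "A \<in> carrier_mat m p" "B \<in> carrier_mat n p"
  shows "hs_sqnorm (inj1 m n * A + inj2 m n * B) = hs_sqnorm A + hs_sqnorm B"
proof -
  have "hs_sqnorm (inj1 m n * A + inj2 m n * B) = 
     (\<Sum>i<m + n. \<Sum>j<p. (cmod ((if i < m then A $$ (i, j) else 0) + (if m \<le> i then B $$ (i - m, j) else 0)))\<^sup>2)"
    using assms unfolding hs_sqnorm_def
    by (intro sum.cong) (auto simp: inj1_mult_index[where p=p] inj2_mult_index[where p=p] simp del: index_mult_mat(1))
  also have "\<dots> = hs_sqnorm A + hs_sqnorm B"
    using assms by (simp add: sum_lessThan_add hs_sqnorm_def)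
  finally show ?thesis .
qed

text \<open>The vector is read as a one-column matrix, which reduces the claim to additivity of the
  Hilbert-Schmidt norm over stacked matrices.\<close>

lemma sqnorm_inj_sum:
  assumes "A \<in> carrier_mat m p" "B \<in> carrier_mat n p" "x \<in> carrier_vec p"
  shows "sqnorm ((inj1 m n * A + inj2 m n * B) *\<^sub>v x) = sqnorm (A *\<^sub>v x) + sqnorm (B *\<^sub>v x)"
proof -
  let ?X = "mat p 1 (\<lambda>(i, j). x $ i)"
  have sqnorm_mult: "sqnorm (C *\<^sub>v x) = hs_sqnorm (C * ?X)" if "C \<in> carrier_mat q p" for C q
  proof -
    have "col ?X 0 = x" using assms(3) by (intro eq_vecI) auto
    then have "col (C * ?X) 0 = C *\<^sub>v x" using col_mult2[OF that, of ?X 1 0] by simp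
    then show ?thesis by (simp add: hs_sqnorm_cols del: col_mult)
  qed
  have [simp]: "?X \<in> carrier_mat p 1" by simp
  have "(inj1 m n * A + inj2 m n * B) * ?X = inj1 m n * (A * ?X) + inj2 m n * (B * ?X)"
  proof -
    have "inj1 m n * A * ?X = inj1 m n * (A * ?X)" "inj2 m n * B * ?X = inj2 m n * (B * ?X)"
      using assms by (auto intro!: assoc_mult_mat)
    moreover have "(inj1 m n * A + inj2 m n * B) * ?X = inj1 m n * A * ?X + inj2 m n * B * ?X"
      using assms by (intro add_mult_distrib_mat) auto
    ultimately show ?thesis by simp
  qed
  moreover have "hs_sqnorm (inj1 m n * (A * ?X) + inj2 m n * (B * ?X)) = hs_sqnorm (A * ?X) + hs_sqnorm (B * ?X)"
    using assms by (intro hs_sqnorm_inj_sum[where p=1]) auto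
  moreover have "inj1 m n * A + inj2 m n * B \<in> carrier_mat (m + n) p" using assms by auto
  ultimately show ?thesis
    using assms(1,2) sqnorm_mult by metis
qed

section \<open>Norm axioms and order axioms in directly usable form\<close>

locale op_space = star_space +
  assumes os: "operator_space V"
begin

lemma norm_nonneg: "0 < n \<Longrightarrow> x \<in> Mat V n \<Longrightarrow> 0 \<le> mnorm V x"
  and norm_zero_iff: "0 < n \<Longrightarrow> x \<in> Mat V n \<Longrightarrow> mnorm V x = 0 \<longleftrightarrow> x = 0\<^sub>m n n"
  and norm_mscale: "0 < n \<Longrightarrow> x \<in> Mat V n \<Longrightarrow> mnorm V (mscale V c x) = cmod c * mnorm V x"
  and norm_triangle: "0 < n \<Longrightarrow> x \<in> Mat V n \<Longrightarrow> y \<in> Mat V n \<Longrightarrow> mnorm V (x + y) \<le> mnorm V x + mnorm V y"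
  and norm_four_block: "0 < m \<Longrightarrow> 0 < n \<Longrightarrow> x \<in> Mat V m \<Longrightarrow> y \<in> Mat V n \<Longrightarrow>
        mnorm V (four_block_mat x (0\<^sub>m m n) (0\<^sub>m n m) y) = max (mnorm V x) (mnorm V y)"
  and norm_bimult: "0 < m \<Longrightarrow> 0 < n \<Longrightarrow> x \<in> Mat V m \<Longrightarrow> \<alpha> \<in> carrier_mat n m \<Longrightarrow> \<beta> \<in> carrier_mat m n \<Longrightarrow>
        mnorm V (bimult V \<alpha> x \<beta>) \<le> op_norm \<alpha> * mnorm V x * op_norm \<beta>"
proof -
  note ax = os[unfolded operator_space_def, THEN conjunct2, THEN conjunct2]
  note n = ax[THEN conjunct1, rule_format]
  show "0 < n \<Longrightarrow> x \<in> Mat V n \<Longrightarrow> 0 \<le> mnorm V x" using n[THEN conjunct1] .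
  show "0 < n \<Longrightarrow> x \<in> Mat V n \<Longrightarrow> mnorm V x = 0 \<longleftrightarrow> x = 0\<^sub>m n n" using n[THEN conjunct2, THEN conjunct1] .
  show "0 < n \<Longrightarrow> x \<in> Mat V n \<Longrightarrow> mnorm V (mscale V c x) = cmod c * mnorm V x"
    using n[THEN conjunct2, THEN conjunct2, THEN conjunct1, rule_format] .
  show "0 < n \<Longrightarrow> x \<in> Mat V n \<Longrightarrow> y \<in> Mat V n \<Longrightarrow> mnorm V (x + y) \<le> mnorm V x + mnorm V y"
    using n[THEN conjunct2, THEN conjunct2, THEN conjunct2, rule_format] .
  show "0 < m \<Longrightarrow> 0 < n \<Longrightarrow> x \<in> Mat V m \<Longrightarrow> y \<in> Mat V n \<Longrightarrow>
        mnorm V (four_block_mat x (0\<^sub>m m n) (0\<^sub>m n m) y) = max (mnorm V x) (mnorm V y)"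
    using ax[THEN conjunct2, THEN conjunct1, rule_format] .
  show "0 < m \<Longrightarrow> 0 < n \<Longrightarrow> x \<in> Mat V m \<Longrightarrow> \<alpha> \<in> carrier_mat n m \<Longrightarrow> \<beta> \<in> carrier_mat m n \<Longrightarrow>
        mnorm V (bimult V \<alpha> x \<beta>) \<le> op_norm \<alpha> * mnorm V x * op_norm \<beta>"
    using ax[THEN conjunct2, THEN conjunct2, rule_format] .
qed


lemma norm_zero: "0 < n \<Longrightarrow> mnorm V (0\<^sub>m n n) = 0"
  using norm_zero_iff Mat_zero by blast

lemma norm_minus_commute: "0 < n \<Longrightarrow> x \<in> Mat V n \<Longrightarrow> y \<in> Mat V n \<Longrightarrow> mnorm V (x - y) = mnorm V (y - x)"
proof -
  assume a: "0 < n" "x \<in> Mat V n" "y \<in> Mat V n"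
  have "x - y = mscale V (-1) (y - x)"
    using a by (intro eq_matI) (auto simp: mscale_index)
  then show ?thesis using a by (simp add: norm_mscale Mat_minus)
qed

lemma norm_triangle_minus:
  assumes "0 < n" "x \<in> Mat V n" "y \<in> Mat V n"
  shows "mnorm V x \<le> mnorm V y + mnorm V (x - y)"
proof -
  have "x = y + (x - y)" using assms by (intro eq_matI) auto
  then show ?thesis using norm_triangle[OF assms(1,3) Mat_minus[OF assms(2,3)]] by simp
qed

lemma norm_bimult_le:
  assumes "0 < m" "0 < n" "x \<in> Mat V m" "\<alpha> \<in> carrier_mat n m" "\<beta> \<in> carrier_mat m n"
    and "sq_bounded c \<alpha>" "sq_bounded d \<beta>" "0 \<le> c" "0 \<le> d"
  shows "mnorm V (bimult V \<alpha> x \<beta>) \<le> sqrt c * mnorm V x * sqrt d"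
proof -
  have "mnorm V (bimult V \<alpha> x \<beta>) \<le> op_norm \<alpha> * mnorm V x * op_norm \<beta>"
    by (rule norm_bimult[OF assms(1-5)])
  also have "\<dots> \<le> sqrt c * mnorm V x * sqrt d"
    using assms norm_nonneg[OF assms(1,3)] by (intro mult_mono op_norm_le mult_nonneg_nonneg op_norm_nonneg) auto
  finally show ?thesis .
qed

lemma Metric_space_mdist:
  assumes that: "0 < n"
  shows "Metric_space (Mat V n) (mdist V n)"
proof
  show "0 \<le> mdist V n x y" for x y
    using that by (simp add: mdist_def norm_nonneg Mat_minus)
  show "mdist V n x y = mdist V n y x" for x y
    using that by (simp add: mdist_def norm_minus_commute)
  show "mdist V n x y = 0 \<longleftrightarrow> x = y" if xy: "x \<in> Mat V n" "y \<in> Mat V n" for x y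
  proof -
    have "x - y = 0\<^sub>m n n \<longleftrightarrow> x = y"
    proof
      assume h: "x - y = 0\<^sub>m n n"
      show "x = y"
      proof (rule eq_matI)
        fix i j assume "i < dim_row y" "j < dim_col y"
        then have "(x - y) $$ (i, j) = 0" unfolding h using xy by simp
        then show "x $$ (i, j) = y $$ (i, j)" using xy \<open>i < dim_row y\<close> \<open>j < dim_col y\<close> by simp
      qed (use xy in auto)
    qed (use xy in \<open>auto intro!: eq_matI\<close>)
    then show ?thesis using xy \<open>0 < n\<close> by (simp add: mdist_def norm_zero_iff Mat_minus)
  qed
  show "mdist V n x z \<le> mdist V n x y + mdist V n y z"
    if xyz: "x \<in> Mat V n" "y \<in> Mat V n" "z \<in> Mat V n" for x y z
  proof -
    have "x - z = (x - y) + (y - z)" using xyz by (intro eq_matI) auto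
    then show ?thesis using xyz \<open>0 < n\<close> by (simp add: mdist_def norm_triangle Mat_minus)
  qed
qed

end

locale mo_op_space =
  fixes V :: "('a::ab_group_add) mo_space"
  assumes moos: "matrix_ordered_operator_space V"
begin

lemma moos_os: "operator_space V"
  and mo: "matrix_ordered V"
  and norm_mstar: "0 < n \<Longrightarrow> x \<in> Mat V n \<Longrightarrow> mnorm V (mstar V x) = mnorm V x"
  and cone_closedin: "0 < n \<Longrightarrow> closedin (Metric_space.mtopology (Mat V n) (mdist V n)) (mcone V n)"
  using moos unfolding matrix_ordered_operator_space_def by blast+

sublocale op_space
  by (intro op_space.intro star_space.intro op_space_axioms.intro mo[unfolded matrix_ordered_def, THEN conjunct1] moos_os)

lemma cone_sa: "0 < n \<Longrightarrow> x \<in> mcone V n \<Longrightarrow> mstar V x = x"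
  and cone_Mat: "0 < n \<Longrightarrow> x \<in> mcone V n \<Longrightarrow> x \<in> Mat V n"
  and cone_zero: "0 < n \<Longrightarrow> 0\<^sub>m n n \<in> mcone V n"
  and cone_add: "0 < n \<Longrightarrow> x \<in> mcone V n \<Longrightarrow> y \<in> mcone V n \<Longrightarrow> x + y \<in> mcone V n"
  and cone_scale: "0 < n \<Longrightarrow> x \<in> mcone V n \<Longrightarrow> 0 \<le> t \<Longrightarrow> mscale V (complex_of_real t) x \<in> mcone V n"
  and cone_adj_bimult: "0 < m \<Longrightarrow> 0 < n \<Longrightarrow> x \<in> mcone V m \<Longrightarrow> \<alpha> \<in> carrier_mat m n \<Longrightarrow> bimult V (mat_adjoint \<alpha>) x \<alpha> \<in> mcone V n"
proof -
  note ax = mo[unfolded matrix_ordered_def Mat_sa_def, THEN conjunct2]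
  note c = ax[THEN conjunct1, rule_format]
  show "0 < n \<Longrightarrow> x \<in> mcone V n \<Longrightarrow> mstar V x = x" "0 < n \<Longrightarrow> x \<in> mcone V n \<Longrightarrow> x \<in> Mat V n"
    using c[THEN conjunct1] by (auto dest: subsetD)
  show "0 < n \<Longrightarrow> 0\<^sub>m n n \<in> mcone V n" using c[THEN conjunct2, THEN conjunct1] .
  show "0 < n \<Longrightarrow> x \<in> mcone V n \<Longrightarrow> y \<in> mcone V n \<Longrightarrow> x + y \<in> mcone V n"
    using c[THEN conjunct2, THEN conjunct2, THEN conjunct1, rule_format] .
  show "0 < n \<Longrightarrow> x \<in> mcone V n \<Longrightarrow> 0 \<le> t \<Longrightarrow> mscale V (complex_of_real t) x \<in> mcone V n"
    using c[THEN conjunct2, THEN conjunct2, THEN conjunct2, rule_format] .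
  show "0 < m \<Longrightarrow> 0 < n \<Longrightarrow> x \<in> mcone V m \<Longrightarrow> \<alpha> \<in> carrier_mat m n \<Longrightarrow> bimult V (mat_adjoint \<alpha>) x \<alpha> \<in> mcone V n"
    using ax[THEN conjunct2, rule_format] .
qed

lemma cone_bimult: "0 < m \<Longrightarrow> 0 < n \<Longrightarrow> x \<in> mcone V m \<Longrightarrow> \<alpha> \<in> carrier_mat n m \<Longrightarrow> bimult V \<alpha> x (mat_adjoint \<alpha>) \<in> mcone V n"
  using cone_adj_bimult[of m n x "mat_adjoint \<alpha>"] by simp

lemma cone_closed:
  assumes n: "0 < n" and "\<And>k. z k \<in> mcone V n" "l \<in> Mat V n" "(\<lambda>k. mnorm V (z k - l)) \<longlonglongrightarrow> 0"
  shows "l \<in> mcone V n"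
proof -
  interpret m: Metric_space "Mat V n" "mdist V n" using Metric_space_mdist[OF n] .
  have "closedin m.mtopology (mcone V n)"
    by (rule cone_closedin[OF n])
  moreover have "range z \<subseteq> mcone V n" using assms by auto
  moreover have "limitin m.mtopology z l sequentially"
    unfolding m.limitin_metric
  proof (intro conjI allI impI)
    fix e :: real assume "0 < e"
    then have "\<forall>\<^sub>F k in sequentially. norm (mnorm V (z k - l) - 0) < e"
      using tendstoD[OF assms(4) \<open>0 < e\<close>] by (simp only: dist_norm)
    then show "\<forall>\<^sub>F k in sequentially. z k \<in> Mat V n \<and> mdist V n (z k) l < e"
      using assms(1-3) by (auto elim!: eventually_mono simp: mdist_def cone_Mat[OF n])
  qed (use assms in auto)
  ultimately show ?thesis using m.metric_closedin_iff_sequentially_closed by blast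
qed

end

section \<open>Off-diagonal corners of positive matrices\<close>

context star_space begin

lemma sum_delta2:
  "(\<Sum>k<(m::nat). \<Sum>l<(n::nat). vscale V ((if k = a then s else 0) * (if l = b then t else 0)) (h k l)) =
     (if a < m \<and> b < n then vscale V (s * t) (h a b) else 0)"
proof -
  have "(\<Sum>k<m. \<Sum>l<n. vscale V ((if k = a then s else 0) * (if l = b then t else 0)) (h k l)) =
     (\<Sum>k<m. if k = a then (\<Sum>l<n. if l = b then vscale V (s * t) (h k l) else 0) else 0)"
  proof (intro sum.cong refl)
    fix k
    show "(\<Sum>l<n. vscale V ((if k = a then s else 0) * (if l = b then t else 0)) (h k l)) =
      (if k = a then (\<Sum>l<n. if l = b then vscale V (s * t) (h k l) else 0) else 0)"
      by (cases "k = a") (auto intro!: sum.cong simp del: sum.delta sum.delta')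
  qed
  also have "\<dots> = (if a < m then (\<Sum>l<n. if l = b then vscale V (s * t) (h a l) else 0) else 0)"
    by (simp only: sum.delta finite_lessThan lessThan_iff)
  also have "\<dots> = (if a < m \<and> b < n then vscale V (s * t) (h a b) else 0)"
    by (simp only: sum.delta finite_lessThan lessThan_iff) simp
  finally show ?thesis .
qed

text \<open>At most one summand of the double sum survives. The positions \<open>a\<close> and
  \<open>b\<close> may lie outside the matrix, and the result is then zero; the zero blocks of
  embedded matrices arise in this way.\<close>

lemma bimult_select:
  assumes x: "x \<in> Mat V m"
    and "\<And>k. k < m \<Longrightarrow> \<alpha> $$ (i, k) = (if k = a then s else 0)"
    and "\<And>l. l < m \<Longrightarrow> \<beta> $$ (l, j) = (if l = b then t else 0)"
    and "i < dim_row \<alpha>" "j < dim_col \<beta>"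
  shows "bimult V \<alpha> x \<beta> $$ (i, j) = (if a < m \<and> b < m then vscale V (s * t) (x $$ (a, b)) else 0)"
proof -
  have "bimult V \<alpha> x \<beta> $$ (i, j) = 
     (\<Sum>k<m. \<Sum>l<m. vscale V ((if k = a then s else 0) * (if l = b then t else 0)) (x $$ (k, l)))"
    unfolding bimult_index[OF x assms(4,5)] using assms(2,3) by (intro sum.cong refl) auto
  then show ?thesis by (simp only: sum_delta2)
qed

lemma Mat_four_block:
  assumes "x \<in> Mat V m" "y \<in> Mat V n"
  shows "four_block_mat x (0\<^sub>m m n) (0\<^sub>m n m) y \<in> Mat V (m + n)"
  using assms by (intro MatI) (auto intro: Mat_entry carrier_zero dest: Mat_carrier)

lemma four_block_bimult:
  assumes x: "x \<in> Mat V m" and y: "y \<in> Mat V n"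
  shows "four_block_mat x (0\<^sub>m m n) (0\<^sub>m n m) y =
    bimult V (inj1 m n) x (mat_adjoint (inj1 m n)) + bimult V (inj2 m n) y (mat_adjoint (inj2 m n))"
proof (rule eq_matI)
  fix i j
  assume "i < dim_row (bimult V (inj1 m n) x (mat_adjoint (inj1 m n)) + bimult V (inj2 m n) y (mat_adjoint (inj2 m n)))"
    "j < dim_col (bimult V (inj1 m n) x (mat_adjoint (inj1 m n)) + bimult V (inj2 m n) y (mat_adjoint (inj2 m n)))"
  then have ij: "i < m + n" "j < m + n" by auto
  have "bimult V (inj1 m n) x (mat_adjoint (inj1 m n)) $$ (i, j) = (if i < m \<and> j < m then vscale V (1 * 1) (x $$ (i, j)) else 0)"
    using ij by (intro bimult_select[OF x]) (auto simp: inj1_def)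
  moreover have "bimult V (inj2 m n) y (mat_adjoint (inj2 m n)) $$ (i, j) =
    (if i - m < n \<and> j - m < n then vscale V ((if m \<le> i then 1 else 0) * (if m \<le> j then 1 else 0)) (y $$ (i - m, j - m)) else 0)"
    using ij by (intro bimult_select[OF y]) (auto simp: inj2_def)
  ultimately show "four_block_mat x (0\<^sub>m m n) (0\<^sub>m n m) y $$ (i, j) =
      (bimult V (inj1 m n) x (mat_adjoint (inj1 m n)) + bimult V (inj2 m n) y (mat_adjoint (inj2 m n))) $$ (i, j)"
    using ij x y by auto
qed (use x y in auto)

text \<open>The Booleans select the block row \<open>p\<close> and block column \<open>q\<close>,
  with \<open>True\<close> for the first and \<open>False\<close> for the second.\<close>

definition blk :: "nat \<Rightarrow> bool \<Rightarrow> bool \<Rightarrow> 'a mat \<Rightarrow> 'a mat" where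
  "blk n p q z = bimult V (mat_adjoint (if p then inj1 n n else inj2 n n)) z (if q then inj1 n n else inj2 n n)"

lemma Mat_blk: "z \<in> Mat V (n + n) \<Longrightarrow> blk n p q z \<in> Mat V n"
  unfolding blk_def by (intro Mat_bimult[of _ "n + n"]) auto

lemma blk_dim [simp]: "dim_row (blk n p q z) = n" "dim_col (blk n p q z) = n"
  by (auto simp: blk_def)

lemma blk_index:
  assumes "z \<in> Mat V (n + n)" "i < n" "j < n"
  shows "blk n p q z $$ (i, j) = z $$ (if p then i else n + i, if q then j else n + j)"
proof -
  have "blk n p q z $$ (i, j) = (if (if p then i else n + i) < n + n \<and> (if q then j else n + j) < n + n
     then vscale V (1 * 1) (z $$ (if p then i else n + i, if q then j else n + j)) else 0)"
    unfolding blk_def using assms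
    by (intro bimult_select[OF assms(1)]) (auto simp: inj1_def inj2_def split: if_splits)
  then show ?thesis using assms by auto
qed

lemma blk_add: "z \<in> Mat V (n + n) \<Longrightarrow> w \<in> Mat V (n + n) \<Longrightarrow> blk n p q (z + w) = blk n p q z + blk n p q w"
  unfolding blk_def by (rule bimult_add)

lemma mstar_blk:
  assumes "z \<in> Mat V (n + n)"
  shows "mstar V (blk n p q z) = blk n q p (mstar V z)"
  unfolding blk_def using assms by (subst mstar_bimult[where m="n+n" and n=n]) auto

lemma four_block_blk:
  assumes "z \<in> Mat V (n + n)"
  shows "z = four_block_mat (blk n True True z) (blk n True False z) (blk n False True z) (blk n False False z)"
  using assms by (intro eq_matI) (auto simp: blk_index)

end

context mo_op_space begin

text \<open>\<open>pos2 n a x b\<close>: the block matrix with rows \<open>(a, x)\<close> and \<open>(x\<^sup>*, b)\<close> is positive. Its corner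
  \<open>x\<^sup>*\<close> need not be mentioned, as positive elements are self-adjoint.\<close>

definition pos2 :: "nat \<Rightarrow> 'a mat \<Rightarrow> 'a mat \<Rightarrow> 'a mat \<Rightarrow> bool" where
  "pos2 n a x b \<longleftrightarrow>
     (\<exists>z\<in>mcone V (n + n). blk n True True z = a \<and> blk n True False z = x \<and> blk n False False z = b)"

lemma pos2_Mat:
  assumes "0 < n" "pos2 n a x b"
  shows "a \<in> Mat V n" "x \<in> Mat V n" "b \<in> Mat V n"
  using assms by (auto simp: pos2_def intro!: Mat_blk cone_Mat)

text \<open>Stack \<open>\<gamma>\<close> on \<open>\<delta>\<close> to a column
  \<open>\<Gamma>\<close>. Conjugating \<open>z\<close> by \<open>\<Gamma>\<close> keeps it
  positive, and the blocks of the result are the displayed ones. It is the main source of positive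
  block matrices here.\<close>

lemma pos2_pair:
  assumes "0 < p" "0 < m" "z \<in> mcone V p" "\<gamma> \<in> carrier_mat m p" "\<delta> \<in> carrier_mat m p"
  shows "pos2 m (bimult V \<gamma> z (mat_adjoint \<gamma>)) (bimult V \<gamma> z (mat_adjoint \<delta>)) (bimult V \<delta> z (mat_adjoint \<delta>))"
proof -
  define \<Gamma> where "\<Gamma> = inj1 m m * \<gamma> + inj2 m m * \<delta>"
  have \<Gamma>: "\<Gamma> \<in> carrier_mat (m + m) p" using assms by (auto simp: \<Gamma>_def)
  have z: "z \<in> Mat V p" using assms cone_Mat by blast
  let ?z = "bimult V \<Gamma> z (mat_adjoint \<Gamma>)"
  let ?E = "\<lambda>q. if q then inj1 m m else inj2 m m" and ?g = "\<lambda>q. if q then \<gamma> else \<delta>"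
  have E: "?E q \<in> carrier_mat (m + m) m" for q by auto
  have g: "mat_adjoint (?E q) * \<Gamma> = ?g q" for q
    using adj_inj1_sum[of \<gamma> m p \<delta> m] assms by (auto simp: \<Gamma>_def)
  have "mat_adjoint \<Gamma> * ?E q = mat_adjoint (mat_adjoint (?E q) * \<Gamma>)" for q
    using adjoint_mult[OF adjoint_carrier[OF E] \<Gamma>, of q] by simp
  then have g': "mat_adjoint \<Gamma> * ?E q = mat_adjoint (?g q)" for q
    using g by simp
  have "blk m q r ?z = bimult V (?g q) z (mat_adjoint (?g r))" for q r
    unfolding blk_def
    by (subst bimult_bimult[OF z adjoint_carrier[OF E] \<Gamma> adjoint_carrier[OF \<Gamma>] E]) (simp only: g g')
  moreover have "?z \<in> mcone V (m + m)"
    using assms \<Gamma> by (intro cone_bimult) auto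
  ultimately show ?thesis unfolding pos2_def by (intro bexI[of _ ?z]) auto
qed

lemma pos2_add:
  assumes n: "0 < n" and "pos2 n a x b" "pos2 n a' x' b'"
  shows "pos2 n (a + a') (x + x') (b + b')"
proof -
  obtain z z' where z: "z \<in> mcone V (n + n)" "blk n True True z = a" "blk n True False z = x" "blk n False False z = b"
    and z': "z' \<in> mcone V (n + n)" "blk n True True z' = a'" "blk n True False z' = x'" "blk n False False z' = b'"
    using assms by (auto simp: pos2_def)
  have "z \<in> Mat V (n + n)" "z' \<in> Mat V (n + n)" using z(1) z'(1) n by (auto intro: cone_Mat)
  then show ?thesis
    unfolding pos2_def using z z' n by (intro bexI[of _ "z + z'"]) (auto simp: blk_add intro!: cone_add)
qed

text \<open>Conjugation of the block matrix by the block diagonal matrix of \<open>\<alpha>\<close>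
  and the adjoint of \<open>\<beta>\<close>: the corner is multiplied by independent factors, each
  diagonal entry only by its own.\<close>

lemma pos2_bimult:
  assumes n: "0 < n" "0 < m" and "pos2 n a x b" and c: "\<alpha> \<in> carrier_mat m n" "\<beta> \<in> carrier_mat n m"
  shows "pos2 m (bimult V \<alpha> a (mat_adjoint \<alpha>)) (bimult V \<alpha> x \<beta>) (bimult V (mat_adjoint \<beta>) b \<beta>)"
proof -
  obtain z where z: "z \<in> mcone V (n + n)" "blk n True True z = a" "blk n True False z = x" "blk n False False z = b"
    using assms by (auto simp: pos2_def)
  have zM: "z \<in> Mat V (n + n)" using cone_Mat[OF _ z(1)] n by simp
  let ?A = "mat_adjoint (inj1 n n)" and ?B = "mat_adjoint (inj2 n n)"
  have AB: "?A \<in> carrier_mat n (n + n)" "?B \<in> carrier_mat n (n + n)" by auto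
  have "pos2 m (bimult V (\<alpha> * ?A) z (mat_adjoint (\<alpha> * ?A))) (bimult V (\<alpha> * ?A) z (mat_adjoint (mat_adjoint \<beta> * ?B)))
     (bimult V (mat_adjoint \<beta> * ?B) z (mat_adjoint (mat_adjoint \<beta> * ?B)))"
    using z n c AB by (intro pos2_pair) (auto intro!: mult_carrier_mat)
  moreover have "mat_adjoint (\<alpha> * ?A) = inj1 n n * mat_adjoint \<alpha>"
    by (subst adjoint_mult[OF c(1) AB(1)]) simp
  moreover have "mat_adjoint (mat_adjoint \<beta> * ?B) = inj2 n n * \<beta>"
    by (subst adjoint_mult[OF adjoint_carrier[OF c(2)] AB(2)]) simp
  moreover have "bimult V (\<gamma> * ?A) z (inj1 n n * \<delta>) = bimult V \<gamma> a \<delta>"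
    "bimult V (\<gamma> * ?A) z (inj2 n n * \<delta>) = bimult V \<gamma> x \<delta>"
    "bimult V (\<gamma> * ?B) z (inj2 n n * \<delta>) = bimult V \<gamma> b \<delta>"
    if "\<gamma> \<in> carrier_mat m n" "\<delta> \<in> carrier_mat n m" for \<gamma> \<delta>
    using that bimult_bimult[OF zM that(1) AB(1) inj_carrier(1) that(2)] bimult_bimult[OF zM that(1) AB(1) inj_carrier(2) that(2)]
      bimult_bimult[OF zM that(1) AB(2) inj_carrier(2) that(2)] 
    unfolding z(2-4)[symmetric] blk_def by auto
  ultimately show ?thesis using c by simp
qed

text \<open>Interchanging the two block rows and the two block columns.\<close>

lemma pos2_mstar:
  assumes n: "0 < n" and "pos2 n a x b"
  shows "pos2 n b (mstar V x) a"
proof -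
  obtain z where z: "z \<in> mcone V (n + n)" "blk n True True z = a" "blk n True False z = x" "blk n False False z = b"
    using assms by (auto simp: pos2_def)
  have zM: "z \<in> Mat V (n + n)" "mstar V z = z" using cone_Mat[OF _ z(1)] cone_sa[OF _ z(1)] n by simp_all
  have "mstar V x = blk n False True z" using mstar_blk[OF zM(1), where p=True and q=False] z zM by simp
  moreover have "pos2 n (bimult V (mat_adjoint (inj2 n n)) z (mat_adjoint (mat_adjoint (inj2 n n)))) 
     (bimult V (mat_adjoint (inj2 n n)) z (mat_adjoint (mat_adjoint (inj1 n n))))
     (bimult V (mat_adjoint (inj1 n n)) z (mat_adjoint (mat_adjoint (inj1 n n))))"
    using z n by (intro pos2_pair) auto
  ultimately show ?thesis using z by (simp add: blk_def)
qed

lemma pos2_self: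
  assumes n: "0 < n" and u: "u \<in> mcone V n"
  shows "pos2 n u u u"
  using pos2_pair[OF n n u one_carrier_mat one_carrier_mat] u n by (simp add: bimult_one cone_Mat)

lemma pos2_neg:
  assumes n: "0 < n" and u: "u \<in> mcone V n"
  shows "pos2 n u (- u) u"
proof -
  have uM: "u \<in> Mat V n" using u n cone_Mat by blast
  have o: "(-1) \<cdot>\<^sub>m 1\<^sub>m n \<in> carrier_mat n n" by simp
  have "pos2 n (bimult V (1\<^sub>m n) u (1\<^sub>m n)) (bimult V (1\<^sub>m n) u ((-1) \<cdot>\<^sub>m 1\<^sub>m n)) (bimult V ((-1) \<cdot>\<^sub>m 1\<^sub>m n) u ((-1) \<cdot>\<^sub>m 1\<^sub>m n))"
    using pos2_pair[OF n n u one_carrier_mat o] by (simp add: adjoint_smult)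
  then show ?thesis
    using uM by (simp add: bimult_smult_right[OF uM one_carrier_mat] bimult_smult_right[where n=n and m=n] bimult_smult_left[OF uM one_carrier_mat] 
       bimult_one uminus_mscale)
qed

text \<open>Half of \<open>u + v\<close> is spread over the block pattern with all signs plus, half
  of \<open>u - v\<close> over the pattern with negative corners; the sum has diagonal
  \<open>u\<close>, \<open>u\<close> and corner \<open>v\<close>.\<close>

lemma pos2_of_order:
  assumes n: "0 < n" and v: "v \<in> Mat V n" and u: "u \<in> Mat V n" and c: "u + v \<in> mcone V n" "u - v \<in> mcone V n"
  shows "pos2 n u v u"
proof -
  let ?h = "mscale V (complex_of_real (1/2))"
  have p: "?h (u + v) \<in> mcone V n" "?h (u - v) \<in> mcone V n"
    using cone_scale[OF n c(1), of "1/2"] cone_scale[OF n c(2), of "1/2"] by simp_all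
  have half: "vscale V (1/2) w + vscale V (1/2) w = w" for w
    using vs.scale_left_distrib[of "1/2" "1/2" w] by simp
  have e: "?h (u + v) + ?h (u - v) = u" "?h (u + v) + - ?h (u - v) = v"
    using u v by (auto intro!: eq_matI simp: mscale_index vs.scale_right_distrib vs.scale_right_diff_distrib half)
  show ?thesis using pos2_add[OF n pos2_self[OF n p(1)] pos2_neg[OF n p(2)]] unfolding e .
qed

text \<open>Compression to the vectors \<open>(1, s)\<close> with \<open>s = \<plusminus>1\<close>
  gives \<open>a + b \<plusminus> 2 v\<close>, because both corners equal \<open>v\<close> for
  self-adjoint \<open>v\<close>. Halving gives the claim.\<close>

lemma order_of_pos2:
  assumes n: "0 < n" and "pos2 n a v b" and v: "mstar V v = v"
  shows "mscale V (1/2) (a + b) + v \<in> mcone V n" "mscale V (1/2) (a + b) - v \<in> mcone V n"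
proof -
  obtain z where z: "z \<in> mcone V (n + n)" "blk n True True z = a" "blk n True False z = v" "blk n False False z = b"
    using assms by (auto simp: pos2_def)
  have zM: "z \<in> Mat V (n + n)" "mstar V z = z" using cone_Mat[OF _ z(1)] cone_sa[OF _ z(1)] n by simp_all
  have v': "blk n False True z = v" using mstar_blk[OF zM(1), where p=True and q=False] z zM v by simp
  have M: "a \<in> Mat V n" "v \<in> Mat V n" "b \<in> Mat V n" using pos2_Mat assms by blast+
  have "mscale V (1/2) (a + b) + mscale V (complex_of_real s) v \<in> mcone V n" if s: "s * s = 1" for s
  proof -
    let ?g = "inj1 n n + complex_of_real s \<cdot>\<^sub>m inj2 n n"
    have g: "?g \<in> carrier_mat (n + n) n" by (rule add_carrier_mat) simp
    have ga: "mat_adjoint ?g = mat_adjoint (inj1 n n) + complex_of_real s \<cdot>\<^sub>m mat_adjoint (inj2 n n)"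
      by (subst adjoint_add[where n="n+n" and m=n]) (auto simp: adjoint_smult)
    have "bimult V (mat_adjoint ?g) z ?g = (a + mscale V (complex_of_real s) v) + mscale V (complex_of_real s) (v + mscale V (complex_of_real s) b)"
    proof -
      have "bimult V (mat_adjoint ?g) z ?g = bimult V (mat_adjoint (inj1 n n)) z ?g + mscale V (complex_of_real s) (bimult V (mat_adjoint (inj2 n n)) z ?g)"
        unfolding ga by (subst bimult_add_left[OF zM(1), where n=n]) (auto simp: bimult_smult_left[OF zM(1), where n=n])
      moreover have "bimult V \<gamma> z ?g = bimult V \<gamma> z (inj1 n n) + mscale V (complex_of_real s) (bimult V \<gamma> z (inj2 n n))" for \<gamma>
        by (subst bimult_add_right[OF zM(1), where n=n]) (auto simp: bimult_smult_right[OF zM(1), where n=n])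
      ultimately show ?thesis using z v' by (simp add: blk_def)
    qed
    moreover have "bimult V (mat_adjoint ?g) z ?g \<in> mcone V n"
      using n z g by (intro cone_adj_bimult) auto
    ultimately have "mscale V (complex_of_real (1/2)) ((a + mscale V (complex_of_real s) v) + mscale V (complex_of_real s) (v + mscale V (complex_of_real s) b)) \<in> mcone V n"
      using cone_scale[OF n, of _ "1/2"] by simp
    moreover have "mscale V (complex_of_real (1/2)) ((a + mscale V (complex_of_real s) v) + mscale V (complex_of_real s) (v + mscale V (complex_of_real s) b))
       = mscale V (1/2) (a + b) + mscale V (complex_of_real s) v"
    proof -
      have s1: "s = 1 \<or> s = - 1" using s by (simp add: square_eq_1_iff)
      have half: "vscale V (1/2) w + vscale V (1/2) w = w" for w
        using vs.scale_left_distrib[of "1/2" "1/2" w] by simp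
      have "vscale V (1/2) ((x + vscale V (complex_of_real s) w) + vscale V (complex_of_real s) (w + vscale V (complex_of_real s) y)) = 
         vscale V (1/2) (x + y) + vscale V (complex_of_real s) w" for x y w
        using s1
      proof
        assume "s = 1"
        have "vscale V (1/2) ((x + w) + (w + y)) = vscale V (1/2) (x + y) + (vscale V (1/2) w + vscale V (1/2) w)"
          by (simp add: vs.scale_right_distrib ac_simps)
        then show ?thesis using \<open>s = 1\<close> by (simp add: half)
      next
        assume "s = -1"
        have "vscale V (1/2) ((x - w) + (y - w)) = vscale V (1/2) (x + y) - (vscale V (1/2) w + vscale V (1/2) w)"
          by (simp add: vs.scale_right_distrib vs.scale_right_diff_distrib algebra_simps)
        then show ?thesis using \<open>s = -1\<close> by (simp add: half)
      qed
      then show ?thesis using M by (intro eq_matI) (auto simp: mscale_index)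
    qed
    ultimately show ?thesis by simp
  qed
  from this[of 1] this[of "-1"] show "mscale V (1/2) (a + b) + v \<in> mcone V n" "mscale V (1/2) (a + b) - v \<in> mcone V n"
    using M by (simp_all add: minus_mscale[where n=n] Mat_mscale Mat_add)
qed

text \<open>Adding the two matrices embedded along complementary coordinates produces the direct sum
  in each block at once, so no permutation of rows and columns is needed.\<close>

lemma pos2_four_block:
  assumes m: "0 < m" and n: "0 < n" and "pos2 m a x b" "pos2 n a' x' b'"
  shows "pos2 (m + n) (four_block_mat a (0\<^sub>m m n) (0\<^sub>m n m) a') (four_block_mat x (0\<^sub>m m n) (0\<^sub>m n m) x')
    (four_block_mat b (0\<^sub>m m n) (0\<^sub>m n m) b')"
proof -
  have "pos2 (m + n) (bimult V (inj1 m n) a (mat_adjoint (inj1 m n))) (bimult V (inj1 m n) x (mat_adjoint (inj1 m n)))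
    (bimult V (mat_adjoint (mat_adjoint (inj1 m n))) b (mat_adjoint (inj1 m n)))"
    using assms by (intro pos2_bimult) auto
  moreover have "pos2 (m + n) (bimult V (inj2 m n) a' (mat_adjoint (inj2 m n))) (bimult V (inj2 m n) x' (mat_adjoint (inj2 m n)))
    (bimult V (mat_adjoint (mat_adjoint (inj2 m n))) b' (mat_adjoint (inj2 m n)))"
    using assms by (intro pos2_bimult) auto
  ultimately show ?thesis
    using pos2_Mat[OF assms(1,3)] pos2_Mat[OF assms(2,4)] m by (simp add: four_block_bimult pos2_add)
qed

text \<open>Let \<open>D\<close> be the block diagonal of \<open>a\<close>, \<open>b\<close> and
  \<open>O\<close> the off-diagonal part. Both \<open>D + O\<close> and \<open>D - O\<close> are
  positive, so a positive functional satisfies \<open>|\<phi> O| \<le> \<phi> D\<close>, and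
  \<open>\<phi> D\<close> is at most the norm of \<open>D\<close>.\<close>

lemma num_radius_le:
  assumes n: "0 < n" and "pos2 n a x b"
  shows "num_radius V n x \<le> max (mnorm V a) (mnorm V b)"
proof -
  have M: "a \<in> Mat V n" "x \<in> Mat V n" "b \<in> Mat V n" using pos2_Mat assms by blast+
  obtain z where z: "z \<in> mcone V (n + n)" "blk n True True z = a" "blk n True False z = x" "blk n False False z = b"
    using assms by (auto simp: pos2_def)
  \<comment> \<open>Conjugation by a sign on the first summand negates the corner and keeps the
    diagonal.\<close>
  have "pos2 n (bimult V (mat_adjoint ((-1) \<cdot>\<^sub>m 1\<^sub>m n)) a (mat_adjoint (mat_adjoint ((-1) \<cdot>\<^sub>m 1\<^sub>m n)))) (bimult V (mat_adjoint ((-1) \<cdot>\<^sub>m 1\<^sub>m n)) x (1\<^sub>m n))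
     (bimult V (mat_adjoint (1\<^sub>m n)) b (1\<^sub>m n))"
    using assms by (intro pos2_bimult) auto
  then have "pos2 n a (mscale V (-1) x) b"
    using M by (simp add: adjoint_smult bimult_one bimult_smult_left[where m=n and n=n] bimult_smult_right[where m=n and n=n])
  then obtain w where w: "w \<in> mcone V (n + n)" "blk n True True w = a" "blk n True False w = mscale V (-1) x" "blk n False False w = b"
    by (auto simp: pos2_def)
  let ?O = "four_block_mat (0\<^sub>m n n) x (mstar V x) (0\<^sub>m n n)" and ?D = "four_block_mat a (0\<^sub>m n n) (0\<^sub>m n n) b"
  have zM: "z \<in> Mat V (n + n)" "mstar V z = z" and wM: "w \<in> Mat V (n + n)" "mstar V w = w"
    using cone_Mat[OF _ z(1)] cone_sa[OF _ z(1)] cone_Mat[OF _ w(1)] cone_sa[OF _ w(1)] n by simp_all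
  have z': "blk n False True z = mstar V x" using mstar_blk[OF zM(1), where p=True and q=False] z zM by simp
  have w': "blk n False True w = mscale V (-1) (mstar V x)"
    using mstar_blk[OF wM(1), where p=True and q=False] w wM M by (simp add: mstar_mscale)
  have O: "?O \<in> Mat V (n + n)"
    using M Mat_mstar[OF M(2)] by (intro MatI) (auto intro: Mat_entry carrier_zero dest: Mat_carrier)
  have D: "?D \<in> Mat V (n + n)" using M by (intro Mat_four_block)
  have zD: "z = ?D + ?O" 
    by (subst four_block_blk[OF zM(1)]) (use M z z' in \<open>auto intro!: eq_matI\<close>)
  have wD: "w = ?D + mscale V (-1) ?O"
    by (subst four_block_blk[OF wM(1)]) (use M w w' in \<open>auto intro!: eq_matI simp: mscale_index\<close>)
  have nD: "mnorm V ?D = max (mnorm V a) (mnorm V b)" using norm_four_block[OF n n M(1,3)] .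
  show ?thesis
    unfolding num_radius_def
  proof (rule cSup_least)
    \<comment> \<open>The supremum must range over a nonempty set; the zero functional provides an
      element.\<close>
    have "positive_contractive V (2 * n) (\<lambda>_. 0)"
      using n by (auto simp: positive_contractive_def intro!: norm_nonneg[of "2 * n"])
    then show "{cmod (\<phi> ?O) |\<phi>. positive_contractive V (2 * n) \<phi>} \<noteq> {}" by blast
    fix y assume "y \<in> {cmod (\<phi> ?O) |\<phi>. positive_contractive V (2 * n) \<phi>}"
    then obtain \<phi> where y: "y = cmod (\<phi> ?O)" and \<phi>: "positive_contractive V (n + n) \<phi>" by (auto simp: mult_2)
    note ax = \<phi>[unfolded positive_contractive_def]
    note add = ax[THEN conjunct1, rule_format]
      and scale = ax[THEN conjunct2, THEN conjunct1, rule_format]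
      and pos = ax[THEN conjunct2, THEN conjunct2, THEN conjunct2, THEN conjunct1, rule_format]
      and le = ax[THEN conjunct2, THEN conjunct2, THEN conjunct2, THEN conjunct2, rule_format]
    have "\<phi> z = \<phi> ?D + \<phi> ?O" using add[OF D O] zD by simp
    moreover have "\<phi> w = \<phi> ?D - \<phi> ?O" using add[OF D Mat_mscale[OF O]] scale[OF O] wD by simp
    ultimately have p: "0 \<le> \<phi> ?D + \<phi> ?O" "0 \<le> \<phi> ?D - \<phi> ?O" using pos[OF z(1)] pos[OF w(1)] by simp_all
    \<comment> \<open>Nonnegative complex numbers are real. Since the sum and the difference are
      real, so is the value at the off-diagonal part, and its modulus is that of its real
      part.\<close>
    then have "Im (\<phi> ?D) + Im (\<phi> ?O) = 0" "Im (\<phi> ?D) - Im (\<phi> ?O) = 0" 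
      "0 \<le> Re (\<phi> ?D) + Re (\<phi> ?O)" "0 \<le> Re (\<phi> ?D) - Re (\<phi> ?O)"
      by (simp_all add: less_eq_complex_def)
    then have "cmod (\<phi> ?O) \<le> Re (\<phi> ?D)" by (simp add: cmod_def)
    also have "\<dots> \<le> max (mnorm V a) (mnorm V b)"
      using le[OF D] complex_Re_le_cmod[of "\<phi> ?D"] nD by simp
    finally show "y \<le> max (mnorm V a) (mnorm V b)" unfolding y .
  qed
qed

end

section \<open>The regularized norm\<close>

lemma limitin_metric_transfer:
  assumes m: "Metric_space M d" "Metric_space M d'"
    and le: "\<And>x y. x \<in> M \<Longrightarrow> y \<in> M \<Longrightarrow> d x y \<le> k * d' x y" and k: "0 < k"
    and l: "limitin (Metric_space.mtopology M d') \<sigma> l sequentially"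
  shows "limitin (Metric_space.mtopology M d) \<sigma> l sequentially"
  unfolding Metric_space.limitin_metric[OF m(1)]
proof (intro conjI allI impI)
  note l' = l[unfolded Metric_space.limitin_metric[OF m(2)]]
  show "l \<in> M" using l' by blast
  fix e :: real assume "0 < e"
  then have "\<forall>\<^sub>F n in sequentially. \<sigma> n \<in> M \<and> d' (\<sigma> n) l < e / k" using l' k by simp
  then show "\<forall>\<^sub>F n in sequentially. \<sigma> n \<in> M \<and> d (\<sigma> n) l < e"
  proof eventually_elim
    case (elim n)
    then have "d (\<sigma> n) l \<le> k * d' (\<sigma> n) l" using le \<open>l \<in> M\<close> by blast
    also have "\<dots> < e" using elim k by (simp add: pos_less_divide_eq mult.commute)
    finally show ?case using elim by simp
  qed
qed

lemma closedin_metric_transfer: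
  assumes m: "Metric_space M d" "Metric_space M d'"
    and le: "\<And>x y. x \<in> M \<Longrightarrow> y \<in> M \<Longrightarrow> d x y \<le> k * d' x y" and k: "0 < k"
    and c: "closedin (Metric_space.mtopology M d) S"
  shows "closedin (Metric_space.mtopology M d') S"
  using c limitin_metric_transfer[OF m le k]
  unfolding Metric_space.metric_closedin_iff_sequentially_closed[OF m(1)]
    Metric_space.metric_closedin_iff_sequentially_closed[OF m(2)] by blast

lemma mcomplete_metric_transfer:
  assumes m: "Metric_space M d" "Metric_space M d'"
    and le: "\<And>x y. x \<in> M \<Longrightarrow> y \<in> M \<Longrightarrow> d x y \<le> k * d' x y" and k: "0 < k"
    and le': "\<And>x y. x \<in> M \<Longrightarrow> y \<in> M \<Longrightarrow> d' x y \<le> k' * d x y" and k': "0 < k'"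
    and c: "Metric_space.mcomplete M d"
  shows "Metric_space.mcomplete M d'"
  unfolding Metric_space.mcomplete_def[OF m(2)]
proof (intro allI impI)
  fix \<sigma> assume \<sigma>: "Metric_space.MCauchy M d' \<sigma>"
  have "Metric_space.MCauchy M d \<sigma>"
    unfolding Metric_space.MCauchy_def[OF m(1)]
  proof (intro conjI allI impI)
    show M: "range \<sigma> \<subseteq> M" using \<sigma> by (simp add: Metric_space.MCauchy_def[OF m(2)])
    fix e :: real assume "0 < e"
    then have "0 < e / k" using k by simp
    then obtain N where N: "\<And>n n'. N \<le> n \<Longrightarrow> N \<le> n' \<Longrightarrow> d' (\<sigma> n) (\<sigma> n') < e / k"
      using \<sigma> unfolding Metric_space.MCauchy_def[OF m(2)] by blast
    have "d (\<sigma> n) (\<sigma> n') < e" if "N \<le> n" "N \<le> n'" for n n'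
    proof -
      have "d (\<sigma> n) (\<sigma> n') \<le> k * d' (\<sigma> n) (\<sigma> n')" using le M by blast
      also have "\<dots> < e" using N[OF that] k by (simp add: pos_less_divide_eq mult.commute)
      finally show ?thesis .
    qed
    then show "\<exists>N. \<forall>n n'. N \<le> n \<longrightarrow> N \<le> n' \<longrightarrow> d (\<sigma> n) (\<sigma> n') < e" by blast
  qed
  then obtain x where "limitin (Metric_space.mtopology M d) \<sigma> x sequentially"
    using c unfolding Metric_space.mcomplete_def[OF m(1)] by blast
  then show "\<exists>x. limitin (Metric_space.mtopology M d') \<sigma> x sequentially"
    using limitin_metric_transfer[OF m(2,1) le' k'] by blast
qed

lemma sq_bounded_isometry:
  assumes "mat_adjoint A * A = 1\<^sub>m q" "A \<in> carrier_mat p q"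
  shows "sq_bounded 1 A"
  unfolding sq_bounded_def
proof
  fix v :: "complex vec" assume "v \<in> carrier_vec (dim_col A)"
  then have v: "v \<in> carrier_vec q" using assms by simp
  have "complex_of_real (sqnorm (A *\<^sub>v v)) = v \<bullet>c (mat_adjoint A *\<^sub>v (A *\<^sub>v v))"
    using cscalar_prod_adjoint[OF assms(2) v, of "A *\<^sub>v v"] assms v by (simp add: cscalar_prod_self)
  also have "mat_adjoint A *\<^sub>v (A *\<^sub>v v) = v"
    using assms v assoc_mult_mat_vec[OF adjoint_carrier[OF assms(2)] assms(2) v] by simp
  finally show "sqnorm (A *\<^sub>v v) \<le> 1 * sqnorm v" by (simp add: cscalar_prod_self)
qed

context op_space begin

lemma norm_conj_le:
  assumes "0 < m" "0 < n" "a \<in> Mat V m" "\<gamma> \<in> carrier_mat n m" "sq_bounded c \<gamma>" "0 \<le> c"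
  shows "mnorm V (bimult V \<gamma> a (mat_adjoint \<gamma>)) \<le> c * mnorm V a"
proof -
  have "sqrt c * mnorm V a * sqrt c = (sqrt c * sqrt c) * mnorm V a" by (simp only: mult_ac)
  also have "\<dots> = c * mnorm V a" using assms(6) by simp
  finally have e: "sqrt c * mnorm V a * sqrt c = c * mnorm V a" .
  show ?thesis
    using norm_bimult_le[OF assms(1-4) adjoint_carrier[OF assms(4)] assms(5) sq_bounded_adjoint[OF assms(5,6)] assms(6,6)]
    unfolding e .
qed

end

definition regular_norm :: "('a::ab_group_add) mo_space \<Rightarrow> 'a mat \<Rightarrow> real" where
  "regular_norm V x = Inf {max (mnorm V a) (mnorm V b) | a b. mo_op_space.pos2 V (dim_row x) a x b}"

definition regularization :: "('a::ab_group_add) mo_space \<Rightarrow> 'a mo_space" where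
  "regularization V = V\<lparr>mnorm := regular_norm V\<rparr>"

lemma regularization_simps [simp]:
  "vcarrier (regularization V) = vcarrier V" "vscale (regularization V) = vscale V"
  "vstar (regularization V) = vstar V" "mcone (regularization V) = mcone V"
  "mnorm (regularization V) = regular_norm V"
  by (simp_all add: regularization_def)

lemma regularization_ops [simp]:
  "Mat (regularization V) = Mat V" "mscale (regularization V) = mscale V" "mstar (regularization V) = mstar V"
  "Mat_sa (regularization V) = Mat_sa V" "bimult (regularization V) = bimult V" "mle (regularization V) = mle V"
  "star_vector_space (regularization V) = star_vector_space V" "matrix_ordered (regularization V) = matrix_ordered V"
  by (auto simp: Mat_def mscale_def mstar_def Mat_sa_def bimult_def mle_def star_vector_space_def matrix_ordered_def fun_eq_iff)

text \<open>The two assumptions are the two halves of norm equivalence and all that the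
  regularization requires. The operator system property of the space will supply
  \<open>dominated\<close>; its dual together with completeness will supply
  \<open>generated\<close>.\<close>

locale generated_space = mo_op_space +
  fixes k C :: real
  assumes k_pos: "0 < k" and C_pos: "0 < C"
    and dominated: "0 < n \<Longrightarrow> pos2 n a x b \<Longrightarrow> mnorm V x \<le> k * max (mnorm V a) (mnorm V b)"
    and generated: "0 < n \<Longrightarrow> x \<in> Mat V n \<Longrightarrow> \<exists>a b. pos2 n a x b \<and> mnorm V a \<le> C * mnorm V x \<and> mnorm V b \<le> C * mnorm V x"
begin

lemma regular_norm_le:
  assumes "0 < n" "pos2 n a x b" "max (mnorm V a) (mnorm V b) \<le> t"
  shows "regular_norm V x \<le> t"
proof -
  have [simp]: "dim_row x = n" using pos2_Mat[OF assms(1,2)] by simp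
  have "regular_norm V x \<le> max (mnorm V a) (mnorm V b)"
    unfolding regular_norm_def
  proof (rule cInf_lower)
    show "bdd_below {max (mnorm V a) (mnorm V b) |a b. pos2 (dim_row x) a x b}"
      using pos2_Mat norm_nonneg assms(1) by (intro bdd_belowI[of _ 0]) (fastforce simp: le_max_iff_disj)
  qed (use assms in auto)
  then show ?thesis using assms(3) by (rule order_trans)
qed

text \<open>The infimum need not be attained, so the estimates below work with strict bounds and a
  slack \<open>e\<close>.\<close>

lemma regular_norm_ex:
  assumes "0 < n" "x \<in> Mat V n" "regular_norm V x < t"
  shows "\<exists>a b. pos2 n a x b \<and> mnorm V a < t \<and> mnorm V b < t"
proof -
  have "{max (mnorm V a) (mnorm V b) |a b. pos2 n a x b} \<noteq> {}"
    using generated[OF assms(1,2)] by blast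
  then have "\<exists>y\<in>{max (mnorm V a) (mnorm V b) |a b. pos2 n a x b}. y < t"
    using assms by (intro cInf_lessD) (auto simp: regular_norm_def)
  then obtain a b where "pos2 n a x b" "max (mnorm V a) (mnorm V b) < t" by blast
  then show ?thesis by (intro exI[of _ a] exI[of _ b]) simp
qed

lemma regular_norm_upper: "0 < n \<Longrightarrow> x \<in> Mat V n \<Longrightarrow> regular_norm V x \<le> C * mnorm V x"
  by (metis generated regular_norm_le max.bounded_iff)

lemma regular_norm_lower:
  assumes "0 < n" "x \<in> Mat V n"
  shows "mnorm V x \<le> k * regular_norm V x"
proof (rule field_le_epsilon)
  fix e :: real assume e: "0 < e"
  then have "regular_norm V x < regular_norm V x + e / k" using k_pos by simp
  then obtain a b where ab: "pos2 n a x b" "mnorm V a < regular_norm V x + e / k" "mnorm V b < regular_norm V x + e / k"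
    using regular_norm_ex[OF assms] by blast
  have "mnorm V x \<le> k * max (mnorm V a) (mnorm V b)" using dominated[OF assms(1) ab(1)] .
  also have "\<dots> \<le> k * (regular_norm V x + e / k)" using ab k_pos by (intro mult_left_mono) auto
  finally show "mnorm V x \<le> k * regular_norm V x + e" using k_pos by (simp add: distrib_left)
qed

lemma regular_norm_nonneg: "0 < n \<Longrightarrow> x \<in> Mat V n \<Longrightarrow> 0 \<le> regular_norm V x"
  using order_trans[OF norm_nonneg regular_norm_lower] k_pos by (simp add: zero_le_mult_iff)

lemma regular_norm_triangle:
  assumes "0 < n" "x \<in> Mat V n" "y \<in> Mat V n"
  shows "regular_norm V (x + y) \<le> regular_norm V x + regular_norm V y"
proof (rule field_le_epsilon)
  fix e :: real assume e: "0 < e"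
  obtain a b where ab: "pos2 n a x b" "mnorm V a < regular_norm V x + e/2" "mnorm V b < regular_norm V x + e/2"
    using regular_norm_ex[OF assms(1,2), of "regular_norm V x + e/2"] e by auto
  obtain a' b' where ab': "pos2 n a' y b'" "mnorm V a' < regular_norm V y + e/2" "mnorm V b' < regular_norm V y + e/2"
    using regular_norm_ex[OF assms(1,3), of "regular_norm V y + e/2"] e by auto
  have "mnorm V (a + a') \<le> mnorm V a + mnorm V a'" "mnorm V (b + b') \<le> mnorm V b + mnorm V b'"
    using pos2_Mat[OF assms(1) ab(1)] pos2_Mat[OF assms(1) ab'(1)] assms(1) by (auto intro: norm_triangle)
  then show "regular_norm V (x + y) \<le> regular_norm V x + regular_norm V y + e"
    using ab ab' by (intro regular_norm_le[OF assms(1) pos2_add[OF assms(1) ab(1) ab'(1)]]) auto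
qed

text \<open>Conjugating a block matrix costs the squared norm of \<open>\<alpha>\<close> on one
  diagonal entry and that of \<open>\<beta>\<close> on the other. Moving a scalar between the
  factors leaves the corner alone and equalizes both costs to the product of the norms.\<close>

lemma regular_norm_bimult:
  assumes m: "0 < m" "0 < n" and x: "x \<in> Mat V m" and c: "\<alpha> \<in> carrier_mat n m" "\<beta> \<in> carrier_mat m n"
  shows "regular_norm V (bimult V \<alpha> x \<beta>) \<le> op_norm \<alpha> * regular_norm V x * op_norm \<beta>"
proof -
  let ?r = "regular_norm V x"
  have main: "regular_norm V (bimult V \<alpha> x \<beta>) \<le> (op_norm \<alpha> + e) * (?r + e) * (op_norm \<beta> + e)" if e: "0 < e" for e
  proof -
    \<comment> \<open>The slack keeps both bounds positive, so that their quotient can balance the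
      factors.\<close>
    define c' d' where "c' = op_norm \<alpha> + e" and "d' = op_norm \<beta> + e"
    have pos: "0 < c'" "0 < d'" using e op_norm_nonneg[of \<alpha>] op_norm_nonneg[of \<beta>] by (auto simp: c'_def d'_def)
    obtain a b where ab: "pos2 m a x b" "mnorm V a < ?r + e" "mnorm V b < ?r + e"
      using regular_norm_ex[OF m(1) x, of "?r + e"] e by auto
    note M = pos2_Mat[OF m(1) ab(1)]
    define s where "s = sqrt (d' / c')"
    have s: "0 < s" "s\<^sup>2 = d' / c'" using pos by (auto simp: s_def)
    let ?\<alpha> = "complex_of_real s \<cdot>\<^sub>m \<alpha>" and ?\<beta> = "complex_of_real (1 / s) \<cdot>\<^sub>m \<beta>"
    have c': "?\<alpha> \<in> carrier_mat n m" "?\<beta> \<in> carrier_mat m n" using c by auto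
    have "sq_bounded (c'\<^sup>2) \<alpha>" "sq_bounded (d'\<^sup>2) \<beta>"
      using e by (auto intro!: sq_bounded_mono[OF sq_bounded_op_norm] power_mono op_norm_nonneg simp: c'_def d'_def)
    then have "sq_bounded (s\<^sup>2 * c'\<^sup>2) ?\<alpha>" "sq_bounded ((1/s)\<^sup>2 * d'\<^sup>2) ?\<beta>"
      using sq_bounded_smult[of "c'\<^sup>2" \<alpha> "complex_of_real s"] sq_bounded_smult[of "d'\<^sup>2" \<beta> "complex_of_real (1 / s)"]
      unfolding norm_of_real power2_abs by auto
    moreover have "s\<^sup>2 * c'\<^sup>2 = c' * d'" "(1/s)\<^sup>2 * d'\<^sup>2 = c' * d'"
      unfolding power_divide s(2) using pos by (auto simp: power2_eq_square)
    ultimately have b: "sq_bounded (c' * d') ?\<alpha>" "sq_bounded (c' * d') ?\<beta>" by simp_all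
    have "bimult V ?\<alpha> x ?\<beta> = bimult V \<alpha> x \<beta>"
      using s by (simp add: bimult_smult_left[OF x c(1)] bimult_smult_right[OF x c(2)] flip: of_real_mult)
    then have p: "pos2 n (bimult V ?\<alpha> a (mat_adjoint ?\<alpha>)) (bimult V \<alpha> x \<beta>) (bimult V (mat_adjoint ?\<beta>) b (mat_adjoint (mat_adjoint ?\<beta>)))"
      using pos2_bimult[OF m ab(1) c'] by simp
    have "mnorm V (bimult V ?\<alpha> a (mat_adjoint ?\<alpha>)) \<le> (c' * d') * mnorm V a"
      using m pos M by (intro norm_conj_le[OF m M(1) c'(1) b(1)]) auto
    moreover have "mnorm V (bimult V (mat_adjoint ?\<beta>) b (mat_adjoint (mat_adjoint ?\<beta>))) \<le> (c' * d') * mnorm V b"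
      using m pos M c' by (intro norm_conj_le[OF m M(3) _ sq_bounded_adjoint[OF b(2)]]) auto
    moreover have "(c' * d') * mnorm V a \<le> (c' * d') * (?r + e)" "(c' * d') * mnorm V b \<le> (c' * d') * (?r + e)"
      using ab pos by (auto intro!: mult_left_mono)
    ultimately have "regular_norm V (bimult V \<alpha> x \<beta>) \<le> (c' * d') * (?r + e)"
      by (intro regular_norm_le[OF m(2) p]) auto
    then show ?thesis by (simp add: c'_def d'_def mult_ac)
  qed
  \<comment> \<open>The slack is removed by letting \<open>e\<close> tend to zero from the
    right.\<close>
  have lim: "((\<lambda>e. (op_norm \<alpha> + e) * (?r + e) * (op_norm \<beta> + e)) \<longlongrightarrow> (op_norm \<alpha> + 0) * (?r + 0) * (op_norm \<beta> + 0)) (at_right 0)"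
    by (intro tendsto_intros)
  have "\<forall>\<^sub>F e in at_right 0. regular_norm V (bimult V \<alpha> x \<beta>) \<le> (op_norm \<alpha> + e) * (?r + e) * (op_norm \<beta> + e)"
    using eventually_at_right_less by (rule eventually_mono) (rule main)
  from tendsto_lowerbound[OF lim this] show ?thesis by simp
qed

text \<open>Scaling is multiplication by a scalar matrix, which gives one inequality; the other is
  the same inequality for the inverse scalar.\<close>

lemma regular_norm_mscale:
  assumes n: "0 < n" and x: "x \<in> Mat V n"
  shows "regular_norm V (mscale V c x) = cmod c * regular_norm V x"
proof -
  have bo: "sq_bounded ((cmod c)\<^sup>2) (c \<cdot>\<^sub>m 1\<^sub>m n)" for c
    using sq_bounded_smult[of 1 "1\<^sub>m n" c] by (simp add: sq_bounded_def)
  have op: "op_norm (c \<cdot>\<^sub>m 1\<^sub>m n) \<le> cmod c" for c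
    using op_norm_le[OF bo] by simp
  have op1: "op_norm (1\<^sub>m n) \<le> 1" using op_norm_le[of 1 "1\<^sub>m n"] by (simp add: sq_bounded_def)
  have le: "regular_norm V (mscale V c x) \<le> cmod c * regular_norm V x" if x: "x \<in> Mat V n" for c x
  proof -
    have "mscale V c x = bimult V (c \<cdot>\<^sub>m 1\<^sub>m n) x (1\<^sub>m n)"
      by (simp add: bimult_smult_left[OF x one_carrier_mat] bimult_one[OF x])
    also have "regular_norm V \<dots> \<le> op_norm (c \<cdot>\<^sub>m 1\<^sub>m n) * regular_norm V x * op_norm (1\<^sub>m n)"
      using x n by (intro regular_norm_bimult) auto
    also have "\<dots> \<le> cmod c * regular_norm V x * 1"
      using regular_norm_nonneg[OF n x] op[of c] op1 op_norm_nonneg by (intro mult_mono mult_nonneg_nonneg) auto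
    finally show ?thesis by simp
  qed
  show ?thesis
  proof (cases "c = 0")
    case True
    then show ?thesis using le[OF x, of c] regular_norm_nonneg[OF n Mat_mscale[OF x, of c]] by simp
  next
    case False
    have "regular_norm V (mscale V (1 / c) (mscale V c x)) \<le> cmod (1 / c) * regular_norm V (mscale V c x)"
      by (rule le[OF Mat_mscale[OF x]])
    then have "cmod c * regular_norm V x \<le> regular_norm V (mscale V c x)"
      using False by (simp add: norm_divide field_simps)
    then show ?thesis using le[OF x, of c] by simp
  qed
qed

text \<open>The upper bound takes direct sums of block matrices. The lower bound recovers
  \<open>x\<close> and \<open>y\<close> as compressions by isometries, which do not increase the
  norm.\<close>

lemma regular_norm_four_block:
  assumes m: "0 < m" "0 < n" and x: "x \<in> Mat V m" and y: "y \<in> Mat V n"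
  shows "regular_norm V (four_block_mat x (0\<^sub>m m n) (0\<^sub>m n m) y) = max (regular_norm V x) (regular_norm V y)"
proof (rule antisym)
  let ?z = "four_block_mat x (0\<^sub>m m n) (0\<^sub>m n m) y"
  have z: "?z \<in> Mat V (m + n)" by (rule Mat_four_block[OF x y])
  show "regular_norm V ?z \<le> max (regular_norm V x) (regular_norm V y)"
  proof (rule field_le_epsilon)
    fix e :: real assume e: "0 < e"
    obtain a b where ab: "pos2 m a x b" "mnorm V a < regular_norm V x + e" "mnorm V b < regular_norm V x + e"
      using regular_norm_ex[OF m(1) x, of "regular_norm V x + e"] e by auto
    obtain a' b' where ab': "pos2 n a' y b'" "mnorm V a' < regular_norm V y + e" "mnorm V b' < regular_norm V y + e"
      using regular_norm_ex[OF m(2) y, of "regular_norm V y + e"] e by auto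
    show "regular_norm V ?z \<le> max (regular_norm V x) (regular_norm V y) + e"
      using ab ab' pos2_Mat[OF m(1) ab(1)] pos2_Mat[OF m(2) ab'(1)] m
      by (intro regular_norm_le[OF _ pos2_four_block[OF m ab(1) ab'(1)]]) (auto simp: norm_four_block)
  qed
  have iso: "op_norm A \<le> 1" if "mat_adjoint A * A = 1\<^sub>m q" "A \<in> carrier_mat p q" for A p q
    using op_norm_le[OF sq_bounded_isometry[OF that]] by simp
  have iso': "op_norm (mat_adjoint A) \<le> 1" if "mat_adjoint A * A = 1\<^sub>m q" "A \<in> carrier_mat p q" for A p q
    using op_norm_le[OF sq_bounded_adjoint[OF sq_bounded_isometry[OF that]]] by simp
  have le: "regular_norm V (bimult V (mat_adjoint A) ?z A) \<le> regular_norm V ?z" 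
    if "mat_adjoint A * A = 1\<^sub>m q" "A \<in> carrier_mat (m + n) q" "0 < q" for A q
  proof -
    have "regular_norm V (bimult V (mat_adjoint A) ?z A) \<le> op_norm (mat_adjoint A) * regular_norm V ?z * op_norm A"
      using that m z by (intro regular_norm_bimult[of "m + n" q]) auto
    also have "\<dots> \<le> 1 * regular_norm V ?z * 1"
      using iso[OF that(1,2)] iso'[OF that(1,2)] op_norm_nonneg regular_norm_nonneg[OF _ z] m
      by (intro mult_mono mult_nonneg_nonneg) auto
    finally show ?thesis by simp
  qed
  have "bimult V (mat_adjoint (inj1 m n)) ?z (inj1 m n) = x"
  proof (rule eq_matI)
    fix i j assume "i < dim_row x" "j < dim_col x"
    then have ij: "i < m" "j < m" using x by auto
    have "bimult V (mat_adjoint (inj1 m n)) ?z (inj1 m n) $$ (i, j) = (if i < m + n \<and> j < m + n then vscale V (1 * 1) (?z $$ (i, j)) else 0)"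
      using ij by (intro bimult_select[OF z]) (auto simp: inj1_def)
    then show "bimult V (mat_adjoint (inj1 m n)) ?z (inj1 m n) $$ (i, j) = x $$ (i, j)" using ij x y by auto
  qed (use x in auto)
  moreover have "bimult V (mat_adjoint (inj2 m n)) ?z (inj2 m n) = y"
  proof (rule eq_matI)
    fix i j assume "i < dim_row y" "j < dim_col y"
    then have ij: "i < n" "j < n" using y by auto
    have "bimult V (mat_adjoint (inj2 m n)) ?z (inj2 m n) $$ (i, j) = (if m + i < m + n \<and> m + j < m + n then vscale V (1 * 1) (?z $$ (m + i, m + j)) else 0)"
      using ij by (intro bimult_select[OF z]) (auto simp: inj2_def)
    then show "bimult V (mat_adjoint (inj2 m n)) ?z (inj2 m n) $$ (i, j) = y $$ (i, j)" using ij x y by auto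
  qed (use y in auto)
  ultimately show "max (regular_norm V x) (regular_norm V y) \<le> regular_norm V ?z"
    using le[OF adj_inj_mult(1) inj_carrier(1) m(1)] le[OF adj_inj_mult(4) inj_carrier(2) m(2)] by simp
qed

lemma regular_norm_mstar:
  assumes n: "0 < n" and x: "x \<in> Mat V n"
  shows "regular_norm V (mstar V x) = regular_norm V x"
proof -
  have "regular_norm V (mstar V x) \<le> regular_norm V x" if x: "x \<in> Mat V n" for x
  proof (rule field_le_epsilon)
    fix e :: real assume e: "0 < e"
    obtain a b where ab: "pos2 n a x b" "mnorm V a < regular_norm V x + e" "mnorm V b < regular_norm V x + e"
      using regular_norm_ex[OF n x, of "regular_norm V x + e"] e by auto
    then show "regular_norm V (mstar V x) \<le> regular_norm V x + e"
      by (intro regular_norm_le[OF n pos2_mstar[OF n ab(1)]]) auto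
  qed
  from this[OF x] this[OF Mat_mstar[OF x]] show ?thesis by (simp add: mstar_mstar[OF x])
qed

lemma operator_space_regularization: "operator_space (regularization V)"
  unfolding operator_space_def
proof (intro conjI allI impI ballI)
  show "vector_space (vscale (regularization V))" using vs.vector_space_axioms by simp
  show "module.subspace (vscale (regularization V)) (vcarrier (regularization V))" using subspace by simp
next
  fix n :: nat and x assume n: "0 < n" and "x \<in> Mat (regularization V) n"
  then have x: "x \<in> Mat V n" by simp
  show "0 \<le> mnorm (regularization V) x" using regular_norm_nonneg[OF n x] by simp
  show "mnorm (regularization V) (mscale (regularization V) c x) = cmod c * mnorm (regularization V) x" for c
    using regular_norm_mscale[OF n x] by simp
  show "mnorm (regularization V) x = 0 \<longleftrightarrow> x = 0\<^sub>m n n"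
    using regular_norm_lower[OF n x] regular_norm_upper[OF n x] norm_zero_iff[OF n x] norm_nonneg[OF n x] 
      regular_norm_nonneg[OF n x] by auto
  show "mnorm (regularization V) (x + y) \<le> mnorm (regularization V) x + mnorm (regularization V) y"
    if "y \<in> Mat (regularization V) n" for y using regular_norm_triangle[OF n x] that by simp
qed (use regular_norm_four_block regular_norm_bimult in auto)

sublocale reg: op_space "regularization V"
  by (intro op_space.intro star_space.intro op_space_axioms.intro operator_space_regularization) (simp add: star)

lemma mdist_le:
  assumes "0 < n" "x \<in> Mat V n" "y \<in> Mat V n"
  shows "mdist V n x y \<le> k * mdist (regularization V) n x y" "mdist (regularization V) n x y \<le> C * mdist V n x y"
  using assms by (auto simp: mdist_def intro: regular_norm_lower regular_norm_upper Mat_minus)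

lemma matrix_regular_regularization:
  assumes "complete_norm V"
  shows "matrix_regular (regularization V)"
proof -
  have m: "Metric_space (Mat V n) (mdist V n)" "Metric_space (Mat V n) (mdist (regularization V) n)" if "0 < n" for n
    using Metric_space_mdist[OF that] reg.Metric_space_mdist[OF that] by simp_all
  have "matrix_ordered_operator_space (regularization V)"
    unfolding matrix_ordered_operator_space_def
  proof (intro conjI allI impI ballI)
    show "operator_space (regularization V)" by (rule operator_space_regularization)
    show "matrix_ordered (regularization V)" using mo by simp
    show "mnorm (regularization V) (mstar (regularization V) x) = mnorm (regularization V) x"
      if "0 < n" "x \<in> Mat (regularization V) n" for n x using regular_norm_mstar that by simp
    show "closedin (Metric_space.mtopology (Mat (regularization V) n) (mdist (regularization V) n)) (mcone (regularization V) n)"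
      if n: "0 < n" for n
      using closedin_metric_transfer[OF m[OF n] mdist_le(1)[OF n] k_pos cone_closedin[OF n]] by simp
  qed
  moreover have "complete_norm (regularization V)"
  proof -
    have one: "0 < (1::nat)" by simp
    show ?thesis
      using mcomplete_metric_transfer[OF m[OF one] mdist_le(1)[OF one] k_pos mdist_le(2)[OF one] C_pos] assms
      unfolding complete_norm_def regularization_ops by blast
  qed
  moreover have "regular_norm V v \<le> regular_norm V u"
    if n: "0 < n" and u: "u \<in> mcone V n" and le: "mle V n (- u) v" "mle V n v u" for n u v
  proof (rule field_le_epsilon)
    fix e :: real assume e: "0 < e"
    have M: "u \<in> Mat V n" "v \<in> Mat V n" "mstar V u = u" using u n le by (auto simp: cone_Mat cone_sa mle_def Mat_sa_def)
    have "v - - u = u + v" using M by (intro eq_matI) auto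
    then have c: "u + v \<in> mcone V n" "u - v \<in> mcone V n" using le by (auto simp: mle_def)
    obtain a b where ab: "pos2 n a u b" "mnorm V a < regular_norm V u + e" "mnorm V b < regular_norm V u + e"
      using regular_norm_ex[OF n M(1), of "regular_norm V u + e"] e by auto
    note abM = pos2_Mat[OF n ab(1)]
    \<comment> \<open>The average of the diagonal over the corner \<open>u\<close> dominates
      \<open>u\<close>, and \<open>u\<close> dominates \<open>v\<close> and \<open>- v\<close>.
      Hence \<open>w\<close> does too, and \<open>w\<close> is controlled in the original
      norm.\<close>
    define w where "w = mscale V (1/2) (a + b)"
    have wM: "w \<in> Mat V n" using abM by (simp add: w_def Mat_mscale Mat_add)
    have w: "w - u \<in> mcone V n" using order_of_pos2[OF n ab(1) M(3)] by (simp add: w_def)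
    have "(w - u) + (u + v) = w + v" "(w - u) + (u - v) = w - v"
      using wM M by (auto intro!: eq_matI)
    then have "w + v \<in> mcone V n" "w - v \<in> mcone V n" using cone_add[OF n w c(1)] cone_add[OF n w c(2)] by auto
    then have "pos2 n w v w" using pos2_of_order[OF n M(2) wM] by blast
    moreover have "mnorm V w \<le> regular_norm V u + e"
    proof -
      have "mnorm V w = mnorm V (a + b) / 2" 
        unfolding w_def norm_mscale[OF n Mat_add[OF abM(1,3)]] by (simp only: norm_divide norm_one norm_numeral)
      then show ?thesis using norm_triangle[OF n abM(1,3)] ab(2,3) by linarith
    qed
    ultimately show "regular_norm V v \<le> regular_norm V u + e" by (intro regular_norm_le[OF n]) auto
  qed
  moreover have "\<exists>u\<in>mcone V n. regular_norm V u < 1 \<and> mle V n (- u) v \<and> mle V n v u"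
    if n: "0 < n" and v: "v \<in> Mat_sa V n" and le: "regular_norm V v < 1" for n v
  proof -
    have vM: "v \<in> Mat V n" "mstar V v = v" using v by (auto simp: Mat_sa_def)
    obtain a b where ab: "pos2 n a v b" "mnorm V a < 1" "mnorm V b < 1"
      using regular_norm_ex[OF n vM(1) le] by blast
    note abM = pos2_Mat[OF n ab(1)]
    define u where "u = mscale V (1/2) (a + b)"
    have uM: "u \<in> Mat V n" using abM by (simp add: u_def Mat_mscale Mat_add)
    have c: "u + v \<in> mcone V n" "u - v \<in> mcone V n" using order_of_pos2[OF n ab(1) vM(2)] by (simp_all add: u_def)
    \<comment> \<open>Positivity of \<open>u\<close> itself: it is the average of the positive
      elements \<open>u + v\<close> and \<open>u - v\<close>.\<close>
    have "mscale V (complex_of_real (1/2)) ((u + v) + (u - v)) \<in> mcone V n"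
      by (intro cone_scale cone_add n c) simp
    moreover have half: "vscale V (1/2) w + vscale V (1/2) w = w" for w
      using vs.scale_left_distrib[of "1/2" "1/2" w] by simp
    have "mscale V (complex_of_real (1/2)) ((u + v) + (u - v)) = u"
      using uM vM by (intro eq_matI) (auto simp: mscale_index vs.scale_right_distrib vs.scale_right_diff_distrib half)
    ultimately have u: "u \<in> mcone V n" by simp
    have "mnorm V u < 1"
    proof -
      have "mnorm V u = mnorm V (a + b) / 2" 
        unfolding u_def norm_mscale[OF n Mat_add[OF abM(1,3)]] by (simp only: norm_divide norm_one norm_numeral)
      then show ?thesis using norm_triangle[OF n abM(1,3)] ab(2,3) by linarith
    qed
    moreover have "regular_norm V u \<le> mnorm V u" by (intro regular_norm_le[OF n pos2_self[OF n u]]) simp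
    moreover have usa: "u \<in> Mat_sa V n" "- u \<in> Mat_sa V n" using cone_sa[OF n u] uM
      by (auto simp: Mat_sa_def Mat_mscale uminus_mscale mstar_mscale)
    moreover have "v - - u = u + v" using uM vM by (intro eq_matI) auto
    ultimately show ?thesis using u c v by (intro bexI[of _ u]) (auto simp: mle_def)
  qed
  ultimately show ?thesis unfolding matrix_regular_def by (auto simp: mle_def)
qed

lemma complete_order_isomorphism_regularization: "complete_order_isomorphism V (regularization V) id"
proof -
  have mm: "map_mat f x = x" if "x \<in> Mat V n" "\<And>v. v \<in> vcarrier V \<Longrightarrow> f v = v" for f x n
    using that by (intro eq_matI) (auto simp: Mat_entry)
  have inv: "inv_into (vcarrier V) id v = v" if "v \<in> vcarrier V" for v
    using inv_into_f_f[of id "vcarrier V" v] that by simp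
  have cl: "v \<in> vcarrier V \<Longrightarrow> w \<in> vcarrier V \<Longrightarrow> v + w \<in> vcarrier V" "v \<in> vcarrier V \<Longrightarrow> vscale V c v \<in> vcarrier V" for v w c
    using carrier_add carrier_scale by auto
  have "linear_map V (regularization V) id" "linear_map (regularization V) V (inv_into (vcarrier V) id)"
    using inv cl by (auto simp: linear_map_def)
  moreover have "map_mat id x = x" "map_mat (inv_into (vcarrier V) id) x = x" if "x \<in> Mat V n" for x n
    using mm[OF that] inv by auto
  moreover from this have "map_mat id x \<in> mcone V n" "map_mat (inv_into (vcarrier V) id) x \<in> mcone V n"
    if "0 < n" "x \<in> mcone V n" for x n
    using that by (metis cone_Mat)+
  ultimately show ?thesis
    unfolding complete_order_isomorphism_def completely_bounded_def completely_positive_def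
    using regular_norm_upper regular_norm_lower inv vstar_carrier by (auto simp: bij_betw_def intro!: exI)
qed

end

section \<open>Completeness\<close>

definition single :: "nat \<Rightarrow> nat \<Rightarrow> nat \<Rightarrow> 'a::zero \<Rightarrow> 'a mat" where
  "single n i j v = mat n n (\<lambda>p. if p = (i, j) then v else 0)"

definition entry_mat :: "'a \<Rightarrow> 'a mat" where
  "entry_mat v = mat 1 1 (\<lambda>_. v)"

lemma entry_mat_simps [simp]:
  "dim_row (entry_mat v) = 1" "dim_col (entry_mat v) = 1" "entry_mat v $$ (0, 0) = v"
  by (simp_all add: entry_mat_def)

definition unit_col :: "nat \<Rightarrow> nat \<Rightarrow> complex mat" where
  "unit_col n i = mat n 1 (\<lambda>(k, _). if k = i then 1 else 0)"

lemma unit_col_carrier [simp]: "unit_col n i \<in> carrier_mat n 1"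
  by (simp add: unit_col_def)

lemma unit_col_dim [simp]: "dim_row (unit_col n i) = n" "dim_col (unit_col n i) = 1"
  by (simp_all add: unit_col_def)

lemma sq_bounded_unit_col: "i < n \<Longrightarrow> sq_bounded 1 (unit_col n i)"
proof -
  assume i: "i < n"
  have "(cmod (unit_col n i $$ (k, 0)))\<^sup>2 = (if k = i then 1 else 0)" if "k < n" for k
    using that by (simp add: unit_col_def)
  then have "hs_sqnorm (unit_col n i) = (\<Sum>k<n. if k = i then 1 else 0)"
    unfolding hs_sqnorm_def by simp
  then show ?thesis using sq_bounded_hs_sqnorm[of "unit_col n i"] i by simp
qed

context op_space begin

lemma Mat_single: "v \<in> vcarrier V \<Longrightarrow> single n i j v \<in> Mat V n"
  by (rule MatI) (auto simp: single_def carrier_zero)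

lemma Mat_entry_mat: "v \<in> vcarrier V \<Longrightarrow> entry_mat v \<in> Mat V 1"
  by (rule MatI) auto

lemma norm_single_le:
  assumes ij: "i < n" "j < n" and v: "v \<in> vcarrier V"
  shows "mnorm V (single n i j v) \<le> mnorm V (entry_mat v)"
proof -
  have "single n i j v = bimult V (unit_col n i) (entry_mat v) (mat_adjoint (unit_col n j))"
  proof (rule eq_matI)
    fix k l assume "k < dim_row (bimult V (unit_col n i) (entry_mat v) (mat_adjoint (unit_col n j)))"
      "l < dim_col (bimult V (unit_col n i) (entry_mat v) (mat_adjoint (unit_col n j)))"
    then have kl: "k < n" "l < n" by auto
    have "bimult V (unit_col n i) (entry_mat v) (mat_adjoint (unit_col n j)) $$ (k, l) = 
       vscale V ((if k = i then 1 else 0) * (if l = j then 1 else 0)) v"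
      using kl ij by (subst bimult_index[OF Mat_entry_mat[OF v]]) (auto simp: unit_col_def)
    then show "single n i j v $$ (k, l) = bimult V (unit_col n i) (entry_mat v) (mat_adjoint (unit_col n j)) $$ (k, l)"
      using kl by (simp add: single_def)
  qed (auto simp: single_def)
  moreover have "mnorm V (bimult V (unit_col n i) (entry_mat v) (mat_adjoint (unit_col n j))) \<le> sqrt 1 * mnorm V (entry_mat v) * sqrt 1"
    using ij v by (intro norm_bimult_le[of 1 n] Mat_entry_mat sq_bounded_unit_col sq_bounded_adjoint) auto
  ultimately show ?thesis by simp
qed

lemma norm_entry_le:
  assumes ij: "i < n" "j < n" and x: "x \<in> Mat V n"
  shows "mnorm V (entry_mat (x $$ (i, j))) \<le> mnorm V x"
proof -
  have "entry_mat (x $$ (i, j)) = bimult V (mat_adjoint (unit_col n i)) x (unit_col n j)"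
  proof (rule eq_matI)
    fix k l assume "k < dim_row (bimult V (mat_adjoint (unit_col n i)) x (unit_col n j))"
      "l < dim_col (bimult V (mat_adjoint (unit_col n i)) x (unit_col n j))"
    then have kl: "k = 0" "l = 0" by auto
    have "bimult V (mat_adjoint (unit_col n i)) x (unit_col n j) $$ (0, 0) = 
       (if i < n \<and> j < n then vscale V (1 * 1) (x $$ (i, j)) else 0)"
      by (intro bimult_select[OF x]) (auto simp: unit_col_def)
    then show "entry_mat (x $$ (i, j)) $$ (k, l) = bimult V (mat_adjoint (unit_col n i)) x (unit_col n j) $$ (k, l)"
      using kl ij by simp
  qed auto
  moreover have "mnorm V (bimult V (mat_adjoint (unit_col n i)) x (unit_col n j)) \<le> sqrt 1 * mnorm V x * sqrt 1"
    using ij x by (intro norm_bimult_le[of n 1] sq_bounded_unit_col sq_bounded_adjoint) auto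
  ultimately show ?thesis by simp
qed

lemma norm_le_sum_entries:
  assumes n: "0 < n" and x: "x \<in> Mat V n"
  shows "mnorm V x \<le> (\<Sum>p\<in>{..<n} \<times> {..<n}. mnorm V (entry_mat (x $$ p)))"
proof -
  \<comment> \<open>Induction on the set of entries that are kept, all others being replaced by
    zero.\<close>
  have "mnorm V (mat n n (\<lambda>p. if p \<in> S then x $$ p else 0)) \<le> (\<Sum>p\<in>S. mnorm V (entry_mat (x $$ p)))"
    if "finite S" "S \<subseteq> {..<n} \<times> {..<n}" for S
    using that
  proof (induction S)
    case empty
    have "mat n n (\<lambda>p. if p \<in> {} then x $$ p else 0) = 0\<^sub>m n n" by (intro eq_matI) auto
    then show ?case using norm_zero[OF n] by simp
  next
    case (insert q S)
    obtain i j where q: "q = (i, j)" "i < n" "j < n" using insert.prems by auto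
    have v: "x $$ (i, j) \<in> vcarrier V" using q x by (simp add: Mat_entry)
    have S: "mat n n (\<lambda>p. if p \<in> S then x $$ p else 0) \<in> Mat V n"
      using x by (intro MatI) (auto simp: Mat_entry carrier_zero)
    have "mat n n (\<lambda>p. if p \<in> insert q S then x $$ p else 0) = single n i j (x $$ (i, j)) + mat n n (\<lambda>p. if p \<in> S then x $$ p else 0)"
      using insert.hyps q by (intro eq_matI) (auto simp: single_def)
    then have "mnorm V (mat n n (\<lambda>p. if p \<in> insert q S then x $$ p else 0)) \<le> 
        mnorm V (entry_mat (x $$ q)) + (\<Sum>p\<in>S. mnorm V (entry_mat (x $$ p)))"
      using norm_triangle[OF n Mat_single[OF v, of n i j] S] norm_single_le[OF q(2,3) v] insert.IH insert.prems q by simp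
    then show ?case using insert.hyps by simp
  qed
  from this[of "{..<n} \<times> {..<n}"] have "mnorm V (mat n n (\<lambda>p. if p \<in> {..<n} \<times> {..<n} then x $$ p else 0)) \<le> (\<Sum>p\<in>{..<n} \<times> {..<n}. mnorm V (entry_mat (x $$ p)))"
    by simp
  moreover have "mat n n (\<lambda>p. if p \<in> {..<n} \<times> {..<n} then x $$ p else 0) = x"
    using x by (intro eq_matI) auto
  ultimately show ?thesis by simp
qed

text \<open>Completeness is given for the first matrix norm only. Each entry is bounded by the norm
  of the matrix, which is bounded by the sum of the norms of the entries, so entrywise limits are
  limits.\<close>

lemma complete_Mat:
  assumes c: "complete_norm V" and n: "0 < n" and Z: "\<And>k. Z k \<in> Mat V n"
    and cauchy: "\<And>e. 0 < e \<Longrightarrow> \<exists>N. \<forall>k\<ge>N. \<forall>l\<ge>N. mnorm V (Z k - Z l) < e"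
  shows "\<exists>z\<in>Mat V n. (\<lambda>k. mnorm V (Z k - z)) \<longlonglongrightarrow> 0"
proof -
  have one: "0 < (1::nat)" by simp
  interpret m1: Metric_space "Mat V 1" "mdist V 1" by (rule Metric_space_mdist[OF one])
  have diff: "entry_mat v - entry_mat w = (entry_mat (v - w) :: 'a mat)" for v w by (intro eq_matI) auto
  have "\<exists>v\<in>vcarrier V. (\<lambda>k. mnorm V (entry_mat (Z k $$ p - v))) \<longlonglongrightarrow> 0" if p: "p \<in> {..<n} \<times> {..<n}" for p
  proof -
    obtain i j where ij: "p = (i, j)" "i < n" "j < n" using p by auto
    have M: "entry_mat (Z k $$ p) \<in> Mat V 1" for k
      using Z[of k] ij by (intro Mat_entry_mat) (simp add: Mat_entry)
    have "m1.MCauchy (\<lambda>k. entry_mat (Z k $$ p))"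
      unfolding m1.MCauchy_def
    proof (intro conjI allI impI)
      show "range (\<lambda>k. entry_mat (Z k $$ p)) \<subseteq> Mat V 1" using M by auto
      fix e :: real assume "0 < e"
      then obtain N where N: "\<forall>k\<ge>N. \<forall>l\<ge>N. mnorm V (Z k - Z l) < e" using cauchy by blast
      have "mdist V 1 (entry_mat (Z k $$ p)) (entry_mat (Z l $$ p)) < e" if "N \<le> k" "N \<le> l" for k l
      proof -
        have "(Z k - Z l) $$ (i, j) = Z k $$ p - Z l $$ p" using Z[of k] Z[of l] ij by simp
        then have "mdist V 1 (entry_mat (Z k $$ p)) (entry_mat (Z l $$ p)) \<le> mnorm V (Z k - Z l)"
          using norm_entry_le[OF ij(2,3) Mat_minus[OF Z Z], of k l] M[of k] M[of l] by (simp only: mdist_def diff) simp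
        moreover have "mnorm V (Z k - Z l) < e" using N that by blast
        ultimately show ?thesis by linarith
      qed
      then show "\<exists>N. \<forall>k l. N \<le> k \<longrightarrow> N \<le> l \<longrightarrow> mdist V 1 (entry_mat (Z k $$ p)) (entry_mat (Z l $$ p)) < e"
        by (intro exI[of _ N] allI impI)
    qed
    then obtain y where y: "limitin m1.mtopology (\<lambda>k. entry_mat (Z k $$ p)) y sequentially"
      using c unfolding complete_norm_def m1.mcomplete_def by blast
    then have yM: "y \<in> Mat V 1" unfolding m1.limitin_metric by blast
    define w where "w = y $$ (0, 0)"
    have ye: "y = entry_mat w" using yM unfolding w_def by (intro eq_matI) auto
    have w: "w \<in> vcarrier V" using Mat_entry[OF yM] by (simp add: w_def)
    have "(\<lambda>k. mnorm V (entry_mat (Z k $$ p - w))) \<longlonglongrightarrow> 0"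
    proof (rule tendstoI)
      fix e :: real assume "0 < e"
      then have "\<forall>\<^sub>F k in sequentially. entry_mat (Z k $$ p) \<in> Mat V 1 \<and> mdist V 1 (entry_mat (Z k $$ p)) (entry_mat w) < e"
        using y unfolding m1.limitin_metric ye by blast
      then show "\<forall>\<^sub>F k in sequentially. dist (mnorm V (entry_mat (Z k $$ p - w))) 0 < e"
      proof eventually_elim
        case (elim k)
        have "mdist V 1 (entry_mat (Z k $$ p)) (entry_mat w) = mnorm V (entry_mat (Z k $$ p - w))"
          unfolding mdist_def diff using M[of k] Mat_entry_mat[OF w] by (simp only: if_True simp_thms)
        moreover have "0 \<le> mdist V 1 (entry_mat (Z k $$ p)) (entry_mat w)" by (rule m1.nonneg)
        ultimately show ?case using elim by (simp only: dist_real_def) linarith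
      qed
    qed
    then show ?thesis using w by blast
  qed
  then obtain v where v: "\<And>p. p \<in> {..<n} \<times> {..<n} \<Longrightarrow> v p \<in> vcarrier V \<and> (\<lambda>k. mnorm V (entry_mat (Z k $$ p - v p))) \<longlonglongrightarrow> 0"
    by metis
  define z where "z = mat n n v"
  have z: "z \<in> Mat V n" using v by (intro MatI) (auto simp: z_def)
  have le: "mnorm V (Z k - z) \<le> (\<Sum>p\<in>{..<n} \<times> {..<n}. mnorm V (entry_mat (Z k $$ p - v p)))" for k
  proof -
    have "(\<Sum>p\<in>{..<n} \<times> {..<n}. mnorm V (entry_mat ((Z k - z) $$ p))) = (\<Sum>p\<in>{..<n} \<times> {..<n}. mnorm V (entry_mat (Z k $$ p - v p)))"
      using Z[of k] by (intro sum.cong) (auto simp: z_def)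
    then show ?thesis using norm_le_sum_entries[OF n Mat_minus[OF Z z], of k] by simp
  qed
  have "(\<lambda>k. \<Sum>p\<in>{..<n} \<times> {..<n}. mnorm V (entry_mat (Z k $$ p - v p))) \<longlonglongrightarrow> (\<Sum>p\<in>{..<n} \<times> {..<n}. 0)"
    using v by (intro tendsto_sum) blast
  then have lim: "(\<lambda>k. \<Sum>p\<in>{..<n} \<times> {..<n}. mnorm V (entry_mat (Z k $$ p - v p))) \<longlonglongrightarrow> 0" by simp
  have "(\<lambda>k. mnorm V (Z k - z)) \<longlonglongrightarrow> 0"
    by (rule tendsto_sandwich[OF _ _ tendsto_const lim]) (intro always_eventually allI norm_nonneg[OF n Mat_minus[OF Z z]] le)+
  then show ?thesis using z by blast
qed

lemma norm_blk_le:
  assumes n: "0 < n" and z: "z \<in> Mat V (n + n)"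
  shows "mnorm V (blk n p q z) \<le> mnorm V z"
proof -
  have b: "sq_bounded 1 (inj1 n n)" "sq_bounded 1 (inj2 n n)"
    using sq_bounded_isometry[OF adj_inj_mult(1) inj_carrier(1)] sq_bounded_isometry[OF adj_inj_mult(4) inj_carrier(2)] by auto
  have "mnorm V (blk n p q z) \<le> sqrt 1 * mnorm V z * sqrt 1"
    unfolding blk_def using n z b by (intro norm_bimult_le[of "n + n" n]) (auto intro: sq_bounded_adjoint)
  then show ?thesis by simp
qed

end

context mo_op_space begin

text \<open>The residual is approximated again and again, halving its norm each time. The positive
  corrections form a series dominated by a geometric one, whose sum accounts for the factor 2; the
  limit is positive because the cone is closed.\<close>

lemma cone_corner_exact:
  assumes c: "complete_norm V" and n: "0 < n" and C: "0 \<le> C"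
    and approx: "\<And>x. x \<in> Mat V n \<Longrightarrow> \<exists>z\<in>mcone V (n + n). mnorm V z \<le> C * mnorm V x \<and> mnorm V (x - blk n True False z) \<le> mnorm V x / 2"
    and x: "x \<in> Mat V n"
  shows "\<exists>z\<in>mcone V (n + n). mnorm V z \<le> 2 * C * mnorm V x \<and> blk n True False z = x"
proof -
  have nn: "0 < n + n" using n by simp
  obtain g where g: "\<And>x. x \<in> Mat V n \<Longrightarrow> g x \<in> mcone V (n + n) \<and> mnorm V (g x) \<le> C * mnorm V x \<and> mnorm V (x - blk n True False (g x)) \<le> mnorm V x / 2"
    using approx by metis
  define xs where "xs = rec_nat x (\<lambda>_ y. y - blk n True False (g y))"
  have xs: "xs 0 = x" "xs (Suc k) = xs k - blk n True False (g (xs k))" for k by (simp_all add: xs_def)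
  define Z where "Z = rec_nat (0\<^sub>m (n + n) (n + n)) (\<lambda>k y. y + g (xs k))"
  have Z: "Z 0 = 0\<^sub>m (n + n) (n + n)" "Z (Suc k) = Z k + g (xs k)" for k by (simp_all add: Z_def)
  have gM: "g y \<in> Mat V (n + n)" if "y \<in> Mat V n" for y using g[OF that] cone_Mat[OF nn] by blast
  have xM: "xs k \<in> Mat V n" for k
    by (induction k) (auto simp: xs x intro!: Mat_minus Mat_blk gM)
  have xn: "mnorm V (xs k) \<le> (1/2) ^ k * mnorm V x" for k
  proof (induction k)
    case (Suc k)
    have "mnorm V (xs (Suc k)) \<le> mnorm V (xs k) / 2" using g[OF xM] by (simp add: xs)
    then show ?case using Suc by simp
  qed (simp add: xs)
  have Zc: "Z k \<in> mcone V (n + n)" for k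
    by (induction k) (use g[OF xM] nn in \<open>auto simp: Z intro!: cone_zero cone_add\<close>)
  have ZM: "Z k \<in> Mat V (n + n)" for k using cone_Mat[OF nn Zc] .
  have Zb: "blk n True False (Z k) = x - xs k" for k
  proof (induction k)
    case 0
    show ?case using x by (intro eq_matI) (auto simp: Z xs blk_index Mat_zero)
  next
    case (Suc k)
    have "blk n True False (Z (Suc k)) = (x - xs k) + blk n True False (g (xs k))"
      using Suc by (simp add: Z blk_add[OF ZM gM[OF xM]])
    also have "\<dots> = x - xs (Suc k)"
      using x xM[of k] by (intro eq_matI) (auto simp: xs)
    finally show ?case .
  qed
  have gn: "mnorm V (g (xs k)) \<le> C * mnorm V x * (1/2) ^ k" for k
  proof -
    have "mnorm V (g (xs k)) \<le> C * mnorm V (xs k)" using g[OF xM] by blast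
    also have "\<dots> \<le> C * ((1/2) ^ k * mnorm V x)" using xn C by (intro mult_left_mono) auto
    finally show ?thesis by (simp add: mult_ac)
  qed
  define D where "D = 2 * C * mnorm V x"
  have D: "0 \<le> D" using C norm_nonneg[OF n x] by (simp add: D_def)
  \<comment> \<open>The bound is the exact partial geometric sum, a form that closes the
    induction.\<close>
  have inc: "mnorm V (Z (k + m) - Z k) \<le> D * (1/2) ^ k * (1 - (1/2) ^ m)" for k m
  proof (induction m)
    case 0
    have "Z k - Z k = 0\<^sub>m (n + n) (n + n)" using ZM[of k] by (intro eq_matI) auto
    then show ?case using norm_zero[OF nn] by simp
  next
    case (Suc m)
    have "Z (k + Suc m) - Z k = (Z (k + m) - Z k) + g (xs (k + m))"
      using ZM[of "k + m"] ZM[of k] gM[OF xM[of "k + m"]] by (intro eq_matI) (auto simp: Z)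
    then have "mnorm V (Z (k + Suc m) - Z k) \<le> mnorm V (Z (k + m) - Z k) + mnorm V (g (xs (k + m)))"
      using norm_triangle[OF nn Mat_minus[OF ZM ZM] gM[OF xM]] by simp
    also have "\<dots> \<le> D * (1/2) ^ k * (1 - (1/2) ^ m) + C * mnorm V x * (1/2) ^ (k + m)"
      using Suc gn by (intro add_mono)
    also have "\<dots> = D * (1/2) ^ k * (1 - (1/2) ^ Suc m)"
      by (simp add: D_def power_add algebra_simps)
    finally show ?case .
  qed
  have inc': "mnorm V (Z (k + m) - Z k) \<le> D * (1/2) ^ k" for k m
    using inc[of k m] D by (smt (verit) mult_left_le mult_nonneg_nonneg zero_le_power half_gt_zero_iff)
  have D0: "(\<lambda>k. D * (1/2) ^ k) \<longlonglongrightarrow> 0"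
    by (intro tendsto_mult_right_zero LIMSEQ_power_zero) simp
  have "\<exists>z\<in>Mat V (n + n). (\<lambda>k. mnorm V (Z k - z)) \<longlonglongrightarrow> 0"
  proof (rule complete_Mat[OF c nn ZM])
    fix e :: real assume "0 < e"
    then have "\<forall>\<^sub>F k in sequentially. D * (1/2) ^ k < e" using order_tendstoD(2)[OF D0] by blast
    then obtain N where N: "\<And>k. N \<le> k \<Longrightarrow> D * (1/2) ^ k < e" unfolding eventually_sequentially by blast
    have "mnorm V (Z k - Z l) < e" if "N \<le> k" "N \<le> l" for k l
    proof (cases "l \<le> k")
      case True
      then show ?thesis using inc'[of l "k - l"] N[OF that(2)] by simp
    next
      case False
      then show ?thesis using inc'[of k "l - k"] N[OF that(1)] norm_minus_commute[OF nn ZM ZM, of k l] by simp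
    qed
    then show "\<exists>N. \<forall>k\<ge>N. \<forall>l\<ge>N. mnorm V (Z k - Z l) < e" by blast
  qed
  then obtain z where z: "z \<in> Mat V (n + n)" "(\<lambda>k. mnorm V (Z k - z)) \<longlonglongrightarrow> 0" by blast
  have zc: "z \<in> mcone V (n + n)" by (rule cone_closed[OF nn Zc z])
  have "mnorm V z \<le> D"
  proof (rule tendsto_lowerbound[of "\<lambda>k. D + mnorm V (Z k - z)"])
    show "(\<lambda>k. D + mnorm V (Z k - z)) \<longlonglongrightarrow> D" using tendsto_add[OF tendsto_const z(2), of D] by simp
    have "mnorm V z \<le> D + mnorm V (Z k - z)" for k
    proof -
      have "Z k - Z 0 = Z k" using ZM[of k] by (intro eq_matI) (auto simp: Z)
      then have "mnorm V (Z k) \<le> D" using inc'[of 0 k] by simp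
      then show ?thesis
        using norm_triangle_minus[OF nn z(1) ZM[of k]] norm_minus_commute[OF nn z(1) ZM[of k]] by simp
    qed
    then show "\<forall>\<^sub>F k in sequentially. mnorm V z \<le> D + mnorm V (Z k - z)" by simp
  qed simp
  moreover have "blk n True False z = x"
  proof -
    have bM: "blk n True False z \<in> Mat V n" by (rule Mat_blk[OF z(1)])
    have "mnorm V (x - blk n True False z) \<le> 0"
    proof (rule tendsto_lowerbound[of "\<lambda>k. mnorm V (Z k - z) + (1/2) ^ k * mnorm V x"])
      have "(\<lambda>k. mnorm V (Z k - z) + (1/2) ^ k * mnorm V x) \<longlonglongrightarrow> 0 + 0 * mnorm V x"
        by (intro tendsto_intros z(2) LIMSEQ_power_zero) simp
      then show "(\<lambda>k. mnorm V (Z k - z) + (1/2) ^ k * mnorm V x) \<longlonglongrightarrow> 0" by simp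
      have "mnorm V (x - blk n True False z) \<le> mnorm V (Z k - z) + (1/2) ^ k * mnorm V x" for k
      proof -
        \<comment> \<open>The error splits into the distance to the limit and the current residual,
          which both tend to zero.\<close>
        have "x - blk n True False z = blk n True False (Z k - z) + xs k"
        proof (rule eq_matI)
          fix i j assume "i < dim_row (blk n True False (Z k - z) + xs k)" "j < dim_col (blk n True False (Z k - z) + xs k)"
          then have ij: "i < n" "j < n" using xM[of k] by auto
          have "blk n True False (Z k) $$ (i, j) = (x - xs k) $$ (i, j)" using Zb by simp
          then have "Z k $$ (i, n + j) = x $$ (i, j) - xs k $$ (i, j)" using ij xM[of k] ZM[of k] by (simp add: blk_index)
          then show "(x - blk n True False z) $$ (i, j) = (blk n True False (Z k - z) + xs k) $$ (i, j)"
            using ij xM[of k] ZM[of k] z(1) by (simp add: blk_index Mat_minus)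
        qed (use x xM[of k] in auto)
        then have "mnorm V (x - blk n True False z) \<le> mnorm V (blk n True False (Z k - z)) + mnorm V (xs k)"
          using norm_triangle[OF n Mat_blk[OF Mat_minus[OF ZM z(1)]] xM] by simp
        then show ?thesis using norm_blk_le[OF n Mat_minus[OF ZM z(1)], of True False k] xn[of k] by simp
      qed
      then show "\<forall>\<^sub>F k in sequentially. mnorm V (x - blk n True False z) \<le> mnorm V (Z k - z) + (1/2) ^ k * mnorm V x" by simp
    qed simp
    then have "mnorm V (x - blk n True False z) = 0" using norm_nonneg[OF n Mat_minus[OF x bM]] by simp
    then have 0: "x - blk n True False z = 0\<^sub>m n n" using norm_zero_iff[OF n Mat_minus[OF x bM]] by simp
    show ?thesis
    proof (rule eq_matI)
      fix i j assume "i < dim_row x" "j < dim_col x"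
      then have ij: "i < n" "j < n" using x by auto
      then have "(x - blk n True False z) $$ (i, j) = 0" unfolding 0 by simp
      then show "blk n True False z $$ (i, j) = x $$ (i, j)" using ij x by simp
    qed (use x in auto)
  qed
  ultimately show ?thesis using zc by (auto simp: D_def)
qed

end

section \<open>The pairing with the dual\<close>

text \<open>The scalar pairing of matrices over the dual with matrices over the space, entry against
  entry without transposition. It reduces cb-norms and complete positivity to statements about
  scalar functionals.\<close>

definition pair :: "('a \<Rightarrow> complex) mat \<Rightarrow> 'a mat \<Rightarrow> complex" where
  "pair F x = (\<Sum>i<dim_row F. \<Sum>j<dim_col F. (F $$ (i, j)) (x $$ (i, j)))"

text \<open>Reshapes a vector with the same index convention as \<open>amplification\<close>; the
  Euclidean norm becomes the Hilbert-Schmidt norm.\<close>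

definition col_mat :: "nat \<Rightarrow> nat \<Rightarrow> complex vec \<Rightarrow> complex mat" where
  "col_mat m n \<eta> = mat m n (\<lambda>(l, j). \<eta> $ (l * n + j))"

lemma col_mat_carrier [simp]: "col_mat m n \<eta> \<in> carrier_mat m n"
  by (simp add: col_mat_def)

lemma block_index_less: "k < m \<Longrightarrow> i < n \<Longrightarrow> k * n + i < m * (n::nat)"
proof -
  assume "k < m" "i < n"
  then have "k * n + i < Suc k * n" by simp
  also have "\<dots> \<le> m * n" using \<open>k < m\<close> by (intro mult_right_mono) auto
  finally show ?thesis .
qed

lemma sum_block: "(\<Sum>i<(m::nat) * n. g i) = (\<Sum>k<m. \<Sum>j<n. g (k * n + j) :: 'b::comm_monoid_add)"
proof (induction m)
  case (Suc m)
  have "(\<Sum>i<Suc m * n. g i) = (\<Sum>i<m * n + n. g i)" by (simp add: add.commute)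
  also have "\<dots> = (\<Sum>i<m * n. g i) + (\<Sum>j<n. g (m * n + j))" by (rule sum_lessThan_add)
  finally show ?case using Suc by simp
qed simp

lemma hs_sqnorm_col_mat: "\<eta> \<in> carrier_vec (m * n) \<Longrightarrow> hs_sqnorm (col_mat m n \<eta>) = sqnorm \<eta>"
  by (simp add: hs_sqnorm_def sqnorm_def col_mat_def sum_block)

lemma col_mat_surj:
  assumes "\<beta> \<in> carrier_mat m n"
  shows "\<exists>\<eta>\<in>carrier_vec (m * n). col_mat m n \<eta> = \<beta>"
proof (rule bexI)
  let ?e = "vec (m * n) (\<lambda>I. \<beta> $$ (I div n, I mod n))"
  show "?e \<in> carrier_vec (m * n)" by simp
  show "col_mat m n ?e = \<beta>"
    using assms by (intro eq_matI) (auto simp: col_mat_def block_index_less)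
qed

text \<open>The set \<open>S\<close> of admissible entries allows one statement for matrices over
  the space and for scalar matrices.\<close>

lemma additive_mat_sum:
  fixes f :: "'a::ab_group_add mat \<Rightarrow> 'b::ab_group_add"
  assumes add: "\<And>x y. x \<in> carrier_mat n n \<Longrightarrow> y \<in> carrier_mat n n \<Longrightarrow> \<forall>i<n. \<forall>j<n. x $$ (i, j) \<in> S \<Longrightarrow> \<forall>i<n. \<forall>j<n. y $$ (i, j) \<in> S \<Longrightarrow> f (x + y) = f x + f y"
    and zero: "0 \<in> S" and x: "x \<in> carrier_mat n n" "\<forall>i<n. \<forall>j<n. x $$ (i, j) \<in> S"
  shows "f x = (\<Sum>i<n. \<Sum>j<n. f (single n i j (x $$ (i, j))))"
proof -
  have f0: "f (0\<^sub>m n n) = 0"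
    using add[of "0\<^sub>m n n" "0\<^sub>m n n"] zero by simp
  have "f (mat n n (\<lambda>p. if p \<in> T then x $$ p else 0)) = (\<Sum>p\<in>T. f (single n (fst p) (snd p) (x $$ p)))"
    if "finite T" "T \<subseteq> {..<n} \<times> {..<n}" for T
    using that
  proof (induction T)
    case empty
    have "mat n n (\<lambda>p. if p \<in> {} then x $$ p else 0) = 0\<^sub>m n n" by (intro eq_matI) auto
    then show ?case using f0 by simp
  next
    case (insert q T)
    obtain i j where q: "q = (i, j)" "i < n" "j < n" using insert.prems by auto
    have "mat n n (\<lambda>p. if p \<in> insert q T then x $$ p else 0) = single n i j (x $$ (i, j)) + mat n n (\<lambda>p. if p \<in> T then x $$ p else 0)"
      using insert.hyps q by (intro eq_matI) (auto simp: single_def)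
    also have "f \<dots> = f (single n i j (x $$ (i, j))) + f (mat n n (\<lambda>p. if p \<in> T then x $$ p else 0))"
      using x q zero by (intro add) (auto simp: single_def)
    finally show ?case using insert q by simp
  qed
  from this[of "{..<n} \<times> {..<n}"] have "f (mat n n (\<lambda>p. if p \<in> {..<n} \<times> {..<n} then x $$ p else 0)) = (\<Sum>p\<in>{..<n} \<times> {..<n}. f (single n (fst p) (snd p) (x $$ p)))"
    by simp
  moreover have "mat n n (\<lambda>p. if p \<in> {..<n} \<times> {..<n} then x $$ p else 0) = x"
    using x by (intro eq_matI) auto
  ultimately show ?thesis by (simp add: sum.cartesian_product case_prod_unfold)
qed

lemma dual_simps [simp]:
  "vcarrier (dual V) = bounded_functionals V" "mnorm (dual V) = cb_norm V"
  "vscale (dual V) c f v = c * f v"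
  "vstar (dual V) f v = (if v \<in> vcarrier V then cnj (f (vstar V v)) else 0)"
  by (simp_all add: dual_def)

lemma bounded_functionalD:
  assumes "f \<in> bounded_functionals V"
  shows "v \<in> vcarrier V \<Longrightarrow> w \<in> vcarrier V \<Longrightarrow> f (v + w) = f v + f w"
    and "v \<in> vcarrier V \<Longrightarrow> f (vscale V c v) = c * f v"
    and "v \<notin> vcarrier V \<Longrightarrow> f v = 0"
  using assms by (auto simp: bounded_functionals_def)

context op_space begin

lemma bounded_functional_zero: "f \<in> bounded_functionals V \<Longrightarrow> f 0 = 0"
  using bounded_functionalD(1)[of f V 0 0] carrier_zero by simp

lemma bounded_functional_sum: "f \<in> bounded_functionals V \<Longrightarrow> (\<And>i. i \<in> I \<Longrightarrow> g i \<in> vcarrier V) \<Longrightarrow> f (\<Sum>i\<in>I. g i) = (\<Sum>i\<in>I. f (g i))"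
  by (induction I rule: infinite_finite_induct) (auto simp: bounded_functional_zero bounded_functionalD carrier_sum)

lemma dual_entry: "F \<in> Mat (dual V) n \<Longrightarrow> i < n \<Longrightarrow> j < n \<Longrightarrow> F $$ (i, j) \<in> bounded_functionals V"
  using Mat_entry[of F "dual V" n i j] by simp

lemma pair_add_right:
  assumes "F \<in> Mat (dual V) n" "x \<in> Mat V n" "y \<in> Mat V n"
  shows "pair F (x + y) = pair F x + pair F y"
  using assms by (simp add: pair_def bounded_functionalD(1)[OF dual_entry] Mat_entry sum.distrib)

lemma pair_mscale_right:
  assumes "F \<in> Mat (dual V) n" "x \<in> Mat V n"
  shows "pair F (mscale V c x) = c * pair F x"
  using assms by (simp add: pair_def bounded_functionalD(2)[OF dual_entry] mscale_index Mat_entry sum_distrib_left)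

lemma pair_add_left:
  assumes "F \<in> Mat (dual V) n" "G \<in> Mat (dual V) n"
  shows "pair (F + G) x = pair F x + pair G x"
  using assms by (simp add: pair_def sum.distrib)

lemma pair_mscale_left:
  assumes "F \<in> Mat (dual V) n"
  shows "pair (mscale (dual V) c F) x = c * pair F x"
  using assms by (simp add: pair_def mscale_index sum_distrib_left)

lemma pair_mstar:
  assumes "F \<in> Mat (dual V) n" "x \<in> Mat V n"
  shows "pair (mstar (dual V) F) x = cnj (pair F (mstar V x))"
proof -
  have "pair (mstar (dual V) F) x = (\<Sum>i<n. \<Sum>j<n. cnj ((F $$ (j, i)) (vstar V (x $$ (i, j)))))"
    using assms by (simp add: pair_def mstar_index Mat_entry)
  also have "\<dots> = (\<Sum>j<n. \<Sum>i<n. cnj ((F $$ (j, i)) (vstar V (x $$ (i, j)))))" by (rule sum.swap)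
  also have "\<dots> = cnj (pair F (mstar V x))" using assms by (simp add: pair_def mstar_index)
  finally show ?thesis .
qed

lemma pair_bimult:
  assumes F: "F \<in> Mat (dual V) n" and x: "x \<in> Mat V m" and c: "\<alpha> \<in> carrier_mat n m" "\<beta> \<in> carrier_mat m n"
  shows "pair F (bimult V \<alpha> x \<beta>) = (\<Sum>i<n. \<Sum>j<n. \<Sum>k<m. \<Sum>l<m. \<alpha> $$ (i, k) * \<beta> $$ (l, j) * (F $$ (i, j)) (x $$ (k, l)))"
proof -
  have "(F $$ (i, j)) (bimult V \<alpha> x \<beta> $$ (i, j)) = (\<Sum>k<m. \<Sum>l<m. \<alpha> $$ (i, k) * \<beta> $$ (l, j) * (F $$ (i, j)) (x $$ (k, l)))"
    if ij: "i < n" "j < n" for i j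
  proof -
    note f = dual_entry[OF F ij]
    have "bimult V \<alpha> x \<beta> $$ (i, j) = (\<Sum>k<m. \<Sum>l<m. vscale V (\<alpha> $$ (i, k) * \<beta> $$ (l, j)) (x $$ (k, l)))"
      using c ij by (intro bimult_index[OF x]) auto
    moreover have "(F $$ (i, j)) (\<Sum>k<m. \<Sum>l<m. vscale V (\<alpha> $$ (i, k) * \<beta> $$ (l, j)) (x $$ (k, l))) = 
      (\<Sum>k<m. (F $$ (i, j)) (\<Sum>l<m. vscale V (\<alpha> $$ (i, k) * \<beta> $$ (l, j)) (x $$ (k, l))))"
      using x by (intro bounded_functional_sum[OF f] carrier_sum carrier_scale) (auto intro: Mat_entry)
    moreover have "(F $$ (i, j)) (\<Sum>l<m. vscale V (\<alpha> $$ (i, k) * \<beta> $$ (l, j)) (x $$ (k, l))) = 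
      (\<Sum>l<m. (F $$ (i, j)) (vscale V (\<alpha> $$ (i, k) * \<beta> $$ (l, j)) (x $$ (k, l))))" if "k < m" for k
      using x that by (intro bounded_functional_sum[OF f] carrier_scale) (auto intro: Mat_entry)
    ultimately show ?thesis using x by (simp add: bounded_functionalD(2)[OF f] Mat_entry)
  qed
  then show ?thesis using F c by (simp add: pair_def)
qed

lemma amplification_carrier:
  assumes F: "F \<in> Mat (dual V) n" and x: "x \<in> Mat V m"
  shows "amplification F x \<in> carrier_mat (m * n) (m * n)"
  using F x by (simp add: amplification_def Let_def)

text \<open>Bridge between the two descriptions of the dual: matrix coefficients of the
  amplification are values of the pairing at factorizations through \<open>x\<close>, with the two
  vectors reshaped to the factors.\<close>

lemma amplification_cscalar:
  assumes F: "F \<in> Mat (dual V) n" and x: "x \<in> Mat V m" and v: "\<xi> \<in> carrier_vec (m * n)" "\<eta> \<in> carrier_vec (m * n)"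
  shows "(amplification F x *\<^sub>v \<eta>) \<bullet>c \<xi> = pair F (bimult V (mat_adjoint (col_mat m n \<xi>)) x (col_mat m n \<eta>))"
proof -
  let ?A = "amplification F x"
  have A: "?A \<in> carrier_mat (m * n) (m * n)" by (rule amplification_carrier[OF F x])
  have ent: "?A $$ (k * n + i, l * n + j) = (F $$ (i, j)) (x $$ (k, l))" if "k < m" "l < m" "i < n" "j < n" for k l i j
    using that F x block_index_less[OF that(1,3)] block_index_less[OF that(2,4)]
    by (simp add: amplification_def Let_def induced_map_def)
  have "(?A *\<^sub>v \<eta>) \<bullet>c \<xi> = (\<Sum>I<m * n. (?A *\<^sub>v \<eta>) $ I * cnj (\<xi> $ I))"
    using A v by (intro cscalar_prod_sum) auto
  also have "\<dots> = (\<Sum>I<m * n. (\<Sum>J<m * n. ?A $$ (I, J) * \<eta> $ J) * cnj (\<xi> $ I))"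
    by (intro sum.cong refl) (simp add: mult_mat_vec_index[OF A v(2)] del: index_mult_mat_vec)
  also have "\<dots> = (\<Sum>k<m. \<Sum>i<n. \<Sum>l<m. \<Sum>j<n. cnj (\<xi> $ (k * n + i)) * \<eta> $ (l * n + j) * (F $$ (i, j)) (x $$ (k, l)))"
    unfolding sum_block by (intro sum.cong refl) (simp add: ent sum_distrib_left sum_distrib_right mult_ac)
  also have "\<dots> = (\<Sum>i<n. \<Sum>k<m. \<Sum>l<m. \<Sum>j<n. cnj (\<xi> $ (k * n + i)) * \<eta> $ (l * n + j) * (F $$ (i, j)) (x $$ (k, l)))"
    by (rule sum.swap)
  also have "\<dots> = (\<Sum>i<n. \<Sum>k<m. \<Sum>j<n. \<Sum>l<m. cnj (\<xi> $ (k * n + i)) * \<eta> $ (l * n + j) * (F $$ (i, j)) (x $$ (k, l)))"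
    by (intro sum.cong refl sum.swap)
  also have "\<dots> = (\<Sum>i<n. \<Sum>j<n. \<Sum>k<m. \<Sum>l<m. cnj (\<xi> $ (k * n + i)) * \<eta> $ (l * n + j) * (F $$ (i, j)) (x $$ (k, l)))"
    by (intro sum.cong refl sum.swap)
  also have "\<dots> = pair F (bimult V (mat_adjoint (col_mat m n \<xi>)) x (col_mat m n \<eta>))"
    by (subst pair_bimult[OF F x]) (auto simp: col_mat_def intro!: sum.cong)
  finally show ?thesis .
qed

text \<open>The hypothesis has an arithmetic mean where the operator norm wants a product. Testing
  it with \<open>\<xi> = A \<eta>\<close> after a suitable rescaling of the factors recovers the
  product.\<close>

lemma op_norm_amplification_le:
  assumes F: "F \<in> Mat (dual V) n" and x: "x \<in> Mat V m" and c: "0 < c"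
    and le: "\<And>\<alpha> \<beta>. \<alpha> \<in> carrier_mat n m \<Longrightarrow> \<beta> \<in> carrier_mat m n \<Longrightarrow> cmod (pair F (bimult V \<alpha> x \<beta>)) \<le> c * (hs_sqnorm \<alpha> + hs_sqnorm \<beta>) / 2"
  shows "op_norm (amplification F x) \<le> c"
proof -
  let ?A = "amplification F x"
  have A: "?A \<in> carrier_mat (m * n) (m * n)" by (rule amplification_carrier[OF F x])
  have "sq_bounded (c\<^sup>2) ?A"
    unfolding sq_bounded_def
  proof
    fix \<eta> :: "complex vec" assume "\<eta> \<in> carrier_vec (dim_col ?A)"
    then have \<eta>: "\<eta> \<in> carrier_vec (m * n)" using A by simp
    define t where "t = sqnorm (?A *\<^sub>v \<eta>)"
    \<comment> \<open>With this scaling the hypothesis reads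
      \<open>t \<le> (t + c\<^sup>2 * sqnorm \<eta>) / 2\<close>, in which \<open>t\<close> can be
      absorbed on the left.\<close>
    define s where "s = complex_of_real (sqrt c)"
    have s: "(cmod s)\<^sup>2 = c" "s \<noteq> 0" using c by (simp_all add: s_def)
    have s': "(cmod (1 / s))\<^sup>2 = 1 / c" using s by (simp add: norm_divide power_divide)
    have A\<eta>: "?A *\<^sub>v \<eta> \<in> carrier_vec (m * n)" using A by (intro carrier_vecI) simp
    let ?a = "mat_adjoint (col_mat m n (?A *\<^sub>v \<eta>))" and ?b = "col_mat m n \<eta>"
    have ab: "?a \<in> carrier_mat n m" "?b \<in> carrier_mat m n" by auto
    have "complex_of_real t = pair F (bimult V ?a x ?b)"
      using amplification_cscalar[OF F x A\<eta> \<eta>] by (simp add: t_def cscalar_prod_self)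
    also have "bimult V ?a x ?b = bimult V ((1 / s) \<cdot>\<^sub>m ?a) x (s \<cdot>\<^sub>m ?b)"
      using s by (simp add: bimult_smult_left[OF x ab(1)] bimult_smult_right[OF x ab(2)])
    finally have "cmod (complex_of_real t) \<le> c * (hs_sqnorm ((1 / s) \<cdot>\<^sub>m ?a) + hs_sqnorm (s \<cdot>\<^sub>m ?b)) / 2"
      using le[of "(1 / s) \<cdot>\<^sub>m ?a" "s \<cdot>\<^sub>m ?b"] ab by simp
    also have "\<dots> = c * (t / c + c * sqnorm \<eta>) / 2"
      unfolding hs_sqnorm_smult s s' hs_sqnorm_adjoint hs_sqnorm_col_mat[OF A\<eta>] hs_sqnorm_col_mat[OF \<eta>] t_def by simp
    also have "\<dots> = (t + c\<^sup>2 * sqnorm \<eta>) / 2" using c by (simp add: field_simps power2_eq_square)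
    finally show "sqnorm (?A *\<^sub>v \<eta>) \<le> c\<^sup>2 * sqnorm \<eta>" by (simp add: t_def)
  qed
  then show ?thesis using op_norm_le[of "c\<^sup>2" ?A] c by simp
qed

text \<open>Converse of the preceding estimate: Cauchy-Schwarz gives the product of the
  Hilbert-Schmidt norms, which is at most the mean of their squares.\<close>

lemma cmod_pair_le:
  assumes F: "F \<in> Mat (dual V) n" and x: "x \<in> Mat V m" and c: "\<alpha> \<in> carrier_mat n m" "\<beta> \<in> carrier_mat m n"
  shows "cmod (pair F (bimult V \<alpha> x \<beta>)) \<le> op_norm (amplification F x) * (hs_sqnorm \<alpha> + hs_sqnorm \<beta>) / 2"
proof -
  let ?A = "amplification F x"
  have A: "?A \<in> carrier_mat (m * n) (m * n)" by (rule amplification_carrier[OF F x])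
  obtain \<xi> \<eta> where v: "\<xi> \<in> carrier_vec (m * n)" "\<eta> \<in> carrier_vec (m * n)" "col_mat m n \<xi> = mat_adjoint \<alpha>" "col_mat m n \<eta> = \<beta>"
    using col_mat_surj[OF adjoint_carrier[OF c(1)]] col_mat_surj[OF c(2)] by blast
  have hs: "hs_sqnorm \<alpha> = sqnorm \<xi>" "hs_sqnorm \<beta> = sqnorm \<eta>"
    using hs_sqnorm_col_mat[OF v(1)] hs_sqnorm_col_mat[OF v(2)] v by simp_all
  let ?o = "op_norm ?A"
  have "pair F (bimult V \<alpha> x \<beta>) = (?A *\<^sub>v \<eta>) \<bullet>c \<xi>"
    using amplification_cscalar[OF F x v(1,2)] v by simp
  then have "(cmod (pair F (bimult V \<alpha> x \<beta>)))\<^sup>2 \<le> sqnorm (?A *\<^sub>v \<eta>) * sqnorm \<xi>"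
    using A v by (simp only:) (intro cscalar_prod_le[where n="m * n"]; simp)
  also have "\<dots> \<le> (?o\<^sup>2 * sqnorm \<eta>) * sqnorm \<xi>"
    by (intro mult_right_mono sq_boundedD[OF sq_bounded_op_norm A v(2)]) simp
  also have "\<dots> \<le> (?o * ((sqnorm \<xi> + sqnorm \<eta>) / 2))\<^sup>2"
  proof -
    have "sqnorm \<eta> * sqnorm \<xi> \<le> ((sqnorm \<xi> + sqnorm \<eta>) / 2)\<^sup>2"
      using zero_le_power2[of "sqnorm \<xi> - sqnorm \<eta>"] by (simp add: power2_eq_square algebra_simps)
    then show ?thesis by (simp only: power_mult_distrib mult.assoc) (intro mult_left_mono; simp)
  qed
  finally have "cmod (pair F (bimult V \<alpha> x \<beta>)) \<le> ?o * ((sqnorm \<xi> + sqnorm \<eta>) / 2)"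
    by (rule power2_le_imp_le) (intro mult_nonneg_nonneg op_norm_nonneg divide_nonneg_nonneg add_nonneg_nonneg; simp)
  then show ?thesis by (simp add: hs)
qed

text \<open>The second claim is stated under the same estimate because it needs the set in
  \<open>cb_norm\<close> to be bounded above, and any constant \<open>c\<close> achieves
  this.\<close>

lemma cb_norm_le:
  assumes F: "F \<in> Mat (dual V) n" and c: "0 < c"
    and le: "\<And>m x \<alpha> \<beta>. 0 < m \<Longrightarrow> x \<in> Mat V m \<Longrightarrow> mnorm V x \<le> 1 \<Longrightarrow> \<alpha> \<in> carrier_mat n m \<Longrightarrow> \<beta> \<in> carrier_mat m n \<Longrightarrow>
      cmod (pair F (bimult V \<alpha> x \<beta>)) \<le> c * (hs_sqnorm \<alpha> + hs_sqnorm \<beta>) / 2"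
  shows "cb_norm V F \<le> c"
    and "0 < m \<Longrightarrow> x \<in> Mat V m \<Longrightarrow> mnorm V x \<le> 1 \<Longrightarrow> op_norm (amplification F x) \<le> cb_norm V F"
proof -
  have b: "op_norm (amplification F x) \<le> c" if "0 < m" "x \<in> Mat V m" "mnorm V x \<le> 1" for m x
    using op_norm_amplification_le[OF F that(2) c le[OF that]] by blast
  show "cb_norm V F \<le> c" unfolding cb_norm_def
  proof (rule cSup_least)
    have "0 < (1::nat)" "0\<^sub>m 1 1 \<in> Mat V 1" "mnorm V (0\<^sub>m 1 1) \<le> 1"
      using Mat_zero[of 1] norm_zero[of 1] by simp_all
    then show "{op_norm (amplification F x) |m x. 0 < m \<and> x \<in> Mat V m \<and> mnorm V x \<le> 1} \<noteq> {}"
      by blast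
  qed (use b in blast)
  show "op_norm (amplification F x) \<le> cb_norm V F" if "0 < m" "x \<in> Mat V m" "mnorm V x \<le> 1"
    unfolding cb_norm_def
  proof (rule cSup_upper)
    show "bdd_above {op_norm (amplification F x) |m x. 0 < m \<and> x \<in> Mat V m \<and> mnorm V x \<le> 1}"
      using b by (intro bdd_aboveI[of _ c]) blast
  qed (use that in blast)
qed

text \<open>A real-linear \<open>l\<close> is the real part of the complex-linear
  \<open>l x - \<i> l (\<i> x)\<close>, and the entries of \<open>F\<close> are the restrictions of
  that functional to single matrix positions.\<close>

lemma functional_pair:
  assumes n: "0 < n"
    and add: "\<And>x y. x \<in> Mat V n \<Longrightarrow> y \<in> Mat V n \<Longrightarrow> l (x + y) = l x + l y"
    and scale: "\<And>t x. x \<in> Mat V n \<Longrightarrow> l (mscale V (complex_of_real t) x) = t * l x"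
    and bound: "\<And>x. x \<in> Mat V n \<Longrightarrow> \<bar>l x\<bar> \<le> K * mnorm V x"
  shows "\<exists>F\<in>Mat (dual V) n. \<forall>x\<in>Mat V n. Re (pair F x) = l x"
proof -
  define f where "f x = Complex (l x) (- l (mscale V \<i> x))" for x
  have fadd: "f (x + y) = f x + f y" if "x \<in> Mat V n" "y \<in> Mat V n" for x y
    using that by (simp add: f_def mscale_add[where n=n] add Mat_mscale complex_eq_iff)
  have freal: "f (mscale V (complex_of_real t) x) = t * f x" if x: "x \<in> Mat V n" for t x
  proof -
    have "mscale V \<i> (mscale V (complex_of_real t) x) = mscale V (complex_of_real t) (mscale V \<i> x)"
      by (simp add: mult.commute)
    then show ?thesis using scale[OF x] scale[OF Mat_mscale[OF x]] by (simp add: f_def complex_eq_iff)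
  qed
  have fi: "f (mscale V \<i> x) = \<i> * f x" if x: "x \<in> Mat V n" for x
  proof -
    have "mscale V \<i> (mscale V \<i> x) = mscale V (complex_of_real (-1)) x" by simp
    then have "l (mscale V \<i> (mscale V \<i> x)) = - l x" using scale[OF x, of "-1"] by simp
    then show ?thesis by (simp add: f_def complex_eq_iff)
  qed
  have fscale: "f (mscale V c x) = c * f x" if x: "x \<in> Mat V n" for c x
  proof -
    have "mscale V c x = mscale V (complex_of_real (Re c) + \<i> * complex_of_real (Im c)) x" by (simp add: complex_eq[symmetric])
    also have "\<dots> = mscale V (complex_of_real (Re c)) x + mscale V \<i> (mscale V (complex_of_real (Im c)) x)"
      using x by (simp add: mscale_add_left)
    finally have "f (mscale V c x) = Re c * f x + \<i> * (Im c * f x)"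
      using x by (simp only: fadd freal fi Mat_mscale)
    also have "\<dots> = c * f x" by (subst (2) complex_eq) (simp add: algebra_simps)
    finally show ?thesis .
  qed
  define F where "F = mat n n (\<lambda>(i, j) v. if v \<in> vcarrier V then f (single n i j v) else 0)"
  have K: "0 \<le> K * mnorm V x" if "x \<in> Mat V n" for x using bound[OF that] by linarith
  have fb: "cmod (f x) \<le> 2 * \<bar>K\<bar> * mnorm V x" if x: "x \<in> Mat V n" for x
  proof -
    have "cmod (f x) \<le> \<bar>l x\<bar> + \<bar>l (mscale V \<i> x)\<bar>" using cmod_le[of "f x"] by (simp add: f_def)
    also have "\<dots> \<le> K * mnorm V x + K * mnorm V x"
      using bound[OF x] bound[OF Mat_mscale[OF x, of \<i>]] norm_mscale[OF n x, of \<i>] by simp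
    also have "\<dots> \<le> 2 * \<bar>K\<bar> * mnorm V x"
      using mult_right_mono[OF abs_ge_self norm_nonneg[OF n x], of K] by simp
    finally show ?thesis .
  qed
  have ent: "F $$ (i, j) = (\<lambda>v. if v \<in> vcarrier V then f (single n i j v) else 0)" if "i < n" "j < n" for i j
    using that by (simp add: F_def)
  have FM: "F \<in> Mat (dual V) n"
  proof (rule MatI)
    show "F \<in> carrier_mat n n" by (simp add: F_def)
    fix i j assume ij: "i < n" "j < n"
    have s: "single n i j (v + w) = single n i j v + single n i j w" "single n i j (vscale V c v) = mscale V c (single n i j v)" for v w c
      by (auto intro!: eq_matI simp: single_def mscale_index)
    have "cmod (f (single n i j v)) \<le> 2 * \<bar>K\<bar> * mnorm V (mat 1 1 (\<lambda>_. v))" if "v \<in> vcarrier V" for v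
      using fb[OF Mat_single[OF that]] mult_left_mono[OF norm_single_le[OF ij that], of "2 * \<bar>K\<bar>"]
      unfolding entry_mat_def by (meson order_trans abs_ge_zero mult_nonneg_nonneg zero_le_numeral)
    then show "F $$ (i, j) \<in> vcarrier (dual V)"
      unfolding dual_simps bounded_functionals_def ent[OF ij]
      using s carrier_add carrier_scale fadd fscale Mat_single by (auto intro!: exI[of _ "2 * \<bar>K\<bar>"])
  qed
  have "Re (pair F x) = l x" if x: "x \<in> Mat V n" for x
  proof -
    have "f x = (\<Sum>i<n. \<Sum>j<n. f (single n i j (x $$ (i, j))))"
    proof (rule additive_mat_sum[where S="vcarrier V"])
      show "f (x + y) = f x + f y" if "x \<in> carrier_mat n n" "y \<in> carrier_mat n n"
        "\<forall>i<n. \<forall>j<n. x $$ (i, j) \<in> vcarrier V" "\<forall>i<n. \<forall>j<n. y $$ (i, j) \<in> vcarrier V" for x y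
        using that by (intro fadd MatI) auto
    qed (use x in \<open>auto simp: carrier_zero Mat_entry dest: Mat_carrier\<close>)
    also have "\<dots> = pair F x" using FM x by (simp add: pair_def ent Mat_entry)
    finally show ?thesis by (metis f_def complex.sel(1))
  qed
  then show ?thesis using FM by blast
qed

end

section \<open>Decomposition of positive elements\<close>

lemma hs_sqnorm_one_smult: "hs_sqnorm (c \<cdot>\<^sub>m 1\<^sub>m n) = (cmod c)\<^sup>2 * n"
proof -
  have "(\<Sum>j<n. (cmod ((1\<^sub>m n :: complex mat) $$ (i, j)))\<^sup>2) = 1" if "i < n" for i
  proof -
    have "(\<Sum>j<n. (cmod ((1\<^sub>m n :: complex mat) $$ (i, j)))\<^sup>2) = (\<Sum>j<n. if j = i then 1 else 0)"
      using that by (intro sum.cong) auto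
    then show ?thesis using that by simp
  qed
  then have "hs_sqnorm (1\<^sub>m n) = n" by (simp add: hs_sqnorm_def)
  then show ?thesis by (simp add: hs_sqnorm_smult)
qed

lemma hform_adjoint_mult:
  assumes B: "B \<in> carrier_mat p n" and x: "x \<in> carrier_vec n"
  shows "hform (mat_adjoint B * B) x = complex_of_real (sqnorm (B *\<^sub>v x))"
proof -
  let ?A = "mat_adjoint B * B"
  have A: "?A \<in> carrier_mat n n" using B by auto
  have "complex_of_real (sqnorm (B *\<^sub>v x)) = cnj ((B *\<^sub>v x) \<bullet>c (B *\<^sub>v x))"
    by (simp add: cscalar_prod_self)
  also have "(B *\<^sub>v x) \<bullet>c (B *\<^sub>v x) = x \<bullet>c (mat_adjoint B *\<^sub>v (B *\<^sub>v x))"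
    using B x by (intro cscalar_prod_adjoint) auto
  also have "mat_adjoint B *\<^sub>v (B *\<^sub>v x) = ?A *\<^sub>v x"
    using assoc_mult_mat_vec[OF adjoint_carrier[OF B] B x] by simp
  also have "x \<bullet>c (?A *\<^sub>v x) = (\<Sum>i<n. x $ i * cnj (\<Sum>j<n. ?A $$ (i, j) * x $ j))"
    using A x by (subst cscalar_prod_sum[where n=n]) (auto simp: mult_mat_vec_index[OF A x] simp del: index_mult_mat_vec index_mult_mat(1))
  finally show ?thesis
    using x by (simp add: hform_def sum_distrib_left mult_ac del: index_mult_mat(1))
qed

text \<open>Evaluation at the unit vectors gives the squared norms of the columns, whose sum is the
  Hilbert-Schmidt norm squared; each of the \<open>n\<close> columns contributes one
  \<open>e\<close>.\<close>

lemma hs_sqnorm_root: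
  assumes L: "L \<in> carrier_mat n n" and B: "B \<in> carrier_mat p n"
    and vn: "\<And>x. x \<in> carrier_vec n \<Longrightarrow> sqnorm (L *\<^sub>v x) = sqnorm (B *\<^sub>v x) + e * sqnorm x"
  shows "hs_sqnorm L = hs_sqnorm B + e * n"
proof -
  have c: "C *\<^sub>v unit_vec n j = col C j" if "C \<in> carrier_mat q n" "j < n" for C :: "complex mat" and q j
    using that by (intro eq_vecI) auto
  have "hs_sqnorm L = (\<Sum>j<n. sqnorm (col L j))" using L by (simp add: hs_sqnorm_cols)
  also have "\<dots> = (\<Sum>j<n. sqnorm (col B j) + e)"
  proof (intro sum.cong refl)
    fix j assume "j \<in> {..<n}"
    then show "sqnorm (col L j) = sqnorm (col B j) + e"
      using vn[of "unit_vec n j"] c[OF L] c[OF B] sqnorm_unit_vec by simp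
  qed
  also have "\<dots> = hs_sqnorm B + e * n" using B by (simp add: hs_sqnorm_cols sum.distrib)
  finally show ?thesis .
qed

context star_space begin

lemma real_space_Mat: "real_space (Mat V n) (+) (\<lambda>t. mscale V (complex_of_real t)) (0\<^sub>m n n)"
  by unfold_locales
    (auto intro: Mat_add Mat_mscale Mat_zero mat_add_assoc mat_add_comm simp: Mat_add_zero mscale_add[where n=n] mscale_add_left[where n=n] mscale_zero)

text \<open>A sum of two factorizations is one factorization through the direct sum. The row of the
  left factors is encoded as the adjoint of a stacked column. This is why the cones built from
  factorizations are closed under addition.\<close>

lemma bimult_direct_sum:
  assumes x: "x \<in> Mat V m" "x' \<in> Mat V m'" and c: "\<gamma> \<in> carrier_mat n m" "\<beta> \<in> carrier_mat m n" "\<gamma>' \<in> carrier_mat n m'" "\<beta>' \<in> carrier_mat m' n"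
  shows "bimult V (mat_adjoint (inj1 m m' * mat_adjoint \<gamma> + inj2 m m' * mat_adjoint \<gamma>')) (four_block_mat x (0\<^sub>m m m') (0\<^sub>m m' m) x')
      (inj1 m m' * \<beta> + inj2 m m' * \<beta>') = bimult V \<gamma> x \<beta> + bimult V \<gamma>' x' \<beta>'"
proof -
  let ?g = "inj1 m m' * mat_adjoint \<gamma> + inj2 m m' * mat_adjoint \<gamma>'" and ?b = "inj1 m m' * \<beta> + inj2 m m' * \<beta>'"
  have c': "mat_adjoint \<gamma> \<in> carrier_mat m n" "mat_adjoint \<gamma>' \<in> carrier_mat m' n" using c by auto
  have g: "?g \<in> carrier_mat (m + m') n" and b: "?b \<in> carrier_mat (m + m') n" using c c' by auto
  have ga: "mat_adjoint ?g \<in> carrier_mat n (m + m')" by (rule adjoint_carrier[OF g])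
  have "mat_adjoint ?g * inj1 m m' = mat_adjoint (mat_adjoint (inj1 m m') * ?g)" 
    "mat_adjoint ?g * inj2 m m' = mat_adjoint (mat_adjoint (inj2 m m') * ?g)"
    using adjoint_mult[OF adjoint_carrier[OF inj_carrier(1)] g] adjoint_mult[OF adjoint_carrier[OF inj_carrier(2)] g] by simp_all
  then have e: "mat_adjoint ?g * inj1 m m' = \<gamma>" "mat_adjoint ?g * inj2 m m' = \<gamma>'"
    unfolding adj_inj1_sum[OF c'] by simp_all
  have i: "bimult V (inj1 m m') x (mat_adjoint (inj1 m m')) \<in> Mat V (m + m')" "bimult V (inj2 m m') x' (mat_adjoint (inj2 m m')) \<in> Mat V (m + m')"
    using x by (auto intro: Mat_bimult)
  show ?thesis
    unfolding four_block_bimult[OF x] bimult_add[OF i]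
      bimult_bimult[OF x(1) ga inj_carrier(1) adjoint_carrier[OF inj_carrier(1)] b]
      bimult_bimult[OF x(2) ga inj_carrier(2) adjoint_carrier[OF inj_carrier(2)] b]
    unfolding e adj_inj1_sum[OF c(2,4)] ..
qed

end

context mo_op_space begin

text \<open>A positive \<open>\<gamma> x \<beta>\<close> is self-adjoint, so it equals the average
  of itself and its adjoint, a factorization through the direct sum of \<open>x\<close> and its
  adjoint in which both factors have the same modulus. Dividing by an invertible root
  \<open>L\<close> of that modulus leaves a positive contraction of size \<open>n\<close>.\<close>

lemma cone_decomposition:
  fixes e :: real
  assumes m: "0 < m" "0 < n" and x: "x \<in> Mat V m" "mnorm V x \<le> 1" and c: "\<gamma> \<in> carrier_mat n m" "\<beta> \<in> carrier_mat m n"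
    and cone: "bimult V \<gamma> x \<beta> \<in> mcone V n" and e: "0 < e"
  obtains L y where "L \<in> carrier_mat n n" "y \<in> mcone V n" "mnorm V y \<le> 1" "bimult V \<gamma> x \<beta> = bimult V (mat_adjoint L) y L"
    and "hs_sqnorm L = (hs_sqnorm \<gamma> + hs_sqnorm \<beta>) / 2 + e * n"
proof -
  let ?c = "bimult V \<gamma> x \<beta>" and ?X = "four_block_mat x (0\<^sub>m m m) (0\<^sub>m m m) (mstar V x)"
  \<comment> \<open>The factor 1/2 of the average is shared equally between the left and the right
    factor.\<close>
  define h where "h = complex_of_real (1 / sqrt 2)"
  have h: "cnj h = h" "h * h = 1 / 2" "(cmod h)\<^sup>2 = 1 / 2"
  proof -
    have r: "1 / sqrt 2 * (1 / sqrt 2) = (1 / 2 :: real)" by simp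
    show "cnj h = h" unfolding h_def by (rule complex_cnj_complex_of_real)
    have "h * h = complex_of_real (1 / 2)" unfolding h_def of_real_mult[symmetric] r ..
    then show "h * h = 1 / 2" by simp
    show "(cmod h)\<^sup>2 = 1 / 2" unfolding h_def norm_of_real power2_eq_square abs_mult_self_eq r ..
  qed
  \<comment> \<open>The two columns have the same blocks in opposite order, hence equal norm on
    every vector; one root serves for both.\<close>
  define P Q where "P = inj1 m m * mat_adjoint \<gamma> + inj2 m m * \<beta>" and "Q = inj1 m m * \<beta> + inj2 m m * mat_adjoint \<gamma>"
  have cg: "mat_adjoint \<gamma> \<in> carrier_mat m n" "mat_adjoint \<beta> \<in> carrier_mat n m" using c by auto
  have PQ: "P \<in> carrier_mat (m + m) n" "Q \<in> carrier_mat (m + m) n" using c cg by (auto simp: P_def Q_def)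
  have xs: "mstar V x \<in> Mat V m" by (rule Mat_mstar[OF x(1)])
  have X: "?X \<in> Mat V (m + m)" by (rule Mat_four_block[OF x(1) xs])
  have nX: "mnorm V ?X \<le> 1" using norm_four_block[OF m(1,1) x(1) xs] norm_mstar[OF m(1) x(1)] x by simp
  have cM: "?c \<in> Mat V n" using cone cone_Mat[OF m(2)] by blast
  have "bimult V (mat_adjoint P) ?X Q = ?c + bimult V (mat_adjoint \<beta>) (mstar V x) (mat_adjoint \<gamma>)"
    unfolding P_def Q_def using bimult_direct_sum[OF x(1) xs c cg(2,1)] unfolding adjoint_adjoint .
  also have "bimult V (mat_adjoint \<beta>) (mstar V x) (mat_adjoint \<gamma>) = ?c"
    using mstar_bimult[OF x(1) c, unfolded cone_sa[OF m(2) cone]] by (rule sym)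
  finally have PXQ: "bimult V (mat_adjoint P) ?X Q = ?c + ?c" .
  have half: "mscale V (1 / 2) (?c + ?c) = ?c"
  proof -
    have "vscale V (1/2) w + vscale V (1/2) w = w" for w
      using vs.scale_left_distrib[of "1/2" "1/2" w] by simp
    then show ?thesis using cM by (intro eq_matI) (auto simp: mscale_index vs.scale_right_distrib)
  qed
  define B D where "B = h \<cdot>\<^sub>m P" and "D = h \<cdot>\<^sub>m Q"
  have BD: "B \<in> carrier_mat (m + m) n" "D \<in> carrier_mat (m + m) n" using PQ by (auto simp: B_def D_def)
  have "bimult V (mat_adjoint B) ?X D = mscale V (h * h) (bimult V (mat_adjoint P) ?X Q)"
    unfolding B_def D_def adjoint_smult h(1)
    by (simp add: bimult_smult_left[OF X adjoint_carrier[OF PQ(1)]] bimult_smult_right[OF X PQ(2)])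
  then have c_eq: "?c = bimult V (mat_adjoint B) ?X D" unfolding PXQ h(2) half ..
  have vPQ: "sqnorm (B *\<^sub>v v) = (sqnorm (mat_adjoint \<gamma> *\<^sub>v v) + sqnorm (\<beta> *\<^sub>v v)) / 2" "sqnorm (D *\<^sub>v v) = (sqnorm (mat_adjoint \<gamma> *\<^sub>v v) + sqnorm (\<beta> *\<^sub>v v)) / 2"
    if v: "v \<in> carrier_vec n" for v
  proof -
    have "sqnorm (P *\<^sub>v v) = sqnorm (mat_adjoint \<gamma> *\<^sub>v v) + sqnorm (\<beta> *\<^sub>v v)" "sqnorm (Q *\<^sub>v v) = sqnorm (\<beta> *\<^sub>v v) + sqnorm (mat_adjoint \<gamma> *\<^sub>v v)"
      unfolding P_def Q_def using sqnorm_inj_sum[OF cg(1) c(2) v] sqnorm_inj_sum[OF c(2) cg(1) v] by simp_all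
    then show "sqnorm (B *\<^sub>v v) = (sqnorm (mat_adjoint \<gamma> *\<^sub>v v) + sqnorm (\<beta> *\<^sub>v v)) / 2" "sqnorm (D *\<^sub>v v) = (sqnorm (mat_adjoint \<gamma> *\<^sub>v v) + sqnorm (\<beta> *\<^sub>v v)) / 2"
      unfolding B_def D_def smult_mat_vec[OF PQ(1) v] smult_mat_vec[OF PQ(2) v] sqnorm_smult h(3) by simp_all
  qed
  have hB: "hs_sqnorm B = (hs_sqnorm \<gamma> + hs_sqnorm \<beta>) / 2"
    unfolding B_def P_def hs_sqnorm_smult hs_sqnorm_inj_sum[OF cg(1) c(2)] h(3) by simp
  obtain L L' where L: "L \<in> carrier_mat n n" "L' \<in> carrier_mat n n" "L * L' = 1\<^sub>m n" "L' * L = 1\<^sub>m n"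
    and vL: "\<And>v. v \<in> carrier_vec n \<Longrightarrow> sqnorm (L *\<^sub>v v) = Re (hform (mat_adjoint B * B) v) + e * sqnorm v"
  proof (rule psd_root[OF _ e, of n "mat_adjoint B * B"])
    show "0 \<le> Re (hform (mat_adjoint B * B) v)" if "v \<in> carrier_vec n" for v
      using hform_adjoint_mult[OF BD(1) that] by simp
  qed blast
  have vL': "sqnorm (L *\<^sub>v v) = sqnorm (B *\<^sub>v v) + e * sqnorm v" if "v \<in> carrier_vec n" for v
    using vL[OF that] hform_adjoint_mult[OF BD(1) that] by simp
  have bB: "sq_bounded 1 (A * L')" if A: "A \<in> carrier_mat (m + m) n" and eq: "\<And>v. v \<in> carrier_vec n \<Longrightarrow> sqnorm (A *\<^sub>v v) = sqnorm (B *\<^sub>v v)" for A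
    unfolding sq_bounded_def
  proof
    fix v :: "complex vec" assume "v \<in> carrier_vec (dim_col (A * L'))"
    then have v: "v \<in> carrier_vec n" using L by simp
    have L'v: "L' *\<^sub>v v \<in> carrier_vec n" using L v by simp
    have "sqnorm (A * L' *\<^sub>v v) = sqnorm (B *\<^sub>v (L' *\<^sub>v v))"
      using assoc_mult_mat_vec[OF A L(2) v] eq[OF L'v] by simp
    also have "\<dots> \<le> sqnorm (L *\<^sub>v (L' *\<^sub>v v))"
      using vL'[OF L'v] e by simp
    also have "L *\<^sub>v (L' *\<^sub>v v) = v" using assoc_mult_mat_vec[OF L(1,2) v] L(3) v by simp
    finally show "sqnorm (A * L' *\<^sub>v v) \<le> 1 * sqnorm v" by simp
  qed
  \<comment> \<open>Positive as a conjugate of a positive element, and contractive because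
    \<open>B * L'\<close> and \<open>D * L'\<close> are contractions.\<close>
  define y where "y = bimult V (mat_adjoint L') ?c L'"
  have y: "y \<in> mcone V n" unfolding y_def by (rule cone_adj_bimult[OF m(2,2) cone L(2)])
  have LL: "mat_adjoint L * mat_adjoint L' = 1\<^sub>m n"
    using adjoint_mult[OF L(2,1)] L(4) by simp
  have cy: "?c = bimult V (mat_adjoint L) y L"
    unfolding y_def bimult_bimult[OF cM adjoint_carrier[OF L(1)] adjoint_carrier[OF L(2)] L(2,1)] LL L(4) bimult_one[OF cM] ..
  have "y = bimult V (mat_adjoint (B * L')) ?X (D * L')"
    unfolding y_def c_eq bimult_bimult[OF X adjoint_carrier[OF L(2)] adjoint_carrier[OF BD(1)] BD(2) L(2)] 
      adjoint_mult[OF BD(1) L(2)] ..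
  then have "mnorm V y \<le> sqrt 1 * mnorm V ?X * sqrt 1"
    using m X BD L bB[OF BD(1)] bB[OF BD(2)] vPQ
    by (simp only:) (intro norm_bimult_le[of "m + m" n] sq_bounded_adjoint; simp)
  then have "mnorm V y \<le> 1" using nX by simp
  then show thesis using that[OF L(1) y _ cy] hs_sqnorm_root[OF L(1) BD(1) vL'] hB by simp
qed

end

locale dual_mo_op_space = mo_op_space V + D: mo_op_space "dual V" for V :: "('a::ab_group_add) mo_space"
begin

text \<open>The self-adjoint matrix at which \<open>num_radius\<close> evaluates functionals, with
  the size read off \<open>F\<close>.\<close>

definition sa_block :: "('a \<Rightarrow> complex) mat \<Rightarrow> ('a \<Rightarrow> complex) mat" where
  "sa_block F = four_block_mat (0\<^sub>m (dim_row F) (dim_row F)) F (mstar (dual V) F) (0\<^sub>m (dim_row F) (dim_row F))"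

lemma Mat_sa_block:
  assumes F: "F \<in> Mat (dual V) n"
  shows "sa_block F \<in> Mat (dual V) (n + n)"
  using F D.Mat_mstar[OF F] D.carrier_zero
  by (intro MatI) (auto simp: sa_block_def intro: dual_entry dest: Mat_carrier)

lemma mstar_sa_block:
  assumes F: "F \<in> Mat (dual V) n"
  shows "mstar (dual V) (sa_block F) = sa_block F"
  using F D.Mat_mstar[OF F] D.vstar_zero D.vstar_vstar[OF Mat_entry[OF F]]
  by (intro eq_matI) (auto simp: sa_block_def mstar_index simp del: dual_simps)

lemma pair_sa_block:
  assumes F: "F \<in> Mat (dual V) n" and z: "z \<in> Mat V (n + n)"
  shows "pair (sa_block F) z = pair F (blk n True False z) + pair (mstar (dual V) F) (blk n False True z)"
proof -
  have dF: "dim_row F = n" "dim_col F = n" using F by auto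
  have "pair (sa_block F) z = (\<Sum>i<n. \<Sum>j<n. (F $$ (i, j)) (z $$ (i, n + j))) + (\<Sum>i<n. \<Sum>j<n. (mstar (dual V) F $$ (i, j)) (z $$ (n + i, j)))"
    using F by (simp add: pair_def sa_block_def sum_lessThan_add)
  then show ?thesis using F z by (simp add: pair_def blk_index)
qed

text \<open>On a self-adjoint element the pairing is twice the real part of \<open>F\<close> at the
  upper corner. After \<open>cone_decomposition\<close> that corner factors through a positive
  contraction, where \<open>F1\<close> applies, and the two outer factors are the two halves of
  \<open>L\<close>.\<close>

lemma pair_sa_block_cone:
  assumes n: "0 < n" and F: "F \<in> Mat (dual V) n"
    and F1: "\<And>m y \<alpha> \<beta>. 0 < m \<Longrightarrow> y \<in> mcone V m \<Longrightarrow> mnorm V y \<le> 1 \<Longrightarrow> \<alpha> \<in> carrier_mat n m \<Longrightarrow> \<beta> \<in> carrier_mat m n \<Longrightarrow>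
      cmod (pair F (bimult V \<alpha> y \<beta>)) \<le> (hs_sqnorm \<alpha> + hs_sqnorm \<beta>) / 2"
    and m: "0 < m" and x: "x \<in> Mat V m" "mnorm V x \<le> 1" and c: "\<gamma> \<in> carrier_mat (n + n) m" "\<beta> \<in> carrier_mat m (n + n)"
    and cone: "bimult V \<gamma> x \<beta> \<in> mcone V (n + n)"
  shows "Re (pair (sa_block F) (bimult V \<gamma> x \<beta>)) \<le> (hs_sqnorm \<gamma> + hs_sqnorm \<beta>) / 2"
proof (rule field_le_epsilon)
  fix e :: real assume e: "0 < e"
  let ?c = "bimult V \<gamma> x \<beta>" and ?e = "e / real (n + n)"
  have nn: "0 < n + n" and e': "0 < ?e" using n e by auto
  obtain L y where L: "L \<in> carrier_mat (n + n) (n + n)" "y \<in> mcone V (n + n)" "mnorm V y \<le> 1" "?c = bimult V (mat_adjoint L) y L"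
    and hL: "hs_sqnorm L = (hs_sqnorm \<gamma> + hs_sqnorm \<beta>) / 2 + ?e * real (n + n)"
    by (rule cone_decomposition[OF m nn x c cone e'])
  have cM: "?c \<in> Mat V (n + n)" using cone_Mat[OF nn cone] .
  have yM: "y \<in> Mat V (n + n)" using cone_Mat[OF nn L(2)] .
  let ?a = "mat_adjoint (inj1 n n) * mat_adjoint L" and ?b = "L * inj2 n n"
  have La: "mat_adjoint L \<in> carrier_mat (n + n) (n + n)" using L(1) by (rule adjoint_carrier)
  have ab: "?a \<in> carrier_mat n (n + n)" "?b \<in> carrier_mat (n + n) n" using L(1) La by auto
  have blkc: "blk n True False ?c = bimult V ?a y ?b"
    unfolding L(4) blk_def using bimult_bimult[OF yM adjoint_carrier[OF inj_carrier(1)] La L(1) inj_carrier(2)] by simp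
  have "mstar V (blk n False True ?c) = blk n True False ?c"
    using mstar_blk[OF cM, of False True] cone_sa[OF nn cone] by simp
  then have "pair (sa_block F) ?c = pair F (bimult V ?a y ?b) + cnj (pair F (bimult V ?a y ?b))"
    unfolding pair_sa_block[OF F cM] pair_mstar[OF F Mat_blk[OF cM]] blkc by simp
  then have "Re (pair (sa_block F) ?c) \<le> 2 * cmod (pair F (bimult V ?a y ?b))"
    using complex_Re_le_cmod[of "pair F (bimult V ?a y ?b)"] by simp
  also have "\<dots> \<le> hs_sqnorm ?a + hs_sqnorm ?b" using F1[OF nn L(2,3) ab] by simp
  also have "\<dots> = hs_sqnorm L"
  proof -
    \<comment> \<open>The adjoint of \<open>L\<close> is \<open>?a\<close> stacked on
      \<open>?b'\<close>, so the squared Hilbert-Schmidt norms of the two halves add up to that of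
      \<open>L\<close>.\<close>
    let ?b' = "mat_adjoint (inj2 n n) * mat_adjoint L"
    have "inj1 n n * ?a + inj2 n n * ?b' = (inj1 n n * mat_adjoint (inj1 n n) + inj2 n n * mat_adjoint (inj2 n n)) * mat_adjoint L"
      using La by (subst add_mult_distrib_mat[where nr="n + n" and n="n + n" and nc="n + n"])
        (auto simp: assoc_mult_mat[OF inj_carrier(1) adjoint_carrier[OF inj_carrier(1)] La] assoc_mult_mat[OF inj_carrier(2) adjoint_carrier[OF inj_carrier(2)] La])
    also have "\<dots> = mat_adjoint L" unfolding inj_mult_adj by (rule left_mult_one_mat[OF La])
    finally have "hs_sqnorm (mat_adjoint L) = hs_sqnorm ?a + hs_sqnorm ?b'"
      using hs_sqnorm_inj_sum[of ?a n "n + n" ?b' n] La by (simp add: mult_carrier_mat[where n="n + n"])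
    moreover have "hs_sqnorm ?b' = hs_sqnorm ?b" using adjoint_mult[OF L(1) inj_carrier(2)] by (metis hs_sqnorm_adjoint)
    ultimately show ?thesis by simp
  qed
  also have "\<dots> = (hs_sqnorm \<gamma> + hs_sqnorm \<beta>) / 2 + e" unfolding hL using n by simp
  finally show "Re (pair (sa_block F) ?c) \<le> (hs_sqnorm \<gamma> + hs_sqnorm \<beta>) / 2 + e" .
qed

end

section \<open>The numerical radius on the dual\<close>

context star_space begin

lemma bimult_scalar:
  assumes x: "x \<in> Mat V n"
  shows "bimult V (c \<cdot>\<^sub>m 1\<^sub>m n) x (d \<cdot>\<^sub>m 1\<^sub>m n) = mscale V (c * d) x"
  by (simp add: bimult_smult_left[OF x one_carrier_mat] bimult_smult_right[OF x one_carrier_mat] bimult_one[OF x] mult.commute)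

end

context dual_mo_op_space begin

text \<open>The linear minorants of this cone are the functionals \<open>l\<close> with
  \<open>l(\<gamma> x \<beta>) \<le> (\<parallel>\<gamma>\<parallel>\<^sub>2\<^sup>2 + \<parallel>\<beta>\<parallel>\<^sub>2\<^sup>2)/2\<close> for contractions \<open>x\<close>, i.e. the cb-contractions,
  that dominate \<open>G\<close> on the positive elements.\<close>

definition dom_cone :: "nat \<Rightarrow> ('a \<Rightarrow> complex) mat \<Rightarrow> ('a mat \<times> real) set" where
  "dom_cone M G = {(z, a). z \<in> Mat V M \<and> (\<exists>m \<gamma> \<beta> x c. 0 < m \<and> \<gamma> \<in> carrier_mat M m \<and> \<beta> \<in> carrier_mat m M \<and>
     x \<in> Mat V m \<and> mnorm V x \<le> 1 \<and> c \<in> mcone V M \<and> z + c = bimult V \<gamma> x \<beta> \<and>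
     (hs_sqnorm \<gamma> + hs_sqnorm \<beta>) / 2 - Re (pair G c) \<le> a)}"

lemma dom_coneI:
  assumes "z \<in> Mat V M" "0 < m" "\<gamma> \<in> carrier_mat M m" "\<beta> \<in> carrier_mat m M" "x \<in> Mat V m" "mnorm V x \<le> 1"
    "c \<in> mcone V M" "z + c = bimult V \<gamma> x \<beta>" "(hs_sqnorm \<gamma> + hs_sqnorm \<beta>) / 2 - Re (pair G c) \<le> a"
  shows "(z, a) \<in> dom_cone M G"
  using assms unfolding dom_cone_def by blast

text \<open>Sums are taken over direct sums, and scaling by \<open>t\<close> puts the root of
  \<open>t\<close> on each factor. Over zero the positive element itself is
  \<open>\<gamma> x \<beta>\<close>, so the last clause of \<open>epi_cone\<close> is exactly the
  hypothesis \<open>G_le\<close>.\<close>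

lemma epi_cone_dom_cone:
  assumes M: "0 < M" and G: "G \<in> Mat (dual V) M"
    and G_le: "\<And>m x \<gamma> \<beta>. 0 < m \<Longrightarrow> x \<in> Mat V m \<Longrightarrow> mnorm V x \<le> 1 \<Longrightarrow> \<gamma> \<in> carrier_mat M m \<Longrightarrow> \<beta> \<in> carrier_mat m M \<Longrightarrow>
      bimult V \<gamma> x \<beta> \<in> mcone V M \<Longrightarrow> Re (pair G (bimult V \<gamma> x \<beta>)) \<le> (hs_sqnorm \<gamma> + hs_sqnorm \<beta>) / 2"
  shows "real_space.epi_cone (Mat V M) (+) (\<lambda>t. mscale V (complex_of_real t)) (0\<^sub>m M M) (dom_cone M G)"
proof -
  interpret rs: real_space "Mat V M" "(+)" "\<lambda>t. mscale V (complex_of_real t)" "0\<^sub>m M M"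
    by (rule real_space_Mat)
  show ?thesis
    unfolding rs.epi_cone_def
  proof (intro conjI allI impI)
    show "dom_cone M G \<subseteq> Mat V M \<times> UNIV" by (auto simp: dom_cone_def)
  next
    fix z a z' a' assume "(z, a) \<in> dom_cone M G" "(z', a') \<in> dom_cone M G"
    then obtain m \<gamma> \<beta> x c m' \<gamma>' \<beta>' x' c' where
      h: "z \<in> Mat V M" "0 < m" "\<gamma> \<in> carrier_mat M m" "\<beta> \<in> carrier_mat m M" "x \<in> Mat V m" "mnorm V x \<le> 1"
        "c \<in> mcone V M" "z + c = bimult V \<gamma> x \<beta>" "(hs_sqnorm \<gamma> + hs_sqnorm \<beta>) / 2 - Re (pair G c) \<le> a" and
      h': "z' \<in> Mat V M" "0 < m'" "\<gamma>' \<in> carrier_mat M m'" "\<beta>' \<in> carrier_mat m' M" "x' \<in> Mat V m'" "mnorm V x' \<le> 1"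
        "c' \<in> mcone V M" "z' + c' = bimult V \<gamma>' x' \<beta>'" "(hs_sqnorm \<gamma>' + hs_sqnorm \<beta>') / 2 - Re (pair G c') \<le> a'"
      unfolding dom_cone_def by auto
    let ?g = "mat_adjoint (inj1 m m' * mat_adjoint \<gamma> + inj2 m m' * mat_adjoint \<gamma>')" and ?b = "inj1 m m' * \<beta> + inj2 m m' * \<beta>'"
    let ?x = "four_block_mat x (0\<^sub>m m m') (0\<^sub>m m' m) x'"
    have ad: "mat_adjoint \<gamma> \<in> carrier_mat m M" "mat_adjoint \<gamma>' \<in> carrier_mat m' M" using h(3) h'(3) by auto
    have cM: "c \<in> Mat V M" "c' \<in> Mat V M" using cone_Mat[OF M] h(7) h'(7) by auto
    show "(z + z', a + a') \<in> dom_cone M G"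
    proof (rule dom_coneI)
      show "z + z' \<in> Mat V M" using h(1) h'(1) by (rule Mat_add)
      show "0 < m + m'" using h(2) by simp
      show "?g \<in> carrier_mat M (m + m')" by (rule adjoint_carrier, rule add_carrier_mat, rule mult_carrier_mat[OF inj_carrier(2) ad(2)])
      show "?b \<in> carrier_mat (m + m') M" by (rule add_carrier_mat, rule mult_carrier_mat[OF inj_carrier(2) h'(4)])
      show "?x \<in> Mat V (m + m')" using h(5) h'(5) by (rule Mat_four_block)
      show "mnorm V ?x \<le> 1" using norm_four_block[OF h(2) h'(2) h(5) h'(5)] h(6) h'(6) by simp
      show "c + c' \<in> mcone V M" using cone_add[OF M h(7) h'(7)] .
      have "z + z' + (c + c') = (z + c) + (z' + c')"
        using h(1) h'(1) cM by (intro eq_matI) (auto simp: algebra_simps)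
      then show "z + z' + (c + c') = bimult V ?g ?x ?b"
        unfolding h(8) h'(8) bimult_direct_sum[OF h(5) h'(5) h(3,4) h'(3,4)] .
      show "(hs_sqnorm ?g + hs_sqnorm ?b) / 2 - Re (pair G (c + c')) \<le> a + a'"
        unfolding hs_sqnorm_adjoint hs_sqnorm_inj_sum[OF ad] hs_sqnorm_inj_sum[OF h(4) h'(4)] pair_add_right[OF G cM]
        using h(9) h'(9) by (simp add: field_simps)
    qed
  next
    fix z a t assume "(z, a) \<in> dom_cone M G" and t: "0 \<le> (t::real)"
    then obtain m \<gamma> \<beta> x c where
      h: "z \<in> Mat V M" "0 < m" "\<gamma> \<in> carrier_mat M m" "\<beta> \<in> carrier_mat m M" "x \<in> Mat V m" "mnorm V x \<le> 1"
        "c \<in> mcone V M" "z + c = bimult V \<gamma> x \<beta>" "(hs_sqnorm \<gamma> + hs_sqnorm \<beta>) / 2 - Re (pair G c) \<le> a"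
      unfolding dom_cone_def by auto
    have cM: "c \<in> Mat V M" using cone_Mat[OF M] h(7) by auto
    let ?s = "complex_of_real (sqrt t)"
    have s: "?s * ?s = complex_of_real t" "(cmod ?s)\<^sup>2 = t" using t by (simp_all flip: of_real_mult)
    show "(mscale V (complex_of_real t) z, t * a) \<in> dom_cone M G"
    proof (rule dom_coneI)
      show "mscale V (complex_of_real t) z \<in> Mat V M" using h(1) by (rule Mat_mscale)
      show "?s \<cdot>\<^sub>m \<gamma> \<in> carrier_mat M m" "?s \<cdot>\<^sub>m \<beta> \<in> carrier_mat m M" using h by auto
      show "mscale V (complex_of_real t) c \<in> mcone V M" using cone_scale[OF M h(7) t] .
      have "bimult V (?s \<cdot>\<^sub>m \<gamma>) x (?s \<cdot>\<^sub>m \<beta>) = mscale V (?s * ?s) (bimult V \<gamma> x \<beta>)"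
        by (simp add: bimult_smult_left[OF h(5,3)] bimult_smult_right[OF h(5,4)] del: of_real_mult)
      then show "mscale V (complex_of_real t) z + mscale V (complex_of_real t) c = bimult V (?s \<cdot>\<^sub>m \<gamma>) x (?s \<cdot>\<^sub>m \<beta>)"
        unfolding s h(8)[symmetric] mscale_add[OF h(1) cM] by simp
      have "(hs_sqnorm (?s \<cdot>\<^sub>m \<gamma>) + hs_sqnorm (?s \<cdot>\<^sub>m \<beta>)) / 2 - Re (pair G (mscale V (complex_of_real t) c)) = t * ((hs_sqnorm \<gamma> + hs_sqnorm \<beta>) / 2 - Re (pair G c))"
        unfolding hs_sqnorm_smult s pair_mscale_right[OF G cM] by (simp add: algebra_simps)
      also have "\<dots> \<le> t * a" using h(9) t by (rule mult_left_mono)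
      finally show "(hs_sqnorm (?s \<cdot>\<^sub>m \<gamma>) + hs_sqnorm (?s \<cdot>\<^sub>m \<beta>)) / 2 - Re (pair G (mscale V (complex_of_real t) c)) \<le> t * a" .
    qed (use h in auto)
  next
    fix a assume "(0\<^sub>m M M, a) \<in> dom_cone M G"
    then obtain m \<gamma> \<beta> x c where
      h: "0 < m" "\<gamma> \<in> carrier_mat M m" "\<beta> \<in> carrier_mat m M" "x \<in> Mat V m" "mnorm V x \<le> 1"
        "c \<in> mcone V M" "0\<^sub>m M M + c = bimult V \<gamma> x \<beta>" "(hs_sqnorm \<gamma> + hs_sqnorm \<beta>) / 2 - Re (pair G c) \<le> a"
      unfolding dom_cone_def by auto
    have c: "c = bimult V \<gamma> x \<beta>" using h(7) Mat_add_zero(2)[OF cone_Mat[OF M h(6)]] by simp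
    have "Re (pair G c) \<le> (hs_sqnorm \<gamma> + hs_sqnorm \<beta>) / 2"
      unfolding c by (rule G_le[OF h(1,4,5,2,3)]) (use h(6) c in simp)
    then show "0 \<le> a" using h(8) by linarith
  qed
qed

lemma dom_cone_bimult:
  assumes M: "0 < M" and G: "G \<in> Mat (dual V) M" and h: "0 < m" "\<gamma> \<in> carrier_mat M m" "\<beta> \<in> carrier_mat m M" "x \<in> Mat V m" "mnorm V x \<le> 1"
  shows "(bimult V \<gamma> x \<beta>, (hs_sqnorm \<gamma> + hs_sqnorm \<beta>) / 2) \<in> dom_cone M G"
proof (rule dom_coneI[OF Mat_bimult[OF h(4,2,3)] h cone_zero[OF M]])
  have "pair G (0\<^sub>m M M) = 0" using pair_mscale_right[OF G Mat_zero, of 0] by simp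
  then show "(hs_sqnorm \<gamma> + hs_sqnorm \<beta>) / 2 - Re (pair G (0\<^sub>m M M)) \<le> (hs_sqnorm \<gamma> + hs_sqnorm \<beta>) / 2" by simp
qed (rule Mat_add_zero(1)[OF Mat_bimult[OF h(4,2,3)]])

text \<open>Writes \<open>z\<close> as its normalization between two copies of a scalar matrix whose
  squared Hilbert-Schmidt norm is \<open>M\<close> times the norm of \<open>z\<close>. This yields
  totality of the cone and boundedness of its minorants.\<close>

lemma dom_cone_norm:
  assumes M: "0 < M" and G: "G \<in> Mat (dual V) M" and z: "z \<in> Mat V M"
  shows "(z, real M * mnorm V z) \<in> dom_cone M G"
proof -
  define t where "t = mnorm V z"
  have t: "0 \<le> t" unfolding t_def by (rule norm_nonneg[OF M z])
  let ?s = "complex_of_real (sqrt t)" and ?x = "mscale V (complex_of_real (1 / t)) z"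
  have s: "?s * ?s = complex_of_real t" "(cmod ?s)\<^sup>2 = t" using t by (simp_all flip: of_real_mult)
  have x: "?x \<in> Mat V M" by (rule Mat_mscale[OF z])
  have nx: "mnorm V ?x \<le> 1"
    unfolding norm_mscale[OF M z] norm_of_real t_def[symmetric]
  \<comment> \<open>For \<open>t = 0\<close> division by zero makes the rescaled matrix zero, so the
    bound still holds.\<close>
  proof (cases "t = 0")
    case False
    have "\<bar>1 / t\<bar> = 1 / t" by (rule abs_of_nonneg) (use t in \<open>rule zero_le_divide_1_iff[THEN iffD2]\<close>)
    then show "\<bar>1 / t\<bar> * t \<le> 1" using False by (simp only:) simp
  qed (simp only: mult_zero_right zero_le_one)
  have e: "bimult V (?s \<cdot>\<^sub>m 1\<^sub>m M) ?x (?s \<cdot>\<^sub>m 1\<^sub>m M) = z"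
  proof (cases "t = 0")
    case True
    then have "z = 0\<^sub>m M M" using norm_zero_iff[OF M z] by (simp add: t_def)
    then show ?thesis unfolding bimult_scalar[OF x] by simp
  next
    case False
    then have "?s * ?s * complex_of_real (1 / t) = 1" unfolding s by simp
    then show ?thesis unfolding bimult_scalar[OF x] mscale_mscale by simp
  qed
  have "(bimult V (?s \<cdot>\<^sub>m 1\<^sub>m M) ?x (?s \<cdot>\<^sub>m 1\<^sub>m M), (hs_sqnorm (?s \<cdot>\<^sub>m 1\<^sub>m M) + hs_sqnorm (?s \<cdot>\<^sub>m 1\<^sub>m M)) / 2) \<in> dom_cone M G"
    by (rule dom_cone_bimult[OF M G M _ _ x nx]) auto
  then show ?thesis unfolding e hs_sqnorm_one_smult s t_def[symmetric] by (simp add: mult.commute)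
qed

text \<open>Complete positivity follows from positivity of one scalar functional: the form of each
  amplification at a vector is the pairing with a compression of a positive element to size
  \<open>n\<close>. Self-adjointness makes these values real.\<close>

lemma mcone_dualI:
  assumes n: "0 < n" and K: "K \<in> Mat (dual V) n" and sa: "mstar (dual V) K = K"
    and pos: "\<And>c. c \<in> mcone V n \<Longrightarrow> 0 \<le> Re (pair K c)"
  shows "K \<in> mcone (dual V) n"
proof -
  have "induced_map K (vstar V v) = mat_adjoint (induced_map K v)" if v: "v \<in> vcarrier V" for v
  proof (rule eq_matI)
    fix i j assume "i < dim_row (mat_adjoint (induced_map K v))" "j < dim_col (mat_adjoint (induced_map K v))"
    then have ij: "i < n" "j < n" using K by (auto simp: induced_map_def)
    have "K $$ (i, j) = vstar (dual V) (K $$ (j, i))"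
      using mstar_index[of i K j "dual V"] K ij unfolding sa by (simp del: dual_simps)
    then have "(K $$ (i, j)) (vstar V v) = cnj ((K $$ (j, i)) v)"
      using v by (simp add: vstar_carrier vstar_vstar)
    then show "induced_map K (vstar V v) $$ (i, j) = mat_adjoint (induced_map K v) $$ (i, j)"
      using K ij by (simp add: induced_map_def)
  qed (use K in \<open>auto simp: induced_map_def\<close>)
  moreover have "psd (m * n) (amplification K y)" if m: "0 < m" and y: "y \<in> mcone V m" for m y
    unfolding psd_def
  proof (intro conjI ballI)
    have yM: "y \<in> Mat V m" by (rule cone_Mat[OF m y])
    show "amplification K y \<in> carrier_mat (m * n) (m * n)" by (rule amplification_carrier[OF K yM])
    fix \<eta> :: "complex vec" assume \<eta>: "\<eta> \<in> carrier_vec (m * n)"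
    define c where "c = bimult V (mat_adjoint (col_mat m n \<eta>)) y (col_mat m n \<eta>)"
    have c: "c \<in> mcone V n" unfolding c_def using m n y by (intro cone_adj_bimult) auto
    have "pair K c = cnj (pair K c)"
      using pair_mstar[OF K cone_Mat[OF n c]] unfolding sa cone_sa[OF n c] .
    then have "Im (pair K c) = 0" by (simp add: complex_eq_iff)
    moreover have "(amplification K y *\<^sub>v \<eta>) \<bullet>c \<eta> = pair K c"
      unfolding c_def by (rule amplification_cscalar[OF K yM \<eta> \<eta>])
    ultimately show "0 \<le> (amplification K y *\<^sub>v \<eta>) \<bullet>c \<eta>" using pos[OF c] by (simp add: less_eq_complex_def)
  qed
  ultimately show ?thesis
    using K by (simp add: dual_def Mat_def)
qed

text \<open>A linear minorant of \<open>dom_cone\<close> is a cb-contraction above \<open>G\<close>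
  on positive elements. Its self-adjoint part \<open>G1\<close> makes \<open>G1 - G\<close> positive
  in the dual, so \<open>\<phi> G \<le> \<phi> G1 \<le> 1\<close> for the real parts.\<close>

lemma sa_block_le:
  assumes n: "0 < n" and F: "F \<in> Mat (dual V) n"
    and F1: "\<And>m y \<alpha> \<beta>. 0 < m \<Longrightarrow> y \<in> mcone V m \<Longrightarrow> mnorm V y \<le> 1 \<Longrightarrow> \<alpha> \<in> carrier_mat n m \<Longrightarrow> \<beta> \<in> carrier_mat m n \<Longrightarrow>
      cmod (pair F (bimult V \<alpha> y \<beta>)) \<le> (hs_sqnorm \<alpha> + hs_sqnorm \<beta>) / 2"
    and \<phi>: "positive_contractive (dual V) (n + n) \<phi>"
  shows "Re (\<phi> (sa_block F)) \<le> 1"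
proof -
  define M where "M = n + n"
  define G where "G = sa_block F"
  have M: "0 < M" using n by (simp add: M_def)
  have G: "G \<in> Mat (dual V) M" unfolding G_def M_def by (rule Mat_sa_block[OF F])
  interpret rs: real_space "Mat V M" "(+)" "\<lambda>t. mscale V (complex_of_real t)" "0\<^sub>m M M"
    by (rule real_space_Mat)
  have ep: "rs.epi_cone (dom_cone M G)"
  proof (rule epi_cone_dom_cone[OF M G])
    show "Re (pair G (bimult V \<gamma> x \<beta>)) \<le> (hs_sqnorm \<gamma> + hs_sqnorm \<beta>) / 2"
      if "0 < m" "x \<in> Mat V m" "mnorm V x \<le> 1" "\<gamma> \<in> carrier_mat M m" "\<beta> \<in> carrier_mat m M" "bimult V \<gamma> x \<beta> \<in> mcone V M" for m x \<gamma> \<beta>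
      using pair_sa_block_cone[OF n F F1 that(1-3) that(4-6)[unfolded M_def]] unfolding G_def .
  qed
  obtain l where l: "\<And>x y. x \<in> Mat V M \<Longrightarrow> y \<in> Mat V M \<Longrightarrow> l (x + y) = l x + l y"
      "\<And>t x. x \<in> Mat V M \<Longrightarrow> l (mscale V (complex_of_real t) x) = t * l x"
    and l_le: "\<And>x a. (x, a) \<in> dom_cone M G \<Longrightarrow> l x \<le> a"
    using rs.epi_cone_linear_minorant[OF ep] dom_cone_norm[OF M G] by blast
  have l_neg: "l (mscale V (- 1) x) = - l x" if "x \<in> Mat V M" for x
    using l(2)[OF that, of "- 1"] by (simp only: of_real_minus of_real_1 mult_minus1)
  have l_bound: "\<bar>l x\<bar> \<le> real M * mnorm V x" if x: "x \<in> Mat V M" for x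
  proof -
    have "mnorm V (mscale V (- 1) x) = mnorm V x" unfolding norm_mscale[OF M x] norm_minus_cancel norm_one mult_1 ..
    then have "- l x \<le> real M * mnorm V x"
      using l_le[OF dom_cone_norm[OF M G Mat_mscale[OF x, of "- 1"]]] unfolding l_neg[OF x] by (simp only:)
    then show ?thesis using l_le[OF dom_cone_norm[OF M G x]] by (rule abs_leI[rotated])
  qed
  obtain F' where F': "F' \<in> Mat (dual V) M" and F'l: "\<And>x. x \<in> Mat V M \<Longrightarrow> Re (pair F' x) = l x"
    using functional_pair[OF M l l_bound] by blast
  have b1: "cmod (pair F' (bimult V \<alpha> x \<beta>)) \<le> (hs_sqnorm \<alpha> + hs_sqnorm \<beta>) / 2"
    if h: "0 < m" "x \<in> Mat V m" "mnorm V x \<le> 1" "\<alpha> \<in> carrier_mat M m" "\<beta> \<in> carrier_mat m M" for m x \<alpha> \<beta>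
  proof -
    define w where "w = pair F' (bimult V \<alpha> x \<beta>)"
    \<comment> \<open>A unimodular factor makes the value real and nonnegative; it is absorbed into
      \<open>\<alpha>\<close> without changing its norm, so a bound on real parts bounds
      moduli.\<close>
    define u where "u = (if w = 0 then 1 else cnj w / cmod w)"
    have u: "cmod u = 1" "u * w = cmod w"
      using complex_norm_square[of w] by (auto simp: u_def norm_divide power2_eq_square field_simps)
    have bM: "bimult V \<alpha> x \<beta> \<in> Mat V M" by (rule Mat_bimult[OF h(2,4,5)])
    have "bimult V (u \<cdot>\<^sub>m \<alpha>) x \<beta> = mscale V u (bimult V \<alpha> x \<beta>)" by (rule bimult_smult_left[OF h(2,4)])
    then have "pair F' (bimult V (u \<cdot>\<^sub>m \<alpha>) x \<beta>) = cmod w" using pair_mscale_right[OF F' bM] u by (simp add: w_def)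
    then have "cmod w = l (bimult V (u \<cdot>\<^sub>m \<alpha>) x \<beta>)"
      using F'l[OF Mat_bimult[OF h(2) smult_carrier_mat[OF h(4)] h(5)], of u] by simp
    also have "\<dots> \<le> (hs_sqnorm (u \<cdot>\<^sub>m \<alpha>) + hs_sqnorm \<beta>) / 2"
      by (rule l_le[OF dom_cone_bimult[OF M G h(1) smult_carrier_mat[OF h(4)] h(5,2,3)]])
    finally show ?thesis by (simp add: w_def hs_sqnorm_smult u)
  qed
  \<comment> \<open>Symmetrization is needed for membership in the cone of the dual. It preserves
    real parts of values on positive elements and the cb-bound.\<close>
  define G1 where "G1 = mscale (dual V) (1 / 2) (F' + mstar (dual V) F')"
  have sF': "mstar (dual V) F' \<in> Mat (dual V) M" by (rule D.Mat_mstar[OF F'])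
  have G1: "G1 \<in> Mat (dual V) M" unfolding G1_def by (intro D.Mat_mscale D.Mat_add F' sF')
  have pG1: "pair G1 z = (pair F' z + cnj (pair F' (mstar V z))) / 2" if "z \<in> Mat V M" for z
    unfolding G1_def pair_mscale_left[OF D.Mat_add[OF F' sF']] pair_add_left[OF F' sF'] pair_mstar[OF F' that] by simp
  have b2: "cmod (pair G1 (bimult V \<alpha> x \<beta>)) \<le> 1 * (hs_sqnorm \<alpha> + hs_sqnorm \<beta>) / 2"
    if h: "0 < m" "x \<in> Mat V m" "mnorm V x \<le> 1" "\<alpha> \<in> carrier_mat M m" "\<beta> \<in> carrier_mat m M" for m x \<alpha> \<beta>
  proof -
    have "mstar V (bimult V \<alpha> x \<beta>) = bimult V (mat_adjoint \<beta>) (mstar V x) (mat_adjoint \<alpha>)" by (rule mstar_bimult[OF h(2,4,5)])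
    then have "cmod (pair F' (mstar V (bimult V \<alpha> x \<beta>))) \<le> (hs_sqnorm \<beta> + hs_sqnorm \<alpha>) / 2"
      using b1[OF h(1) Mat_mstar[OF h(2)] _ adjoint_carrier[OF h(5)] adjoint_carrier[OF h(4)]] norm_mstar[OF h(1,2)] h(3) by simp
    moreover have "cmod (pair G1 (bimult V \<alpha> x \<beta>)) \<le> (cmod (pair F' (bimult V \<alpha> x \<beta>)) + cmod (pair F' (mstar V (bimult V \<alpha> x \<beta>)))) / 2"
      unfolding pG1[OF Mat_bimult[OF h(2,4,5)]] norm_divide
      using norm_triangle_ineq[of "pair F' (bimult V \<alpha> x \<beta>)" "cnj (pair F' (mstar V (bimult V \<alpha> x \<beta>)))"] by simp
    ultimately show ?thesis using b1[OF h] by simp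
  qed
  have cbG1: "cb_norm V G1 \<le> 1" by (rule cb_norm_le(1)[OF G1 _ b2]) simp_all
  define K where "K = G1 + mscale (dual V) (- 1) G"
  have K: "K \<in> Mat (dual V) M" unfolding K_def by (intro D.Mat_add D.Mat_mscale G1 G)
  have "mstar (dual V) G1 = G1"
    unfolding G1_def D.mstar_mscale[OF D.Mat_add[OF F' sF']] D.mstar_add[OF F' sF'] D.mstar_mstar[OF F'] D.mat_add_comm[OF sF' F'] by simp
  moreover have "mstar (dual V) G = G" unfolding G_def by (rule mstar_sa_block[OF F])
  ultimately have saK: "mstar (dual V) K = K"
    unfolding K_def D.mstar_add[OF G1 D.Mat_mscale[OF G]] D.mstar_mscale[OF G] by simp
  have Kc: "K \<in> mcone (dual V) M"
  proof (rule mcone_dualI[OF M K saK])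
    fix c assume c: "c \<in> mcone V M"
    have cM: "c \<in> Mat V M" by (rule cone_Mat[OF M c])
    have z: "0\<^sub>m M 1 \<in> carrier_mat M 1" "0\<^sub>m 1 M \<in> carrier_mat 1 M" by auto
    \<comment> \<open>The trivial factorization of zero, together with the positive element
      \<open>c\<close>, shows that \<open>l\<close> dominates \<open>G\<close> at
      \<open>c\<close>.\<close>
    have "(mscale V (- 1) c, - Re (pair G c)) \<in> dom_cone M G"
    proof (rule dom_coneI[OF Mat_mscale[OF cM] _ z Mat_zero _ c])
      have "mscale V (- 1) c + c = 0\<^sub>m M M" using cM by (intro eq_matI) (auto simp: mscale_index)
      then show "mscale V (- 1) c + c = bimult V (0\<^sub>m M 1) (0\<^sub>m 1 1) (0\<^sub>m 1 M)"
        using bimult_zero_left[OF Mat_zero, of M 1 "0\<^sub>m 1 M"] by simp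
    qed (auto simp: norm_zero hs_sqnorm_def)
    then have "- l c \<le> - Re (pair G c)" using l_le l_neg[OF cM] by metis
    moreover have "Re (pair G1 c) = l c"
      unfolding pG1[OF cM] cone_sa[OF M c] by (simp add: F'l[OF cM])
    moreover have "pair K c = pair G1 c - pair G c"
      unfolding K_def pair_add_left[OF G1 D.Mat_mscale[OF G]] pair_mscale_left[OF G] by simp
    ultimately show "0 \<le> Re (pair K c)" by simp
  qed
  note ax = \<phi>[unfolded positive_contractive_def, folded M_def]
  note add = ax[THEN conjunct1, rule_format]
    and pos = ax[THEN conjunct2, THEN conjunct2, THEN conjunct2, THEN conjunct1, rule_format]
    and le = ax[THEN conjunct2, THEN conjunct2, THEN conjunct2, THEN conjunct2, rule_format]
  have "G + K = G1" unfolding K_def using G G1 by (intro eq_matI) (auto simp: mscale_index)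
  then have "Re (\<phi> G1) = Re (\<phi> G) + Re (\<phi> K)" using add[OF G K] by simp
  moreover have "0 \<le> Re (\<phi> K)" using pos[OF Kc] by (simp add: less_eq_complex_def)
  moreover have "cmod (\<phi> G1) \<le> 1" using le[OF G1] cbG1 by simp
  ultimately have "Re (\<phi> G) \<le> 1" using complex_Re_le_cmod[of "\<phi> G1"] by linarith
  then show ?thesis by (simp add: G_def)
qed

text \<open>The value at a self-adjoint element is real, so the one-sided bound for \<open>F\<close>
  and for \<open>- F\<close> bounds its modulus.\<close>

lemma num_radius_dual_le:
  assumes n: "0 < n" and F: "F \<in> Mat (dual V) n"
    and F1: "\<And>m y \<alpha> \<beta>. 0 < m \<Longrightarrow> y \<in> mcone V m \<Longrightarrow> mnorm V y \<le> 1 \<Longrightarrow> \<alpha> \<in> carrier_mat n m \<Longrightarrow> \<beta> \<in> carrier_mat m n \<Longrightarrow>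
      cmod (pair F (bimult V \<alpha> y \<beta>)) \<le> (hs_sqnorm \<alpha> + hs_sqnorm \<beta>) / 2"
  shows "num_radius (dual V) n F \<le> 1"
  unfolding num_radius_def
proof (rule cSup_least)
  have G: "four_block_mat (0\<^sub>m n n) F (mstar (dual V) F) (0\<^sub>m n n) = sa_block F"
    using F by (simp add: sa_block_def)
  have "positive_contractive (dual V) (2 * n) (\<lambda>_. 0)"
    unfolding positive_contractive_def using n D.norm_nonneg[of "2 * n"] by auto
  then show "{cmod (\<phi> (four_block_mat (0\<^sub>m n n) F (mstar (dual V) F) (0\<^sub>m n n))) |\<phi>. positive_contractive (dual V) (2 * n) \<phi>} \<noteq> {}"
    by blast
  fix y assume "y \<in> {cmod (\<phi> (four_block_mat (0\<^sub>m n n) F (mstar (dual V) F) (0\<^sub>m n n))) |\<phi>. positive_contractive (dual V) (2 * n) \<phi>}"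
  then obtain \<phi> where y: "y = cmod (\<phi> (sa_block F))" and \<phi>: "positive_contractive (dual V) (n + n) \<phi>"
    unfolding G by (auto simp: mult_2)
  note ax = \<phi>[unfolded positive_contractive_def]
  note scale = ax[THEN conjunct2, THEN conjunct1, rule_format]
    and herm = ax[THEN conjunct2, THEN conjunct2, THEN conjunct1, rule_format]
  let ?F = "mscale (dual V) (- 1) F"
  have F': "?F \<in> Mat (dual V) n" by (rule D.Mat_mscale[OF F])
  have "cmod (pair ?F (bimult V \<alpha> y \<beta>)) \<le> (hs_sqnorm \<alpha> + hs_sqnorm \<beta>) / 2"
    if "0 < m" "y \<in> mcone V m" "mnorm V y \<le> 1" "\<alpha> \<in> carrier_mat n m" "\<beta> \<in> carrier_mat m n" for m y \<alpha> \<beta>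
    using F1[OF that] unfolding pair_mscale_left[OF F] by simp
  then have le: "Re (\<phi> (sa_block ?F)) \<le> 1" by (rule sa_block_le[OF n F' _ \<phi>])
  have "sa_block ?F = mscale (dual V) (- 1) (sa_block F)"
  proof (rule eq_matI)
    fix i j assume "i < dim_row (mscale (dual V) (- 1) (sa_block F))" "j < dim_col (mscale (dual V) (- 1) (sa_block F))"
    then have ij: "i < n + n" "j < n + n" using F by (auto simp: sa_block_def)
    then show "sa_block ?F $$ (i, j) = mscale (dual V) (- 1) (sa_block F) $$ (i, j)"
      unfolding sa_block_def D.mstar_mscale[OF F] using F D.Mat_mstar[OF F] by (auto simp: mscale_index simp del: dual_simps)
  qed (use F in \<open>auto simp: sa_block_def\<close>)
  then have "- Re (\<phi> (sa_block F)) \<le> 1" using le scale[OF Mat_sa_block[OF F], of "- 1"] by simp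
  moreover have "Re (\<phi> (sa_block F)) \<le> 1" by (rule sa_block_le[OF n F F1 \<phi>])
  moreover have "Im (\<phi> (sa_block F)) = 0"
    using herm[OF Mat_sa_block[OF F]] unfolding mstar_sa_block[OF F] by (simp add: complex_eq_iff)
  ultimately show "y \<le> 1" unfolding y by (simp add: cmod_def abs_le_iff)
qed

end

section \<open>Factorization cones\<close>

lemma real_space_Times:
  assumes "real_space E1 a1 s1 z1" "real_space E2 a2 s2 z2"
  shows "real_space (E1 \<times> E2) (\<lambda>p q. (a1 (fst p) (fst q), a2 (snd p) (snd q))) (\<lambda>t p. (s1 t (fst p), s2 t (snd p))) (z1, z2)"
proof -
  interpret r1: real_space E1 a1 s1 z1 by fact
  interpret r2: real_space E2 a2 s2 z2 by fact
  show ?thesis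
    by unfold_locales
      (auto intro: r1.add_closed r1.sc_closed r1.zero_closed r1.add_assoc r1.add_comm r1.add_zero r1.sc_add r1.sc_plus r1.sc_sc r1.sc_one r1.sc_zero
        r2.add_closed r2.sc_closed r2.zero_closed r2.add_assoc r2.add_comm r2.add_zero r2.sc_add r2.sc_plus r2.sc_sc r2.sc_one r2.sc_zero)
qed

lemma real_space_carrier_mat:
  "real_space (carrier_mat n n) (+) (\<lambda>t A. complex_of_real t \<cdot>\<^sub>m A) (0\<^sub>m n n)"
proof
  show "complex_of_real (s + t) \<cdot>\<^sub>m x = complex_of_real s \<cdot>\<^sub>m x + complex_of_real t \<cdot>\<^sub>m x" if "x \<in> carrier_mat n n" for s t x
    using that by (intro eq_matI) (auto simp: distrib_right)
  show "complex_of_real s \<cdot>\<^sub>m (complex_of_real t \<cdot>\<^sub>m x) = complex_of_real (s * t) \<cdot>\<^sub>m x" for s t x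
    by (intro eq_matI) auto
  show "complex_of_real 1 \<cdot>\<^sub>m x = x" for x by (intro eq_matI) auto
  show "complex_of_real 0 \<cdot>\<^sub>m x = 0\<^sub>m n n" if "x \<in> carrier_mat n n" for x
    using that by (intro eq_matI) auto
  show "complex_of_real t \<cdot>\<^sub>m (x + y) = complex_of_real t \<cdot>\<^sub>m x + complex_of_real t \<cdot>\<^sub>m y" if "x \<in> carrier_mat n n" "y \<in> carrier_mat n n" for t x y
    using that by (intro eq_matI) (auto simp: distrib_left)
qed (auto intro: comm_add_mat assoc_add_mat)

lemma hform_cscalar:
  assumes A: "A \<in> carrier_mat n n" and x: "x \<in> carrier_vec n"
  shows "hform A x = (A *\<^sub>v x) \<bullet>c x"
proof -
  have "(A *\<^sub>v x) \<bullet>c x = (\<Sum>i<n. (A *\<^sub>v x) $ i * cnj (x $ i))"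
    using A x by (intro cscalar_prod_sum) auto
  also have "\<dots> = (\<Sum>i<n. (\<Sum>j<n. A $$ (i, j) * x $ j) * cnj (x $ i))"
    by (intro sum.cong refl) (simp add: mult_mat_vec_index[OF A x] del: index_mult_mat_vec)
  finally show ?thesis using x by (simp add: hform_def sum_distrib_left sum_distrib_right mult_ac)
qed

text \<open>Dominates an arbitrary scalar matrix by a multiple of the identity in the sense of
  forms, which makes the scalar coordinates of \<open>factor_cone\<close> total.\<close>

lemma Re_hform_le:
  assumes A: "A \<in> carrier_mat n n" and x: "x \<in> carrier_vec n"
  shows "Re (hform A x) \<le> sqrt (hs_sqnorm A) * sqnorm x"
proof -
  have "(cmod (hform A x))\<^sup>2 \<le> sqnorm (A *\<^sub>v x) * sqnorm x"
    unfolding hform_cscalar[OF A x] using A x by (intro cscalar_prod_le[where n=n]) auto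
  also have "\<dots> \<le> (hs_sqnorm A * sqnorm x) * sqnorm x"
    by (intro mult_right_mono sq_boundedD[OF sq_bounded_hs_sqnorm A x]) simp
  also have "\<dots> = (sqrt (hs_sqnorm A) * sqnorm x)\<^sup>2" by (simp add: power_mult_distrib power2_eq_square)
  finally have "cmod (hform A x) \<le> sqrt (hs_sqnorm A) * sqnorm x"
    by (rule power2_le_imp_le) simp
  then show ?thesis using complex_Re_le_cmod order_trans by blast
qed

lemma hform_add:
  "A \<in> carrier_mat n n \<Longrightarrow> B \<in> carrier_mat n n \<Longrightarrow> x \<in> carrier_vec n \<Longrightarrow> hform (A + B) x = hform A x + hform B x"
  by (simp add: hform_def algebra_simps sum.distrib)

lemma hform_smult:
  "A \<in> carrier_mat n n \<Longrightarrow> x \<in> carrier_vec n \<Longrightarrow> hform (c \<cdot>\<^sub>m A) x = c * hform A x"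
  by (simp add: hform_def algebra_simps sum_distrib_left)

text \<open>The perturbation by \<open>e\<close> is what makes the root of the density of \<open>P\<close> invertible.\<close>

lemma positive_functional_root:
  fixes e :: real
  assumes add: "\<And>s t. s \<in> carrier_mat n n \<Longrightarrow> t \<in> carrier_mat n n \<Longrightarrow> P (s + t) = P s + P t"
    and scale: "\<And>c s. s \<in> carrier_mat n n \<Longrightarrow> P (complex_of_real c \<cdot>\<^sub>m s) = c * (P s :: real)"
    and pos: "\<And>v. v \<in> carrier_mat n 1 \<Longrightarrow> 0 \<le> P (v * mat_adjoint v)"
    and e: "0 < e"
  shows "\<exists>R R'. R \<in> carrier_mat n n \<and> R' \<in> carrier_mat n n \<and> R * R' = 1\<^sub>m n \<and> R' * R = 1\<^sub>m n \<and>
    (\<forall>m. \<forall>A\<in>carrier_mat n m. P (A * mat_adjoint A) \<le> hs_sqnorm (R * A)) \<and> hs_sqnorm R = P (1\<^sub>m n) + e * n"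
proof -
  \<comment> \<open>The density of \<open>P\<close>: the functional is the real part of the trace of
    \<open>H\<close> times its argument. The values at \<open>1\<close> and \<open>\<i>\<close> in
    each position recover a complex entry from a real functional.\<close>
  define H where "H = mat n n (\<lambda>(j, i). cnj (Complex (P (single n i j 1)) (P (single n i j \<i>))))"
  have PH: "P s = Re (\<Sum>i<n. \<Sum>j<n. H $$ (j, i) * s $$ (i, j))" if s: "s \<in> carrier_mat n n" for s
  proof -
    have "P (single n i j w) = Re (H $$ (j, i) * w)" if "i < n" "j < n" for i j w
    proof -
      have "single n i j w = complex_of_real (Re w) \<cdot>\<^sub>m single n i j 1 + complex_of_real (Im w) \<cdot>\<^sub>m single n i j \<i>"
        by (intro eq_matI) (auto simp: single_def complex_eq_iff)
      moreover have "single n i j u \<in> carrier_mat n n" for u :: complex by (simp add: single_def)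
      ultimately have "P (single n i j w) = Re w * P (single n i j 1) + Im w * P (single n i j \<i>)"
        by (simp add: add scale)
      then show ?thesis using that by (simp add: H_def)
    qed
    moreover have "P s = (\<Sum>i<n. \<Sum>j<n. P (single n i j (s $$ (i, j))))"
      by (rule additive_mat_sum[where S=UNIV]) (use s add in auto)
    ultimately show ?thesis by (simp add: Re_sum)
  qed
  have PA: "P (A * mat_adjoint A) = (\<Sum>k<m. Re (hform H (col A k)))" if A: "A \<in> carrier_mat n m" for A m
  proof -
    have c: "A * mat_adjoint A \<in> carrier_mat n n" using A by auto
    have "(\<Sum>i<n. \<Sum>j<n. H $$ (j, i) * (A * mat_adjoint A) $$ (i, j)) = (\<Sum>i<n. \<Sum>j<n. \<Sum>k<m. cnj (A $$ (j, k)) * H $$ (j, i) * A $$ (i, k))"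
    proof (intro sum.cong refl)
      fix i j assume "i \<in> {..<n}" "j \<in> {..<n}"
      then have "(A * mat_adjoint A) $$ (i, j) = (\<Sum>k<m. A $$ (i, k) * cnj (A $$ (j, k)))"
        using A by (subst mult_mat_index[OF A adjoint_carrier[OF A]]) auto
      then show "H $$ (j, i) * (A * mat_adjoint A) $$ (i, j) = (\<Sum>k<m. cnj (A $$ (j, k)) * H $$ (j, i) * A $$ (i, k))"
        by (simp add: sum_distrib_left mult_ac del: index_mult_mat(1))
    qed
    also have "\<dots> = (\<Sum>j<n. \<Sum>i<n. \<Sum>k<m. cnj (A $$ (j, k)) * H $$ (j, i) * A $$ (i, k))" by (rule sum.swap)
    also have "\<dots> = (\<Sum>j<n. \<Sum>k<m. \<Sum>i<n. cnj (A $$ (j, k)) * H $$ (j, i) * A $$ (i, k))" by (intro sum.cong refl sum.swap)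
    also have "\<dots> = (\<Sum>k<m. \<Sum>j<n. \<Sum>i<n. cnj (A $$ (j, k)) * H $$ (j, i) * A $$ (i, k))" by (rule sum.swap)
    also have "\<dots> = (\<Sum>k<m. hform H (col A k))"
      using A by (intro sum.cong refl) (simp add: hform_def)
    finally show ?thesis using PH[OF c] by (simp add: Re_sum)
  qed
  have "0 \<le> Re (hform H v)" if v: "v \<in> carrier_vec n" for v
  proof -
    let ?v = "mat n 1 (\<lambda>(i, j). v $ i)"
    have "col ?v 0 = v" using v by (intro eq_vecI) auto
    then show ?thesis using pos[of ?v] PA[of ?v 1] by simp
  qed
  from psd_root[OF this e] obtain R R' where R: "R \<in> carrier_mat n n" "R' \<in> carrier_mat n n" "R * R' = 1\<^sub>m n" "R' * R = 1\<^sub>m n"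
    and vR: "\<And>v. v \<in> carrier_vec n \<Longrightarrow> sqnorm (R *\<^sub>v v) = Re (hform H v) + e * sqnorm v" by blast
  have hsR: "hs_sqnorm (R * A) = P (A * mat_adjoint A) + e * hs_sqnorm A" if A: "A \<in> carrier_mat n m" for A m
  proof -
    have "hs_sqnorm (R * A) = (\<Sum>k<m. sqnorm (R *\<^sub>v col A k))"
      unfolding hs_sqnorm_cols using R A by (simp add: col_mult2[OF R(1) A] del: col_mult)
    also have "\<dots> = (\<Sum>k<m. Re (hform H (col A k)) + e * sqnorm (col A k))"
      using A by (intro sum.cong refl vR) auto
    also have "\<dots> = P (A * mat_adjoint A) + e * hs_sqnorm A"
      unfolding PA[OF A] hs_sqnorm_cols using A by (simp add: sum.distrib sum_distrib_left)
    finally show ?thesis .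
  qed
  have "hs_sqnorm (1\<^sub>m n) = n" using hs_sqnorm_one_smult[of 1 n] by (simp add: hs_sqnorm_smult)
  then have hR: "hs_sqnorm R = P (1\<^sub>m n) + e * n" using hsR[OF one_carrier_mat] R by simp
  have leR: "P (A * mat_adjoint A) \<le> hs_sqnorm (R * A)" if "A \<in> carrier_mat n m" for m A
    using hsR[OF that] e by simp
  show ?thesis by (intro exI conjI allI ballI) (rule R leR hR | assumption)+
qed

section \<open>Almost positive contractions and the cone of their factorizations\<close>

context mo_op_space begin

text \<open>Taking \<open>y = 0\<close> shows that the ball of radius \<open>d\<close> is included.
  Every element is then a multiple of a member, which the positive contractions alone would not
  give.\<close>

definition near_pos :: "real \<Rightarrow> nat \<Rightarrow> 'a mat set" where
  "near_pos d m = {w \<in> Mat V m. \<exists>y\<in>mcone V m. mnorm V y \<le> 1 \<and> mnorm V (w - y) \<le> d}"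

lemma near_pos_cone: "0 < m \<Longrightarrow> 0 \<le> d \<Longrightarrow> y \<in> mcone V m \<Longrightarrow> mnorm V y \<le> 1 \<Longrightarrow> y \<in> near_pos d m"
proof -
  assume h: "0 < m" "0 \<le> d" "y \<in> mcone V m" "mnorm V y \<le> 1"
  have "y - y = 0\<^sub>m m m" using cone_Mat[OF h(1,3)] by (intro eq_matI) auto
  then show ?thesis using h norm_zero[OF h(1)] cone_Mat[OF h(1,3)] unfolding near_pos_def by (auto intro!: bexI[of _ y])
qed

lemma near_pos_ball: "0 < m \<Longrightarrow> w \<in> Mat V m \<Longrightarrow> mnorm V w \<le> d \<Longrightarrow> w \<in> near_pos d m"
proof -
  assume h: "0 < m" "w \<in> Mat V m" "mnorm V w \<le> d"
  have "w - 0\<^sub>m m m = w" using h(2) by (intro eq_matI) auto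
  then show ?thesis using h norm_zero[OF h(1)] cone_zero[OF h(1)] unfolding near_pos_def by (auto intro!: bexI[of _ "0\<^sub>m m m"])
qed

lemma near_pos_four_block:
  assumes m: "0 < m" "0 < m'" and w: "w \<in> near_pos d m" "w' \<in> near_pos d m'"
  shows "four_block_mat w (0\<^sub>m m m') (0\<^sub>m m' m) w' \<in> near_pos d (m + m')"
proof -
  obtain y y' where y: "w \<in> Mat V m" "y \<in> mcone V m" "mnorm V y \<le> 1" "mnorm V (w - y) \<le> d"
    and y': "w' \<in> Mat V m'" "y' \<in> mcone V m'" "mnorm V y' \<le> 1" "mnorm V (w' - y') \<le> d"
    using w unfolding near_pos_def by blast
  have yM: "y \<in> Mat V m" "y' \<in> Mat V m'" using cone_Mat m y(2) y'(2) by blast+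
  let ?F = "\<lambda>a b. four_block_mat a (0\<^sub>m m m') (0\<^sub>m m' m) b"
  have mm: "0 < m + m'" using m by simp
  have "?F y y' \<in> mcone V (m + m')"
    unfolding four_block_bimult[OF yM] using m mm y(2) y'(2) by (intro cone_add cone_bimult) auto
  moreover have "mnorm V (?F y y') \<le> 1" using norm_four_block[OF m yM] y(3) y'(3) by simp
  moreover have "?F w w' - ?F y y' = ?F (w - y) (w' - y')"
    using y(1) y'(1) yM by (intro eq_matI) auto
  moreover have "mnorm V (?F (w - y) (w' - y')) \<le> d"
    using norm_four_block[OF m Mat_minus[OF y(1) yM(1)] Mat_minus[OF y'(1) yM(2)]] y(4) y'(4) by simp
  moreover have "?F w w' \<in> Mat V (m + m')" by (rule Mat_four_block[OF y(1) y'(1)])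
  ultimately show ?thesis unfolding near_pos_def by auto
qed

text \<open>The linear minorants of this cone are the triples \<open>(P, Q, -f)\<close> with
  \<open>f(\<alpha> w \<beta>) \<le> P(\<alpha> \<alpha>\<^sup>*) + Q(\<beta>\<^sup>* \<beta>)\<close> for \<open>w\<close> in \<open>near_pos\<close>, \<open>P(1), Q(1) \<le> 1\<close> and \<open>f(x0) \<ge> 2C\<close>.
  It is an epigraph unless \<open>x0\<close> itself has a factorization \<open>\<alpha> w \<beta>\<close> with \<open>\<parallel>\<alpha>\<parallel>\<^sup>2, \<parallel>\<beta>\<parallel>\<^sup>2 \<le> C\<close>.\<close>

definition factor_cone :: "real \<Rightarrow> real \<Rightarrow> nat \<Rightarrow> 'a mat \<Rightarrow> ((complex mat \<times> complex mat \<times> 'a mat) \<times> real) set" where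
  "factor_cone d C n x0 = {((s, u, x), a). s \<in> carrier_mat n n \<and> u \<in> carrier_mat n n \<and> x \<in> Mat V n \<and>
     (\<exists>m \<alpha> \<beta> w a1 a2 r. 0 < m \<and> \<alpha> \<in> carrier_mat n m \<and> \<beta> \<in> carrier_mat m n \<and> w \<in> near_pos d m \<and> 0 \<le> r \<and>
       x + bimult V \<alpha> w \<beta> = mscale V (complex_of_real r) x0 \<and>
       (\<forall>v\<in>carrier_vec n. Re (hform s v) + sqnorm (mat_adjoint \<alpha> *\<^sub>v v) \<le> a1 * sqnorm v) \<and>
       (\<forall>v\<in>carrier_vec n. Re (hform u v) + sqnorm (\<beta> *\<^sub>v v) \<le> a2 * sqnorm v) \<and> a1 + a2 - 2 * r * C \<le> a)}"

lemma factor_coneI: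
  assumes "s \<in> carrier_mat n n" "u \<in> carrier_mat n n" "x \<in> Mat V n"
    "0 < m" "\<alpha> \<in> carrier_mat n m" "\<beta> \<in> carrier_mat m n" "w \<in> near_pos d m" "0 \<le> r"
    "x + bimult V \<alpha> w \<beta> = mscale V (complex_of_real r) x0"
    "\<And>v. v \<in> carrier_vec n \<Longrightarrow> Re (hform s v) + sqnorm (mat_adjoint \<alpha> *\<^sub>v v) \<le> b * sqnorm v"
    "\<And>v. v \<in> carrier_vec n \<Longrightarrow> Re (hform u v) + sqnorm (\<beta> *\<^sub>v v) \<le> c * sqnorm v" "b + c - 2 * r * C \<le> a"
  shows "((s, u, x), a) \<in> factor_cone d C n x0"
  using assms unfolding factor_cone_def by blast

lemma factor_coneE:
  assumes "(p, a) \<in> factor_cone d C n x0"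
  obtains s u x m \<alpha> \<beta> w a1 a2 r where "p = (s, u, x)" "s \<in> carrier_mat n n" "u \<in> carrier_mat n n" "x \<in> Mat V n" "0 < m"
    "\<alpha> \<in> carrier_mat n m" "\<beta> \<in> carrier_mat m n" "w \<in> near_pos d m" "0 \<le> r"
    "x + bimult V \<alpha> w \<beta> = mscale V (complex_of_real r) x0"
    "\<forall>v\<in>carrier_vec n. Re (hform s v) + sqnorm (mat_adjoint \<alpha> *\<^sub>v v) \<le> a1 * sqnorm v"
    "\<forall>v\<in>carrier_vec n. Re (hform u v) + sqnorm (\<beta> *\<^sub>v v) \<le> a2 * sqnorm v" "a1 + a2 - 2 * r * C \<le> a"
proof -
  obtain s u x where p: "p = (s, u, x)" by (cases p) auto
  show thesis
    using assms unfolding p factor_cone_def mem_Collect_eq prod.case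
    by (elim conjE exE) (rule that[OF p]; assumption)
qed

text \<open>A negative value over zero is a factorization of \<open>r x0\<close> with squared norms
  \<open>a1\<close>, \<open>a2\<close> and \<open>a1 + a2 < 2 r C\<close>. Since the geometric mean
  is at most the arithmetic mean, rescaling the two factors turns it into a factorization of
  \<open>x0\<close> with both squared norms at most \<open>C\<close>, which \<open>no\<close>
  excludes.\<close>

lemma epi_cone_factor_cone:
  assumes n: "0 < n" and x0: "x0 \<in> Mat V n" and C: "0 < C" and d: "0 < d"
    and no: "\<And>m \<alpha> \<beta> w. 0 < m \<Longrightarrow> \<alpha> \<in> carrier_mat n m \<Longrightarrow> \<beta> \<in> carrier_mat m n \<Longrightarrow> w \<in> near_pos d m \<Longrightarrow> 
      sq_bounded C (mat_adjoint \<alpha>) \<Longrightarrow> sq_bounded C \<beta> \<Longrightarrow> x0 = bimult V \<alpha> w \<beta> \<Longrightarrow> False"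
  shows "real_space.epi_cone (carrier_mat n n \<times> carrier_mat n n \<times> Mat V n)
      (\<lambda>p q. (fst p + fst q, fst (snd p) + fst (snd q), snd (snd p) + snd (snd q)))
      (\<lambda>t p. (complex_of_real t \<cdot>\<^sub>m fst p, complex_of_real t \<cdot>\<^sub>m fst (snd p), mscale V (complex_of_real t) (snd (snd p))))
      (0\<^sub>m n n, 0\<^sub>m n n, 0\<^sub>m n n) (factor_cone d C n x0)"
proof -
  interpret rs: real_space "carrier_mat n n \<times> carrier_mat n n \<times> Mat V n"
      "\<lambda>p q. (fst p + fst q, fst (snd p) + fst (snd q), snd (snd p) + snd (snd q))"
      "\<lambda>t p. (complex_of_real t \<cdot>\<^sub>m fst p, complex_of_real t \<cdot>\<^sub>m fst (snd p), mscale V (complex_of_real t) (snd (snd p)))"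
      "(0\<^sub>m n n, 0\<^sub>m n n, 0\<^sub>m n n)"
    using real_space_Times[OF real_space_carrier_mat real_space_Times[OF real_space_carrier_mat real_space_Mat]] by simp
  show ?thesis
    unfolding rs.epi_cone_def
  proof (intro conjI allI impI)
    show "factor_cone d C n x0 \<subseteq> (carrier_mat n n \<times> carrier_mat n n \<times> Mat V n) \<times> UNIV"
      unfolding factor_cone_def by blast
  next
    fix p a p' a' assume pa: "(p, a) \<in> factor_cone d C n x0" and pa': "(p', a') \<in> factor_cone d C n x0"
    obtain s u x m \<alpha> \<beta> w a1 a2 r where
      h: "p = (s, u, x)" "s \<in> carrier_mat n n" "u \<in> carrier_mat n n" "x \<in> Mat V n" "0 < m" "\<alpha> \<in> carrier_mat n m" "\<beta> \<in> carrier_mat m n" "w \<in> near_pos d m" "0 \<le> r"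
        "x + bimult V \<alpha> w \<beta> = mscale V (complex_of_real r) x0"
        "\<forall>v\<in>carrier_vec n. Re (hform s v) + sqnorm (mat_adjoint \<alpha> *\<^sub>v v) \<le> a1 * sqnorm v"
        "\<forall>v\<in>carrier_vec n. Re (hform u v) + sqnorm (\<beta> *\<^sub>v v) \<le> a2 * sqnorm v" "a1 + a2 - 2 * r * C \<le> a"
      by (rule factor_coneE[OF pa])
    obtain s' u' x' m' \<alpha>' \<beta>' w' a1' a2' r' where
      h': "p' = (s', u', x')" "s' \<in> carrier_mat n n" "u' \<in> carrier_mat n n" "x' \<in> Mat V n" "0 < m'" "\<alpha>' \<in> carrier_mat n m'" "\<beta>' \<in> carrier_mat m' n" "w' \<in> near_pos d m'" "0 \<le> r'"
        "x' + bimult V \<alpha>' w' \<beta>' = mscale V (complex_of_real r') x0"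
        "\<forall>v\<in>carrier_vec n. Re (hform s' v) + sqnorm (mat_adjoint \<alpha>' *\<^sub>v v) \<le> a1' * sqnorm v"
        "\<forall>v\<in>carrier_vec n. Re (hform u' v) + sqnorm (\<beta>' *\<^sub>v v) \<le> a2' * sqnorm v" "a1' + a2' - 2 * r' * C \<le> a'"
      by (rule factor_coneE[OF pa'])
    have wM: "w \<in> Mat V m" "w' \<in> Mat V m'" using h(8) h'(8) by (auto simp: near_pos_def)
    let ?a = "mat_adjoint (inj1 m m' * mat_adjoint \<alpha> + inj2 m m' * mat_adjoint \<alpha>')" and ?b = "inj1 m m' * \<beta> + inj2 m m' * \<beta>'"
    let ?w = "four_block_mat w (0\<^sub>m m m') (0\<^sub>m m' m) w'"
    have ad: "mat_adjoint \<alpha> \<in> carrier_mat m n" "mat_adjoint \<alpha>' \<in> carrier_mat m' n" using h(6) h'(6) by auto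
    have "((s + s', u + u', x + x'), a + a') \<in> factor_cone d C n x0"
    proof (rule factor_coneI)
      show "s + s' \<in> carrier_mat n n" "u + u' \<in> carrier_mat n n" using h(2,3) h'(2,3) by auto
      show "x + x' \<in> Mat V n" by (rule Mat_add[OF h(4) h'(4)])
      show "0 < m + m'" using h(5) by simp
      show "?a \<in> carrier_mat n (m + m')" by (rule adjoint_carrier, rule add_carrier_mat, rule mult_carrier_mat[OF inj_carrier(2) ad(2)])
      show "?b \<in> carrier_mat (m + m') n" by (rule add_carrier_mat, rule mult_carrier_mat[OF inj_carrier(2) h'(7)])
      show "?w \<in> near_pos d (m + m')" by (rule near_pos_four_block[OF h(5) h'(5) h(8) h'(8)])
      show "0 \<le> r + r'" using h(9) h'(9) by simp
      have "x + x' + (bimult V \<alpha> w \<beta> + bimult V \<alpha>' w' \<beta>') = (x + bimult V \<alpha> w \<beta>) + (x' + bimult V \<alpha>' w' \<beta>')"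
        by (rule mat_add_swap[OF h(4) h'(4) Mat_bimult[OF wM(1) h(6,7)] Mat_bimult[OF wM(2) h'(6,7)]])
      then show "x + x' + bimult V ?a ?w ?b = mscale V (complex_of_real (r + r')) x0"
        unfolding bimult_direct_sum[OF wM h(6,7) h'(6,7)] h(10) h'(10) by (simp add: mscale_add_left[OF x0])
      show "Re (hform (s + s') v) + sqnorm (mat_adjoint ?a *\<^sub>v v) \<le> (a1 + a1') * sqnorm v" if v: "v \<in> carrier_vec n" for v
        unfolding adjoint_adjoint sqnorm_inj_sum[OF ad v] hform_add[OF h(2) h'(2) v]
        using bspec[OF h(11) v] bspec[OF h'(11) v] by (simp add: distrib_right)
      show "Re (hform (u + u') v) + sqnorm (?b *\<^sub>v v) \<le> (a2 + a2') * sqnorm v" if v: "v \<in> carrier_vec n" for v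
        unfolding sqnorm_inj_sum[OF h(7) h'(7) v] hform_add[OF h(3) h'(3) v]
        using bspec[OF h(12) v] bspec[OF h'(12) v] by (simp add: distrib_right)
      show "(a1 + a1') + (a2 + a2') - 2 * (r + r') * C \<le> a + a'" using h(13) h'(13) by (simp add: algebra_simps)
    qed
    then show "((fst p + fst p', fst (snd p) + fst (snd p'), snd (snd p) + snd (snd p')), a + a') \<in> factor_cone d C n x0"
      unfolding h(1) h'(1) by simp
  next
    fix p a t assume pa: "(p, a) \<in> factor_cone d C n x0" and t: "0 \<le> (t::real)"
    obtain s u x m \<alpha> \<beta> w a1 a2 r where
      h: "p = (s, u, x)" "s \<in> carrier_mat n n" "u \<in> carrier_mat n n" "x \<in> Mat V n" "0 < m" "\<alpha> \<in> carrier_mat n m" "\<beta> \<in> carrier_mat m n" "w \<in> near_pos d m" "0 \<le> r"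
        "x + bimult V \<alpha> w \<beta> = mscale V (complex_of_real r) x0"
        "\<forall>v\<in>carrier_vec n. Re (hform s v) + sqnorm (mat_adjoint \<alpha> *\<^sub>v v) \<le> a1 * sqnorm v"
        "\<forall>v\<in>carrier_vec n. Re (hform u v) + sqnorm (\<beta> *\<^sub>v v) \<le> a2 * sqnorm v" "a1 + a2 - 2 * r * C \<le> a"
      by (rule factor_coneE[OF pa])
    have wM: "w \<in> Mat V m" using h(8) by (auto simp: near_pos_def)
    let ?s = "complex_of_real (sqrt t)" and ?t = "complex_of_real t"
    have sq: "?s * ?s = ?t" "(cmod ?s)\<^sup>2 = t" "cnj ?s = ?s" using t by (simp_all flip: of_real_mult)
    have "((?t \<cdot>\<^sub>m s, ?t \<cdot>\<^sub>m u, mscale V ?t x), t * a) \<in> factor_cone d C n x0"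
    proof (rule factor_coneI)
      show "?t \<cdot>\<^sub>m s \<in> carrier_mat n n" "?t \<cdot>\<^sub>m u \<in> carrier_mat n n" using h(2,3) by auto
      show "mscale V ?t x \<in> Mat V n" by (rule Mat_mscale[OF h(4)])
      show "?s \<cdot>\<^sub>m \<alpha> \<in> carrier_mat n m" "?s \<cdot>\<^sub>m \<beta> \<in> carrier_mat m n" using h(6,7) by auto
      show "0 \<le> t * r" using t h(9) by simp
      have "bimult V (?s \<cdot>\<^sub>m \<alpha>) w (?s \<cdot>\<^sub>m \<beta>) = mscale V (?s * ?s) (bimult V \<alpha> w \<beta>)"
        unfolding bimult_smult_left[OF wM h(6)] bimult_smult_right[OF wM h(7)] mscale_mscale ..
      then show "mscale V ?t x + bimult V (?s \<cdot>\<^sub>m \<alpha>) w (?s \<cdot>\<^sub>m \<beta>) = mscale V (complex_of_real (t * r)) x0"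
        unfolding sq using mscale_add[OF h(4) Mat_bimult[OF wM h(6,7)], of ?t] unfolding h(10) by simp
      show "Re (hform (?t \<cdot>\<^sub>m s) v) + sqnorm (mat_adjoint (?s \<cdot>\<^sub>m \<alpha>) *\<^sub>v v) \<le> (t * a1) * sqnorm v" if v: "v \<in> carrier_vec n" for v
        unfolding adjoint_smult sq(3) smult_mat_vec[OF adjoint_carrier[OF h(6)] v] sqnorm_smult sq(2) hform_smult[OF h(2) v]
        using mult_left_mono[OF bspec[OF h(11) v] t] by (simp add: algebra_simps)
      show "Re (hform (?t \<cdot>\<^sub>m u) v) + sqnorm ((?s \<cdot>\<^sub>m \<beta>) *\<^sub>v v) \<le> (t * a2) * sqnorm v" if v: "v \<in> carrier_vec n" for v
        unfolding smult_mat_vec[OF h(7) v] sqnorm_smult sq(2) hform_smult[OF h(3) v]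
        using mult_left_mono[OF bspec[OF h(12) v] t] by (simp add: algebra_simps)
      show "t * a1 + t * a2 - 2 * (t * r) * C \<le> t * a" using mult_left_mono[OF h(13) t] by (simp add: algebra_simps)
    qed (rule h(5) h(8))+
    then show "((?t \<cdot>\<^sub>m fst p, ?t \<cdot>\<^sub>m fst (snd p), mscale V ?t (snd (snd p))), t * a) \<in> factor_cone d C n x0"
      unfolding h(1) by simp
  next
    fix a assume z: "((0\<^sub>m n n, 0\<^sub>m n n, 0\<^sub>m n n), a) \<in> factor_cone d C n x0"
    obtain s u x m \<alpha> \<beta> w a1 a2 r where
      g: "(0\<^sub>m n n, 0\<^sub>m n n, 0\<^sub>m n n) = (s, u, x)" "s \<in> carrier_mat n n" "u \<in> carrier_mat n n" "x \<in> Mat V n"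
      and h: "0 < m" "\<alpha> \<in> carrier_mat n m" "\<beta> \<in> carrier_mat m n" "w \<in> near_pos d m" "0 \<le> r"
        "x + bimult V \<alpha> w \<beta> = mscale V (complex_of_real r) x0"
        "\<forall>v\<in>carrier_vec n. Re (hform s v) + sqnorm (mat_adjoint \<alpha> *\<^sub>v v) \<le> a1 * sqnorm v"
        "\<forall>v\<in>carrier_vec n. Re (hform u v) + sqnorm (\<beta> *\<^sub>v v) \<le> a2 * sqnorm v" "a1 + a2 - 2 * r * C \<le> a"
      by (rule factor_coneE[OF z])
    have g': "s = 0\<^sub>m n n" "u = 0\<^sub>m n n" "x = 0\<^sub>m n n" using g(1)[symmetric] by simp_all
    note h = h[unfolded g']
    have wM: "w \<in> Mat V m" using h(4) by (auto simp: near_pos_def)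
    have h0: "hform (0\<^sub>m n n) v = 0" if "v \<in> carrier_vec n" for v using that by (simp add: hform_def)
    have b: "sq_bounded a1 (mat_adjoint \<alpha>)" "sq_bounded a2 \<beta>" using h(2,3,7,8) h0 by (auto simp: sq_bounded_def)
    have "sqnorm (mat_adjoint \<alpha> *\<^sub>v unit_vec n 0) \<le> a1" "sqnorm (\<beta> *\<^sub>v unit_vec n 0) \<le> a2"
      using bspec[OF h(7), of "unit_vec n 0"] bspec[OF h(8), of "unit_vec n 0"] h0[of "unit_vec n 0"] sqnorm_unit_vec[OF n] by simp_all
    then have a12: "0 \<le> a1" "0 \<le> a2" by (auto intro: order_trans[OF sqnorm_nonneg])
    have xr: "bimult V \<alpha> w \<beta> = mscale V (complex_of_real r) x0"
      using h(6) Mat_add_zero(2)[OF Mat_bimult[OF wM h(2,3)]] by simp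
    show "0 \<le> a"
    proof (rule ccontr)
      assume "\<not> 0 \<le> a"
      then have lt: "a1 + a2 < 2 * r * C" using h(9) by linarith
      have r: "0 < r"
      proof (rule ccontr)
        assume "\<not> 0 < r"
        then have "r = 0" using h(5) by simp
        then show False using lt a12 by simp
      qed
      define e where "e = 2 * r * C"
      \<comment> \<open>Half of the available slack is given to \<open>a1\<close>, so that
        \<open>b1\<close> is positive even when \<open>a1\<close> vanishes.\<close>
      define f where "f = (e - a1 - a2) / 2"
      define b1 where "b1 = a1 + f"
      have lt': "a1 + a2 < e" using lt by (simp add: e_def)
      have f: "2 * f = e - a1 - a2" unfolding f_def by simp
      have "0 < f" using f lt' by linarith
      then have b1: "0 < b1" "a1 \<le> b1" "b1 + a2 < e" unfolding b1_def using a12 f by linarith+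
      \<comment> \<open>Chosen so that the left factor has squared norm at most \<open>C\<close>;
        the reciprocal on the right then leaves \<open>b1 * a2 / (C * r\<^sup>2)\<close>, which is
        at most \<open>C\<close>.\<close>
      define k where "k = sqrt (C / b1)"
      have k: "0 < k" "k\<^sup>2 = C / b1" using C b1 by (simp_all add: k_def)
      let ?k = "complex_of_real k" and ?l = "complex_of_real (1 / (k * r))"
      have kl: "?l * (?k * complex_of_real r) = 1" using k r by (simp flip: of_real_mult)
      have "x0 = bimult V (?k \<cdot>\<^sub>m \<alpha>) w (?l \<cdot>\<^sub>m \<beta>)"
        unfolding bimult_smult_left[OF wM h(2)] bimult_smult_right[OF wM h(3)] mscale_mscale xr kl mscale_one ..
      moreover have "sq_bounded C (mat_adjoint (?k \<cdot>\<^sub>m \<alpha>))"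
      proof -
        have "sq_bounded ((cmod ?k)\<^sup>2 * b1) (?k \<cdot>\<^sub>m mat_adjoint \<alpha>)" by (rule sq_bounded_smult[OF sq_bounded_mono[OF b(1) b1(2)]])
        moreover have "(cmod ?k)\<^sup>2 * b1 = C" unfolding norm_of_real power2_abs k(2) using b1(1) by simp
        ultimately show ?thesis unfolding adjoint_smult complex_cnj_complex_of_real by simp
      qed
      moreover have "sq_bounded C (?l \<cdot>\<^sub>m \<beta>)"
      proof (rule sq_bounded_mono[OF sq_bounded_smult[OF b(2)]])
        have "4 * (b1 * a2) \<le> (b1 + a2)\<^sup>2" using zero_le_power2[of "b1 - a2"] by (simp add: power2_eq_square algebra_simps)
        also have "\<dots> \<le> e\<^sup>2" using b1 a12 by (intro power_mono) auto
        finally have le: "b1 * a2 \<le> (r * C)\<^sup>2" by (simp add: power2_eq_square e_def)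
        have "(cmod ?l)\<^sup>2 * a2 = (b1 * a2) / (C * r\<^sup>2)"
          unfolding norm_of_real power2_abs power_divide power_mult_distrib k(2) using b1 C r by (simp add: field_simps)
        also have "\<dots> \<le> (r * C)\<^sup>2 / (C * r\<^sup>2)" using le C r by (intro divide_right_mono) auto
        also have "\<dots> = C" using C r by (simp add: power2_eq_square)
        finally show "(cmod ?l)\<^sup>2 * a2 \<le> C" .
      qed
      ultimately show False using no[OF h(1) _ _ h(4), of "?k \<cdot>\<^sub>m \<alpha>" "?l \<cdot>\<^sub>m \<beta>"] h(2,3) by simp
    qed
  qed
qed

text \<open>With \<open>r = 0\<close>, the coordinate \<open>x\<close> is cancelled by a multiple of
  an element of the ball inside \<open>near_pos\<close>.\<close>

lemma factor_cone_total:
  assumes n: "0 < n" and x0: "x0 \<in> Mat V n" and d: "0 < d"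
    and s: "s \<in> carrier_mat n n" and u: "u \<in> carrier_mat n n" and x: "x \<in> Mat V n"
  shows "\<exists>a. ((s, u, x), a) \<in> factor_cone d C n x0"
proof -
  \<comment> \<open>The summand 1 keeps \<open>t\<close> positive when \<open>x\<close>
    vanishes.\<close>
  define t where "t = mnorm V x / d + 1"
  have t: "0 < t" "mnorm V x \<le> t * d" using norm_nonneg[OF n x] d by (auto simp: t_def field_simps intro: add_nonneg_pos)
  let ?s = "complex_of_real (sqrt t)" and ?w = "mscale V (complex_of_real (- 1 / t)) x"
  have sq: "?s * ?s = complex_of_real t" "(cmod ?s)\<^sup>2 = t" "cnj ?s = ?s" using t by (simp_all flip: of_real_mult)
  have w: "?w \<in> Mat V n" by (rule Mat_mscale[OF x])
  have nw: "mnorm V ?w \<le> d"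
    unfolding norm_mscale[OF n x] norm_of_real using t by (simp add: divide_simps mult.commute)
  have e: "bimult V (?s \<cdot>\<^sub>m 1\<^sub>m n) ?w (?s \<cdot>\<^sub>m 1\<^sub>m n) = mscale V (- 1) x"
    unfolding bimult_scalar[OF w] sq mscale_mscale using t by (simp flip: of_real_mult)
  have v1: "sqnorm ((?s \<cdot>\<^sub>m 1\<^sub>m n) *\<^sub>v v) = t * sqnorm v" if "v \<in> carrier_vec n" for v
    unfolding smult_mat_vec[OF one_carrier_mat that] sqnorm_smult sq using that by simp
  have "((s, u, x), (sqrt (hs_sqnorm s) + t) + (sqrt (hs_sqnorm u) + t) - 2 * 0 * C) \<in> factor_cone d C n x0"
  proof (rule factor_coneI[OF s u x n _ _ near_pos_ball[OF n w nw]])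
    have "x + mscale V (- 1) x = 0\<^sub>m n n" using x by (intro eq_matI) (auto simp: mscale_index)
    then show "x + bimult V (?s \<cdot>\<^sub>m 1\<^sub>m n) ?w (?s \<cdot>\<^sub>m 1\<^sub>m n) = mscale V (complex_of_real 0) x0"
      unfolding e using mscale_zero[OF x0] by simp
    show "Re (hform s v) + sqnorm (mat_adjoint (?s \<cdot>\<^sub>m 1\<^sub>m n) *\<^sub>v v) \<le> (sqrt (hs_sqnorm s) + t) * sqnorm v" if v: "v \<in> carrier_vec n" for v
      unfolding adjoint_smult sq(3) adjoint_one v1[OF v] using Re_hform_le[OF s v] by (simp add: distrib_right)
    show "Re (hform u v) + sqnorm ((?s \<cdot>\<^sub>m 1\<^sub>m n) *\<^sub>v v) \<le> (sqrt (hs_sqnorm u) + t) * sqnorm v" if v: "v \<in> carrier_vec n" for v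
      unfolding v1[OF v] using Re_hform_le[OF u v] by (simp add: distrib_right)
  qed auto
  then show ?thesis by blast
qed

end

section \<open>Factorization through almost positive elements\<close>

context star_space begin

lemma mscale_minus: "x \<in> Mat V n \<Longrightarrow> y \<in> Mat V n \<Longrightarrow> mscale V c (x - y) = mscale V c x - mscale V c y"
  by (intro eq_matI) (auto simp: mscale_index vs.scale_right_diff_distrib)

lemma blk_mscale: "z \<in> Mat V (n + n) \<Longrightarrow> blk n p q (mscale V c z) = mscale V c (blk n p q z)"
  unfolding blk_def by (rule bimult_mscale)

lemma mat_add_neg: "x \<in> Mat V n \<Longrightarrow> mscale V (- 1) x + x = 0\<^sub>m n n"
  by (intro eq_matI) (auto simp: mscale_index)

end

context dual_mo_op_space begin

text \<open>If no factorization exists, separation gives densities and a functional that is large at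
  \<open>x0\<close>. Roots of the densities normalize the functional so that
  \<open>num_radius_dual_le\<close> applies; then \<open>nr\<close> bounds its cb-norm, and the
  value at \<open>x0\<close> is too large for that bound.\<close>

lemma near_pos_factorization:
  assumes n: "0 < n" and x0: "x0 \<in> Mat V n" "mnorm V x0 \<le> 1" and k: "0 < k" and d: "0 < d"
    and nr: "\<And>F. F \<in> Mat (dual V) n \<Longrightarrow> cb_norm V F \<le> k * num_radius (dual V) n F"
  shows "\<exists>m \<alpha> \<beta> w. 0 < m \<and> \<alpha> \<in> carrier_mat n m \<and> \<beta> \<in> carrier_mat m n \<and> w \<in> near_pos d m \<and>
    sq_bounded (2 * k) (mat_adjoint \<alpha>) \<and> sq_bounded (2 * k) \<beta> \<and> x0 = bimult V \<alpha> w \<beta>"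
proof (rule ccontr)
  assume no: "\<not> ?thesis"
  let ?E = "carrier_mat n n \<times> carrier_mat n n \<times> Mat V n"
  interpret rs: real_space ?E
      "\<lambda>p q. (fst p + fst q, fst (snd p) + fst (snd q), snd (snd p) + snd (snd q))"
      "\<lambda>t p. (complex_of_real t \<cdot>\<^sub>m fst p, complex_of_real t \<cdot>\<^sub>m fst (snd p), mscale V (complex_of_real t) (snd (snd p)))"
      "(0\<^sub>m n n, 0\<^sub>m n n, 0\<^sub>m n n)"
    using real_space_Times[OF real_space_carrier_mat real_space_Times[OF real_space_carrier_mat real_space_Mat]] by simp
  let ?G = "factor_cone d (2 * k) n x0"
  have ep: "rs.epi_cone ?G"
    by (rule epi_cone_factor_cone[OF n x0(1) _ d]) (use k no in \<open>simp, blast\<close>)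
  have tot: "\<exists>a. (p, a) \<in> ?G" if "p \<in> ?E" for p
    using that factor_cone_total[OF n x0(1) d] by (cases p) auto
  obtain l where l0: "\<And>p q. p \<in> ?E \<Longrightarrow> q \<in> ?E \<Longrightarrow> l (fst p + fst q, fst (snd p) + fst (snd q), snd (snd p) + snd (snd q)) = l p + l q"
      "\<And>t p. p \<in> ?E \<Longrightarrow> l (complex_of_real t \<cdot>\<^sub>m fst p, complex_of_real t \<cdot>\<^sub>m fst (snd p), mscale V (complex_of_real t) (snd (snd p))) = t * l p"
    and l_le: "\<And>p a. (p, a) \<in> ?G \<Longrightarrow> l p \<le> a"
    by (rule rs.epi_cone_linear_minorant[OF ep tot]) blast+
  let ?z = "0\<^sub>m n n :: complex mat" and ?o = "0\<^sub>m n n :: 'a mat"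
  \<comment> \<open>The minorant is split along the three coordinates. The sign of \<open>f\<close>
    reflects that a factorization enters the cone on the same side as \<open>x\<close>.\<close>
  define P where "P s = l (s, ?z, ?o)" for s
  define Q where "Q u = l (?z, u, ?o)" for u
  define f where "f x = - l (?z, ?z, x)" for x
  have oM: "?o \<in> Mat V n" by (rule Mat_zero)
  have oo: "?o + ?o = ?o" "mscale V c ?o = ?o" for c by (auto intro!: eq_matI simp: mscale_index)
  have zz: "?z + ?z = ?z" "c \<cdot>\<^sub>m ?z = ?z" for c by auto
  have Padd: "P (s + t) = P s + P t" if "s \<in> carrier_mat n n" "t \<in> carrier_mat n n" for s t
    unfolding P_def using l0(1)[of "(s, ?z, ?o)" "(t, ?z, ?o)"] that oM by (simp add: oo zz)
  have Pscale: "P (complex_of_real c \<cdot>\<^sub>m s) = c * P s" if "s \<in> carrier_mat n n" for c s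
    unfolding P_def using l0(2)[of "(s, ?z, ?o)" c] that oM by (simp add: oo zz)
  have Qadd: "Q (s + t) = Q s + Q t" if "s \<in> carrier_mat n n" "t \<in> carrier_mat n n" for s t
    unfolding Q_def using l0(1)[of "(?z, s, ?o)" "(?z, t, ?o)"] that oM by (simp add: oo zz)
  have Qscale: "Q (complex_of_real c \<cdot>\<^sub>m s) = c * Q s" if "s \<in> carrier_mat n n" for c s
    unfolding Q_def using l0(2)[of "(?z, s, ?o)" c] that oM by (simp add: oo zz)
  have fadd: "f (x + y) = f x + f y" if "x \<in> Mat V n" "y \<in> Mat V n" for x y
    unfolding f_def using l0(1)[of "(?z, ?z, x)" "(?z, ?z, y)"] that by (simp add: zz)
  have fscale: "f (mscale V (complex_of_real c) x) = c * f x" if "x \<in> Mat V n" for c x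
    unfolding f_def using l0(2)[of "(?z, ?z, x)" c] that by (simp add: zz)
  have lsum: "l (s, u, x) = P s + Q u - f x" if "s \<in> carrier_mat n n" "u \<in> carrier_mat n n" "x \<in> Mat V n" for s u x
  proof -
    have "l (s, u, ?o) = P s + Q u"
      unfolding P_def Q_def using l0(1)[of "(s, ?z, ?o)" "(?z, u, ?o)"] that oM by (simp add: oo)
    then show ?thesis
      unfolding f_def using l0(1)[of "(s, u, ?o)" "(?z, ?z, x)"] that oM by (simp add: Mat_add_zero)
  qed
  have n0: "?o \<in> near_pos d n" by (rule near_pos_cone[OF n _ cone_zero[OF n]]) (use d norm_zero[OF n] in auto)
  have b0: "bimult V \<alpha> ?o \<beta> = ?o" if "\<alpha> \<in> carrier_mat n n" "\<beta> \<in> carrier_mat n n" for \<alpha> \<beta>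
    using bimult_mscale[OF oM, of \<alpha> 0 \<beta>] mscale_zero[OF Mat_bimult[OF oM that]] by (simp add: oo)
  have vz: "sqnorm (?z *\<^sub>v v) = 0" "hform ?z v = 0" if "v \<in> carrier_vec n" for v
    using that by (simp_all add: sqnorm_def hform_def)
  have az: "mat_adjoint ?z = ?z" by (intro eq_matI) auto
  have neg: "hform ((- 1) \<cdot>\<^sub>m (mat_adjoint B * B)) v = - complex_of_real (sqnorm (B *\<^sub>v v))"
    if "B \<in> carrier_mat m n" "v \<in> carrier_vec n" for B m v
    using hform_smult[of "mat_adjoint B * B" n v "- 1"] that hform_adjoint_mult[OF that] by (simp add: mult_carrier_mat[where n=m])
  have main: "f (bimult V \<alpha> w \<beta>) \<le> P (\<alpha> * mat_adjoint \<alpha>) + Q (mat_adjoint \<beta> * \<beta>)"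
    if h: "0 < m" "\<alpha> \<in> carrier_mat n m" "\<beta> \<in> carrier_mat m n" "w \<in> near_pos d m" for m \<alpha> \<beta> w
  proof -
    have wM: "w \<in> Mat V m" using h(4) by (simp add: near_pos_def)
    have bM: "bimult V \<alpha> w \<beta> \<in> Mat V n" by (rule Mat_bimult[OF wM h(2,3)])
    let ?s = "\<alpha> * mat_adjoint \<alpha>" and ?u = "mat_adjoint \<beta> * \<beta>"
    have su: "?s \<in> carrier_mat n n" "?u \<in> carrier_mat n n" using h by auto
    \<comment> \<open>All three coordinates are the negatives of what the factorization contributes,
      so the bound \<open>0\<close> with \<open>r = 0\<close> is admissible.\<close>
    have "(((- 1) \<cdot>\<^sub>m ?s, (- 1) \<cdot>\<^sub>m ?u, mscale V (- 1) (bimult V \<alpha> w \<beta>)), 0) \<in> ?G"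
    proof (rule factor_coneI[OF _ _ Mat_mscale[OF bM] h])
      have "mscale V (- 1) (bimult V \<alpha> w \<beta>) + bimult V \<alpha> w \<beta> = ?o" by (rule mat_add_neg[OF bM])
      then show "mscale V (- 1) (bimult V \<alpha> w \<beta>) + bimult V \<alpha> w \<beta> = mscale V (complex_of_real 0) x0"
        using mscale_zero[OF x0(1)] by simp
      show "Re (hform ((- 1) \<cdot>\<^sub>m ?s) v) + sqnorm (mat_adjoint \<alpha> *\<^sub>v v) \<le> 0 * sqnorm v" if "v \<in> carrier_vec n" for v
        using neg[OF adjoint_carrier[OF h(2)] that] by simp
      show "Re (hform ((- 1) \<cdot>\<^sub>m ?u) v) + sqnorm (\<beta> *\<^sub>v v) \<le> 0 * sqnorm v" if "v \<in> carrier_vec n" for v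
        using neg[OF h(3) that] by simp
    qed (use su in auto)
    then have "l ((- 1) \<cdot>\<^sub>m ?s, (- 1) \<cdot>\<^sub>m ?u, mscale V (- 1) (bimult V \<alpha> w \<beta>)) \<le> 0" by (rule l_le)
    moreover have "l ((- 1) \<cdot>\<^sub>m ?s, (- 1) \<cdot>\<^sub>m ?u, mscale V (- 1) (bimult V \<alpha> w \<beta>)) = - l (?s, ?u, bimult V \<alpha> w \<beta>)"
      using l0(2)[of "(?s, ?u, bimult V \<alpha> w \<beta>)" "- 1"] su bM by simp
    ultimately show ?thesis using lsum[OF su bM] by simp
  qed
  have f_x0: "2 * (2 * k) \<le> f x0"
  proof -
    \<comment> \<open>The zero factorization with \<open>r = 1\<close>: here the target
      \<open>x0\<close> itself enters, with \<open>C = 2 * k\<close>.\<close>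
    have "((?z, ?z, x0), 0 + 0 - 2 * 1 * (2 * k)) \<in> ?G"
      using b0[of ?z ?z] x0(1) by (intro factor_coneI[OF _ _ x0(1) n _ _ n0, where \<alpha>="?z" and \<beta>="?z" and b=0 and c=0 and r=1]) (auto simp: Mat_add_zero vz az)
    then have "l (?z, ?z, x0) \<le> 0 + 0 - 2 * 1 * (2 * k)" by (rule l_le)
    then show ?thesis by (simp add: f_def)
  qed
  have f0: "f ?o = 0" using fscale[OF oM, of 0] by (simp add: oo)
  have P0: "P ?z = 0" using Pscale[of ?z 0] by (simp add: zz)
  have Q0: "Q ?z = 0" using Qscale[of ?z 0] by (simp add: zz)
  have hform_one: "Re (hform (1\<^sub>m n) v) = sqnorm v" if "v \<in> carrier_vec n" for v
    using hform_adjoint_mult[OF one_carrier_mat that] that by simp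
  have P1: "P (1\<^sub>m n) \<le> 1"
  proof -
    have "((1\<^sub>m n, ?z, ?o), 1 + 0 - 2 * 0 * (2 * k)) \<in> ?G"
      using b0[of ?z ?z] mscale_zero[OF x0(1)]
      by (intro factor_coneI[OF _ _ oM n _ _ n0, where \<alpha>="?z" and \<beta>="?z" and b=1 and c=0 and r=0]) (auto simp: oo vz az hform_one)
    then have "l (1\<^sub>m n, ?z, ?o) \<le> 1 + 0 - 2 * 0 * (2 * k)" by (rule l_le)
    then show ?thesis by (simp add: P_def)
  qed
  have Q1: "Q (1\<^sub>m n) \<le> 1"
  proof -
    have "((?z, 1\<^sub>m n, ?o), 0 + 1 - 2 * 0 * (2 * k)) \<in> ?G"
      using b0[of ?z ?z] mscale_zero[OF x0(1)]
      by (intro factor_coneI[OF _ _ oM n _ _ n0, where \<alpha>="?z" and \<beta>="?z" and b=0 and c=1 and r=0]) (auto simp: oo vz az hform_one)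
    then have "l (?z, 1\<^sub>m n, ?o) \<le> 0 + 1 - 2 * 0 * (2 * k)" by (rule l_le)
    then show ?thesis by (simp add: Q_def)
  qed
  have one: "0 < (1::nat)" by simp
  have n01: "0\<^sub>m 1 1 \<in> near_pos d 1" by (rule near_pos_cone[OF one _ cone_zero[OF one]]) (use d norm_zero[OF one] in auto)
  have b01: "bimult V \<alpha> (0\<^sub>m 1 1) \<beta> = ?o" if "\<alpha> \<in> carrier_mat n 1" "\<beta> \<in> carrier_mat 1 n" for \<alpha> \<beta>
    using bimult_mscale[OF Mat_zero[of 1], of \<alpha> 0 \<beta>] mscale_zero[OF Mat_bimult[OF Mat_zero that]] by simp
  have Ppos: "0 \<le> P (v * mat_adjoint v)" if v: "v \<in> carrier_mat n 1" for v
  proof -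
    have "mat_adjoint (0\<^sub>m 1 n) * 0\<^sub>m 1 n = ?z" by (intro eq_matI) (auto simp: scalar_prod_def)
    \<comment> \<open>Positivity of \<open>P\<close> is the domination at the factorization of zero
      with left factor \<open>v\<close> and right factor zero.\<close>
    then show ?thesis using main[OF one v _ n01, of "0\<^sub>m 1 n"] b01[OF v, of "0\<^sub>m 1 n"] f0 Q0 by simp
  qed
  have Qpos: "0 \<le> Q (v * mat_adjoint v)" if v: "v \<in> carrier_mat n 1" for v
  proof -
    have "0\<^sub>m n 1 * mat_adjoint (0\<^sub>m n 1) = ?z" by (intro eq_matI) (auto simp: scalar_prod_def)
    then show ?thesis
      using main[OF one _ adjoint_carrier[OF v] n01, of "0\<^sub>m n 1"] b01[OF _ adjoint_carrier[OF v], of "0\<^sub>m n 1"] f0 P0 by simp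
  qed
  \<comment> \<open>Each root gains \<open>e * n = 1 / 2\<close> in squared Hilbert-Schmidt norm, so
    the two together stay at most 3, below the critical 4.\<close>
  define e where "e = 1 / (2 * real n)"
  have e: "0 < e" "e * real n = 1 / 2" using n by (auto simp: e_def)
  obtain R R' where R: "R \<in> carrier_mat n n" "R' \<in> carrier_mat n n" "R * R' = 1\<^sub>m n" "R' * R = 1\<^sub>m n"
    and RP0: "\<forall>m. \<forall>A\<in>carrier_mat n m. P (A * mat_adjoint A) \<le> hs_sqnorm (R * A)" and hR: "hs_sqnorm R = P (1\<^sub>m n) + e * n"
  proof -
    have "\<exists>R R'. R \<in> carrier_mat n n \<and> R' \<in> carrier_mat n n \<and> R * R' = 1\<^sub>m n \<and> R' * R = 1\<^sub>m n \<and>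
        (\<forall>m. \<forall>A\<in>carrier_mat n m. P (A * mat_adjoint A) \<le> hs_sqnorm (R * A)) \<and> hs_sqnorm R = P (1\<^sub>m n) + e * n"
      by (rule positive_functional_root) (rule Padd Pscale Ppos e(1) | assumption)+
    then show thesis by (elim exE conjE) (rule that)
  qed
  note RP = RP0[rule_format]
  obtain S0 S0' where S0: "S0 \<in> carrier_mat n n" "S0' \<in> carrier_mat n n" "S0 * S0' = 1\<^sub>m n" "S0' * S0 = 1\<^sub>m n"
    and SQ0: "\<forall>m. \<forall>A\<in>carrier_mat n m. Q (A * mat_adjoint A) \<le> hs_sqnorm (S0 * A)" and hS0: "hs_sqnorm S0 = Q (1\<^sub>m n) + e * n"
  proof -
    have "\<exists>R R'. R \<in> carrier_mat n n \<and> R' \<in> carrier_mat n n \<and> R * R' = 1\<^sub>m n \<and> R' * R = 1\<^sub>m n \<and>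
        (\<forall>m. \<forall>A\<in>carrier_mat n m. Q (A * mat_adjoint A) \<le> hs_sqnorm (R * A)) \<and> hs_sqnorm R = Q (1\<^sub>m n) + e * n"
      by (rule positive_functional_root) (rule Qadd Qscale Qpos e(1) | assumption)+
    then show thesis by (elim exE conjE) (rule that)
  qed
  note SQ = SQ0[rule_format]
  \<comment> \<open>The density of \<open>Q\<close> acts on the right factor, hence the passage to
    adjoints.\<close>
  define S S' where "S = mat_adjoint S0" and "S' = mat_adjoint S0'"
  have S: "S \<in> carrier_mat n n" "S' \<in> carrier_mat n n" using S0 by (auto simp: S_def S'_def)
  have SS: "S' * S = 1\<^sub>m n" "S * S' = 1\<^sub>m n"
    unfolding S_def S'_def adjoint_mult[OF S0(1,2), symmetric] adjoint_mult[OF S0(2,1), symmetric] S0(3,4) adjoint_one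
    by (rule refl)+
  have QS: "Q (mat_adjoint \<beta> * \<beta>) \<le> hs_sqnorm (\<beta> * S)" if "\<beta> \<in> carrier_mat m n" for \<beta> m
  proof -
    have "Q (mat_adjoint \<beta> * \<beta>) \<le> hs_sqnorm (S0 * mat_adjoint \<beta>)" using SQ[OF adjoint_carrier[OF that]] by simp
    also have "S0 * mat_adjoint \<beta> = mat_adjoint (\<beta> * S)" using adjoint_mult[OF that S(1)] by (simp add: S_def)
    finally show ?thesis by simp
  qed
  \<comment> \<open>Absorbing the inverse roots converts the bound by \<open>P\<close> and
    \<open>Q\<close> into one by Hilbert-Schmidt norms.\<close>
  define g where "g y = f (bimult V R' y S')" for y
  have bM: "bimult V R' y S' \<in> Mat V n" if "y \<in> Mat V n" for y by (rule Mat_bimult[OF that R(2) S(2)])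
  have gadd: "g (x + y) = g x + g y" if "x \<in> Mat V n" "y \<in> Mat V n" for x y
    unfolding g_def bimult_add[OF that] using that by (intro fadd bM)
  have gscale: "g (mscale V (complex_of_real t) x) = t * g x" if "x \<in> Mat V n" for t x
    unfolding g_def bimult_mscale[OF that] using that by (intro fscale bM)
  have main': "g (bimult V \<alpha> w \<beta>) \<le> hs_sqnorm \<alpha> + hs_sqnorm \<beta>"
    if h: "0 < m" "\<alpha> \<in> carrier_mat n m" "\<beta> \<in> carrier_mat m n" "w \<in> near_pos d m" for m \<alpha> \<beta> w
  proof -
    have wM: "w \<in> Mat V m" using h(4) by (simp add: near_pos_def)
    have c: "R' * \<alpha> \<in> carrier_mat n m" "\<beta> * S' \<in> carrier_mat m n" using R S h by auto
    have "g (bimult V \<alpha> w \<beta>) = f (bimult V (R' * \<alpha>) w (\<beta> * S'))"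
      unfolding g_def bimult_bimult[OF wM R(2) h(2,3) S(2)] ..
    also have "\<dots> \<le> hs_sqnorm (R * (R' * \<alpha>)) + hs_sqnorm ((\<beta> * S') * S)"
      using main[OF h(1) c h(4)] RP[OF c(1)] QS[OF c(2)] by linarith
    also have "R * (R' * \<alpha>) = \<alpha>" using assoc_mult_mat[OF R(1,2) h(2)] R(3) h(2) by simp
    also have "(\<beta> * S') * S = \<beta>" using assoc_mult_mat[OF h(3) S(2,1)] SS(1) h(3) by simp
    finally show ?thesis .
  qed
  \<comment> \<open>Boundedness comes from the ball of radius \<open>d\<close> in
    \<open>near_pos\<close>. The constant depends on \<open>d\<close> and serves only to make the
    functional an element of the dual.\<close>
  have gb: "g z \<le> (2 * real n / d) * mnorm V z" if z: "z \<in> Mat V n" for z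
  proof (cases "mnorm V z = 0")
    case True
    then have "z = ?o" using norm_zero_iff[OF n z] by simp
    then have "mscale V (complex_of_real 0) z = z" using oo by simp
    then show ?thesis using gscale[OF z, of 0] True by simp
  next
    case False
    define t where "t = mnorm V z / d"
    have t: "0 < t" using False norm_nonneg[OF n z] d by (simp add: t_def)
    let ?s = "complex_of_real (sqrt t)" and ?w = "mscale V (complex_of_real (1 / t)) z"
    have sq: "?s * ?s = complex_of_real t" "(cmod ?s)\<^sup>2 = t" using t by (simp_all flip: of_real_mult)
    have w: "?w \<in> Mat V n" by (rule Mat_mscale[OF z])
    have td: "mnorm V z = t * d" using d by (simp add: t_def)
    have nw: "mnorm V ?w \<le> d" unfolding norm_mscale[OF n z] norm_of_real td using t by simp
    have "bimult V (?s \<cdot>\<^sub>m 1\<^sub>m n) ?w (?s \<cdot>\<^sub>m 1\<^sub>m n) = z"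
      unfolding bimult_scalar[OF w] sq mscale_mscale using t by (simp flip: of_real_mult)
    then have "g z \<le> hs_sqnorm (?s \<cdot>\<^sub>m 1\<^sub>m n) + hs_sqnorm (?s \<cdot>\<^sub>m 1\<^sub>m n)"
      using main'[OF n _ _ near_pos_ball[OF n w nw], of "?s \<cdot>\<^sub>m 1\<^sub>m n" "?s \<cdot>\<^sub>m 1\<^sub>m n"] by simp
    also have "\<dots> = (2 * real n / d) * mnorm V z" unfolding hs_sqnorm_one_smult sq td using d by simp
    finally show ?thesis .
  qed
  have gabs: "\<bar>g z\<bar> \<le> (2 * real n / d) * mnorm V z" if z: "z \<in> Mat V n" for z
  proof -
    have "mnorm V (mscale V (complex_of_real (- 1)) z) = mnorm V z"
      unfolding norm_mscale[OF n z] norm_of_real by simp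
    then have "- g z \<le> (2 * real n / d) * mnorm V z"
      using gb[OF Mat_mscale[OF z, of "complex_of_real (- 1)"]] gscale[OF z, of "- 1"] by (simp only: mult_minus1)
    then show ?thesis using gb[OF z] by (simp only: abs_le_iff)
  qed
  obtain F where F: "F \<in> Mat (dual V) n" and Fg: "\<And>x. x \<in> Mat V n \<Longrightarrow> Re (pair F x) = g x"
    using functional_pair[OF n gadd gscale gabs] by blast
  have Fb: "cmod (pair F (bimult V \<alpha> w \<beta>)) \<le> hs_sqnorm \<alpha> + hs_sqnorm \<beta>"
    if h: "0 < m" "\<alpha> \<in> carrier_mat n m" "\<beta> \<in> carrier_mat m n" "w \<in> near_pos d m" for m \<alpha> \<beta> w
  proof -
    have wM: "w \<in> Mat V m" using h(4) by (simp add: near_pos_def)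
    define c where "c = pair F (bimult V \<alpha> w \<beta>)"
    define u where "u = (if c = 0 then 1 else cnj c / cmod c)"
    have u: "cmod u = 1" "u * c = cmod c"
      using complex_norm_square[of c] by (auto simp: u_def norm_divide power2_eq_square field_simps)
    have "pair F (bimult V (u \<cdot>\<^sub>m \<alpha>) w \<beta>) = cmod c"
      unfolding bimult_smult_left[OF wM h(2)] pair_mscale_right[OF F Mat_bimult[OF wM h(2,3)]] using u by (simp add: c_def)
    then have "cmod c = g (bimult V (u \<cdot>\<^sub>m \<alpha>) w \<beta>)"
      using Fg[OF Mat_bimult[OF wM smult_carrier_mat[OF h(2)] h(3)], of u] by simp
    also have "\<dots> \<le> hs_sqnorm (u \<cdot>\<^sub>m \<alpha>) + hs_sqnorm \<beta>" by (rule main'[OF h(1) smult_carrier_mat[OF h(2)] h(3,4)])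
    finally show ?thesis by (simp add: c_def hs_sqnorm_smult u)
  qed
  \<comment> \<open>Halving replaces the sum of the squared norms by their mean, as
    \<open>num_radius_dual_le\<close> demands.\<close>
  define F2 where "F2 = mscale (dual V) (1 / 2) F"
  have F2: "F2 \<in> Mat (dual V) n" unfolding F2_def by (rule D.Mat_mscale[OF F])
  have pF2: "pair F2 z = pair F z / 2" for z unfolding F2_def pair_mscale_left[OF F] by simp
  have F2b: "cmod (pair F2 (bimult V \<alpha> w \<beta>)) \<le> (hs_sqnorm \<alpha> + hs_sqnorm \<beta>) / 2"
    if h: "0 < m" "\<alpha> \<in> carrier_mat n m" "\<beta> \<in> carrier_mat m n" "w \<in> near_pos d m" for m \<alpha> \<beta> w
    using Fb[OF h] unfolding pF2 norm_divide by simp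
  have nr1: "num_radius (dual V) n F2 \<le> 1"
  proof (rule num_radius_dual_le[OF n F2])
    show "cmod (pair F2 (bimult V \<alpha> y \<beta>)) \<le> (hs_sqnorm \<alpha> + hs_sqnorm \<beta>) / 2"
      if "0 < m" "y \<in> mcone V m" "mnorm V y \<le> 1" "\<alpha> \<in> carrier_mat n m" "\<beta> \<in> carrier_mat m n" for m y \<alpha> \<beta>
      by (rule F2b[OF that(1,4,5) near_pos_cone[OF that(1) less_imp_le[OF d] that(2,3)]])
  qed
  have "cb_norm V F2 \<le> k * num_radius (dual V) n F2" by (rule nr[OF F2])
  also have "\<dots> \<le> k" using nr1 k by simp
  finally have cb: "cb_norm V F2 \<le> k" .
  \<comment> \<open>A crude bound on all contractions. It makes the supremum in
    \<open>cb_norm\<close> bounded above, so that \<open>cb_norm\<close> really dominates the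
    amplification at \<open>x0\<close>.\<close>
  have "cmod (pair F2 (bimult V \<alpha> x \<beta>)) \<le> (1 / d) * (hs_sqnorm \<alpha> + hs_sqnorm \<beta>) / 2"
    if h: "0 < m" "x \<in> Mat V m" "mnorm V x \<le> 1" "\<alpha> \<in> carrier_mat n m" "\<beta> \<in> carrier_mat m n" for m x \<alpha> \<beta>
  proof -
    let ?w = "mscale V (complex_of_real d) x"
    have w: "?w \<in> near_pos d m"
      by (rule near_pos_ball[OF h(1) Mat_mscale[OF h(2)]]) (use norm_mscale[OF h(1,2)] h(3) d in simp)
    have "cmod (pair F2 (bimult V \<alpha> ?w \<beta>)) = d * cmod (pair F2 (bimult V \<alpha> x \<beta>))"
      unfolding bimult_mscale[OF h(2)] pair_mscale_right[OF F2 Mat_bimult[OF h(2,4,5)]] norm_mult norm_of_real using d by simp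
    then have "d * cmod (pair F2 (bimult V \<alpha> x \<beta>)) \<le> (hs_sqnorm \<alpha> + hs_sqnorm \<beta>) / 2" using F2b[OF h(1,4,5) w] by simp
    then show ?thesis using d by (simp add: field_simps)
  qed
  from cb_norm_le(2)[OF F2 divide_pos_pos[OF _ d] this n x0]
  have "op_norm (amplification F2 x0) \<le> cb_norm V F2" by simp
  then have op: "op_norm (amplification F2 x0) \<le> k" using cb by simp
  have "2 * k \<le> cmod (pair F2 (bimult V R x0 S))"
  proof -
    have "bimult V R' (bimult V R x0 S) S' = x0"
      unfolding bimult_bimult[OF x0(1) R(2,1) S] R(4) SS(2) by (rule bimult_one[OF x0(1)])
    then have "Re (pair F (bimult V R x0 S)) = f x0"
      using Fg[OF Mat_bimult[OF x0(1) R(1) S(1)]] by (simp add: g_def)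
    then have "2 * (2 * k) \<le> cmod (pair F (bimult V R x0 S))"
      using f_x0 complex_Re_le_cmod[of "pair F (bimult V R x0 S)"] by linarith
    then show ?thesis unfolding pF2 norm_divide by simp
  qed
  also have "\<dots> \<le> op_norm (amplification F2 x0) * (hs_sqnorm R + hs_sqnorm S) / 2"
    by (rule cmod_pair_le[OF F2 x0(1) R(1) S(1)])
  also have "\<dots> \<le> k * 3 / 2"
  proof -
    have "hs_sqnorm R + hs_sqnorm S \<le> 3" using hR hS0 P1 Q1 e(2) by (simp add: S_def)
    then have "op_norm (amplification F2 x0) * (hs_sqnorm R + hs_sqnorm S) \<le> k * 3"
      using op k by (intro mult_mono) auto
    then show ?thesis by simp
  qed
  finally show False using k by simp
qed

text \<open>For \<open>x = \<alpha> w \<beta>\<close> with \<open>w\<close> close to the positive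
  \<open>y\<close>, conjugating \<open>y\<close> by the column of \<open>\<alpha>\<close> and the
  adjoint of \<open>\<beta>\<close> gives a positive block matrix with corner
  \<open>\<alpha> y \<beta>\<close>. The squared norm of the column is at most
  \<open>2 * k + 2 * k\<close>.\<close>

lemma approximate_corner:
  assumes n: "0 < n" and k: "0 < k"
    and nr: "\<And>F. F \<in> Mat (dual V) n \<Longrightarrow> cb_norm V F \<le> k * num_radius (dual V) n F"
    and x: "x \<in> Mat V n"
  shows "\<exists>z\<in>mcone V (n + n). mnorm V z \<le> (4 * k) * mnorm V x \<and> mnorm V (x - blk n True False z) \<le> mnorm V x / 2"
proof -
  have nn: "0 < n + n" using n by simp
  have unit: "\<exists>z\<in>mcone V (n + n). mnorm V z \<le> 4 * k \<and> mnorm V (x - blk n True False z) \<le> 1 / 2"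
    if x: "x \<in> Mat V n" "mnorm V x \<le> 1" for x
  proof -
    \<comment> \<open>Replacing \<open>w\<close> by \<open>y\<close> costs at most
      \<open>2 * k * d\<close>, which this choice makes 1/2.\<close>
    define d where "d = 1 / (4 * k)"
    have d: "0 < d" using k by (simp add: d_def)
    obtain m \<alpha> \<beta> w where h: "0 < m" "\<alpha> \<in> carrier_mat n m" "\<beta> \<in> carrier_mat m n" "w \<in> near_pos d m"
        "sq_bounded (2 * k) (mat_adjoint \<alpha>)" "sq_bounded (2 * k) \<beta>" "x = bimult V \<alpha> w \<beta>"
      using near_pos_factorization[OF n x k d nr] by blast
    obtain y where w: "w \<in> Mat V m" and y: "y \<in> mcone V m" "mnorm V y \<le> 1" "mnorm V (w - y) \<le> d"
      using h(4) unfolding near_pos_def mem_Collect_eq by (elim conjE bexE)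
    have yM: "y \<in> Mat V m" by (rule cone_Mat[OF h(1) y(1)])
    have ba: "sq_bounded (2 * k) \<alpha>" "sq_bounded (2 * k) (mat_adjoint \<beta>)"
      using sq_bounded_adjoint[OF h(5)] sq_bounded_adjoint[OF h(6)] k by simp_all
    define G where "G = inj1 n n * \<alpha> + inj2 n n * mat_adjoint \<beta>"
    have \<beta>a: "mat_adjoint \<beta> \<in> carrier_mat n m" by (rule adjoint_carrier[OF h(3)])
    have G: "G \<in> carrier_mat (n + n) m" unfolding G_def by (rule add_carrier_mat, rule mult_carrier_mat[OF inj_carrier(2) \<beta>a])
    have bG: "sq_bounded (4 * k) G"
      unfolding sq_bounded_def
    proof
      fix v :: "complex vec" assume "v \<in> carrier_vec (dim_col G)"
      then have v: "v \<in> carrier_vec m" using G by simp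
      show "sqnorm (G *\<^sub>v v) \<le> 4 * k * sqnorm v"
        unfolding G_def sqnorm_inj_sum[OF h(2) \<beta>a v] using sq_boundedD[OF ba(1) h(2) v] sq_boundedD[OF ba(2) \<beta>a v] by simp
    qed
    define z where "z = bimult V G y (mat_adjoint G)"
    have z: "z \<in> mcone V (n + n)" unfolding z_def by (rule cone_bimult[OF h(1) nn y(1) G])
    have "mnorm V z \<le> 4 * k * mnorm V y"
      unfolding z_def using k by (intro norm_conj_le[OF h(1) nn yM G bG]) simp
    also have "\<dots> \<le> 4 * k" using y(2) k by simp
    finally have nz: "mnorm V z \<le> 4 * k" .
    have g: "mat_adjoint (inj1 n n) * G = \<alpha>" "mat_adjoint (inj2 n n) * G = mat_adjoint \<beta>"
      unfolding G_def using adj_inj1_sum[OF h(2) \<beta>a] by simp_all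
    have "mat_adjoint G * inj2 n n = mat_adjoint (mat_adjoint (inj2 n n) * G)"
      using adjoint_mult[OF adjoint_carrier[OF inj_carrier(2)] G] by simp
    then have g2: "mat_adjoint G * inj2 n n = \<beta>" unfolding g by simp
    have bz: "blk n True False z = bimult V \<alpha> y \<beta>"
      unfolding blk_def z_def using bimult_bimult[OF yM adjoint_carrier[OF inj_carrier(1)] G adjoint_carrier[OF G] inj_carrier(2)] g g2 by simp
    have wy: "w - y \<in> Mat V m" by (rule Mat_minus[OF w yM])
    have "x - blk n True False z = bimult V \<alpha> (w - y) \<beta>"
      unfolding bz h(7) minus_mscale[OF w yM] bimult_add[OF w Mat_mscale[OF yM]] bimult_mscale[OF yM]
      by (rule minus_mscale[OF Mat_bimult[OF w h(2,3)] Mat_bimult[OF yM h(2,3)]])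
    moreover have "mnorm V (bimult V \<alpha> (w - y) \<beta>) \<le> sqrt (2 * k) * mnorm V (w - y) * sqrt (2 * k)"
      using k by (intro norm_bimult_le[OF h(1) n wy h(2,3) ba(1) h(6)]) simp_all
    moreover have "sqrt (2 * k) * mnorm V (w - y) * sqrt (2 * k) = 2 * k * mnorm V (w - y)"
    proof -
      have "sqrt (2 * k) * mnorm V (w - y) * sqrt (2 * k) = (sqrt (2 * k) * sqrt (2 * k)) * mnorm V (w - y)" by (simp only: mult_ac)
      also have "sqrt (2 * k) * sqrt (2 * k) = 2 * k" using k by simp
      finally show ?thesis .
    qed
    moreover have "2 * k * mnorm V (w - y) \<le> 2 * k * d" using y(3) k by (intro mult_left_mono) auto
    moreover have "2 * k * d = 1 / 2" using k by (simp add: d_def)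
    ultimately show ?thesis using z nz by (intro bexI[of _ z]) auto
  qed
  show ?thesis
  proof (cases "mnorm V x = 0")
    case True
    then have x: "x = 0\<^sub>m n n" using norm_zero_iff[OF n x] by simp
    have "x - blk n True False (0\<^sub>m (n + n) (n + n)) = 0\<^sub>m n n"
      unfolding x by (intro eq_matI) (auto simp: blk_index[OF Mat_zero])
    then show ?thesis using True cone_zero[OF nn] norm_zero[OF nn] norm_zero[OF n] by (intro bexI[of _ "0\<^sub>m (n + n) (n + n)"]) auto
  next
    case False
    define t where "t = mnorm V x"
    have t: "0 < t" using False norm_nonneg[OF n x] by (simp add: t_def)
    \<comment> \<open>General elements are normalized, and the block matrix found is scaled back by
      their norm.\<close>
    let ?x = "mscale V (complex_of_real (1 / t)) x" and ?t = "complex_of_real t"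
    have xM: "?x \<in> Mat V n" by (rule Mat_mscale[OF x])
    have "mnorm V ?x \<le> 1" unfolding norm_mscale[OF n x] norm_of_real t_def[symmetric] using t by simp
    then obtain z where z: "z \<in> mcone V (n + n)" "mnorm V z \<le> 4 * k" "mnorm V (?x - blk n True False z) \<le> 1 / 2"
      using unit[OF xM] by blast
    have zM: "z \<in> Mat V (n + n)" by (rule cone_Mat[OF nn z(1)])
    let ?z = "mscale V ?t z"
    have "?z \<in> mcone V (n + n)" using cone_scale[OF nn z(1), of t] t by simp
    moreover have "mnorm V ?z \<le> 4 * k * t"
      unfolding norm_mscale[OF nn zM] norm_of_real using z(2) t by simp
    moreover have "x - blk n True False ?z = mscale V ?t (?x - blk n True False z)"
    proof -
      have "?t * complex_of_real (1 / t) = 1" using t by (simp flip: of_real_mult)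
      then have "mscale V ?t ?x = x" unfolding mscale_mscale by (simp only: mscale_one)
      then show ?thesis unfolding mscale_minus[OF xM Mat_blk[OF zM]] blk_mscale[OF zM] by (simp only:)
    qed
    moreover have "mnorm V (mscale V ?t (?x - blk n True False z)) \<le> t / 2"
      unfolding norm_mscale[OF n Mat_minus[OF xM Mat_blk[OF zM]]] norm_of_real using z(3) t by simp
    ultimately show ?thesis unfolding t_def[symmetric] by (intro bexI[of _ ?z]) auto
  qed
qed

end

theorem theorem3p4:
  fixes V :: "('a::ab_group_add) mo_space"
  assumes "matrix_ordered_operator_space V"
    and "operator_system V" and "complete_norm V"
    and "operator_system (dual V)" and "complete_norm (dual V)"
  shows "\<exists>W :: 'a mo_space. matrix_regular W \<and> (\<exists>\<Phi>. complete_order_isomorphism V W \<Phi>)"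
proof -
  interpret dual_mo_op_space V
    by (intro dual_mo_op_space.intro mo_op_space.intro) (use assms(1,4) in \<open>auto simp only: operator_system_def\<close>)
  obtain k where k: "0 < k" and kV: "\<And>n x. 0 < n \<Longrightarrow> x \<in> Mat V n \<Longrightarrow> mnorm V x \<le> k * num_radius V n x"
    using assms(2) unfolding operator_system_def by blast
  obtain k' where k': "0 < k'" and kD: "\<And>n F. 0 < n \<Longrightarrow> F \<in> Mat (dual V) n \<Longrightarrow> cb_norm V F \<le> k' * num_radius (dual V) n F"
    using assms(4) unfolding operator_system_def dual_simps by blast
  \<comment> \<open>The constant \<open>4 * k'\<close> of \<open>approximate_corner\<close>, doubled
    by the geometric series in \<open>cone_corner_exact\<close>.\<close>
  define C where "C = 2 * (4 * k')"
  interpret generated_space V k C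
  proof
    show "0 < k" "0 < C" using k k' by (simp_all add: C_def)
    fix n :: nat assume n: "0 < n"
    show "mnorm V x \<le> k * max (mnorm V a) (mnorm V b)" if "pos2 n a x b" for a x b
    proof -
      have "mnorm V x \<le> k * num_radius V n x" using kV[OF n] pos2_Mat[OF n that] by blast
      also have "\<dots> \<le> k * max (mnorm V a) (mnorm V b)" using num_radius_le[OF n that] k by (intro mult_left_mono) auto
      finally show ?thesis .
    qed
    show "\<exists>a b. pos2 n a x b \<and> mnorm V a \<le> C * mnorm V x \<and> mnorm V b \<le> C * mnorm V x" if x: "x \<in> Mat V n" for x
    proof -
      have "0 \<le> 4 * k'" using k' by simp
      then obtain z where z: "z \<in> mcone V (n + n)" "mnorm V z \<le> C * mnorm V x" "blk n True False z = x"
        using cone_corner_exact[OF assms(3) n _ approximate_corner[OF n k' kD[OF n]] x] unfolding C_def by blast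
      have "z \<in> Mat V (n + n)" using n cone_Mat[OF _ z(1)] by simp
      \<comment> \<open>The diagonal blocks inherit the bound because compression by isometries is
        contractive.\<close>
      then have "mnorm V (blk n p q z) \<le> C * mnorm V x" for p q
        using norm_blk_le[OF n] z(2) by (meson order_trans)
      moreover have "pos2 n (blk n True True z) x (blk n False False z)"
        unfolding pos2_def using z by blast
      ultimately show ?thesis by blast
    qed
  qed
  show ?thesis
    using matrix_regular_regularization[OF assms(3)] complete_order_isomorphism_regularization by blast
qed

end
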